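(* If $G$ is an edge-critical graph with maximum degree $4$, then $G$ has average degree at least $3.6$. This is best possible, as shown by $K_5-e$; that is, $K_5-e$ is an edge-critical graph with maximum degree $4$ and average degree exactly $3.6$.
   Context: Graphs are finite and simple. $\Delta(G)$ is the maximum degree of $G$ and $\chi'(G)$ is the edge-chromatic number (the minimum number of colors in an edge-coloring in which any two distinct edges sharing an endpoint get different colors). A graph $G$ with maximum degree $\Delta$ is edge-critical (or $\Delta$-edge-critical) if it is connected, $\chi'(G)>\Delta$, and $\chi'(G-e)\le\Delta$ for every edge $e$ of $G$. The average degree of $G$ is $2|E(G)|/|V(G)|$. $K_5-e$ is the complete graph on 5 vertices with one edge deleted. *)

theory Defs
  imports Complex_Main
begin

text \<open>Undirected graphs. An edge is the set of its two endpoints.\<close>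

record 'a ugraph =
  verts :: "'a set"
  edges :: "'a set set"

definition finite_simple_graph :: "'a ugraph \<Rightarrow> bool" where
  "finite_simple_graph G \<longleftrightarrow>
     finite (verts G) \<and> (\<forall>e \<in> edges G. e \<subseteq> verts G \<and> card e = 2)"

definition degree :: "'a ugraph \<Rightarrow> 'a \<Rightarrow> nat" where
  "degree G v = card {e \<in> edges G. v \<in> e}"

text \<open>For a graph without vertices, \<^term>\<open>Max\<close> is unspecified; such graphs are not connected
  in the sense below.\<close>

definition max_degree :: "'a ugraph \<Rightarrow> nat" where
  "max_degree G = Max (degree G ` verts G)"

definition average_degree :: "'a ugraph \<Rightarrow> real" where
  "average_degree G = 2 * real (card (edges G)) / real (card (verts G))"

definition connected_graph :: "'a ugraph \<Rightarrow> bool" where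
  "connected_graph G \<longleftrightarrow>
     verts G \<noteq> {} \<and> (\<forall>u \<in> verts G. \<forall>v \<in> verts G. (u, v) \<in> {(x, y). {x, y} \<in> edges G}\<^sup>*)"

definition proper_edge_coloring :: "'a ugraph \<Rightarrow> nat \<Rightarrow> ('a set \<Rightarrow> nat) \<Rightarrow> bool" where
  "proper_edge_coloring G k c \<longleftrightarrow>
     c ` edges G \<subseteq> {..<k} \<and>
     (\<forall>e \<in> edges G. \<forall>f \<in> edges G. e \<noteq> f \<and> e \<inter> f \<noteq> {} \<longrightarrow> c e \<noteq> c f)"

definition chromatic_index :: "'a ugraph \<Rightarrow> nat" where
  "chromatic_index G = (LEAST k. \<exists>c. proper_edge_coloring G k c)"

text \<open>The minimum is attained, so \<^const>\<open>chromatic_index\<close> is not an unspecified value.\<close>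

lemma chromatic_index_attained:
  fixes G :: "'a ugraph"
  assumes "finite_simple_graph G"
  shows "\<exists>c. proper_edge_coloring G (chromatic_index G) c"
proof -
  have "edges G \<subseteq> Pow (verts G)" and "finite (Pow (verts G))"
    using assms unfolding finite_simple_graph_def by simp_all blast
  then have "finite (edges G)"
    by (rule finite_subset)
  then obtain c :: "'a set \<Rightarrow> nat" where c: "bij_betw c (edges G) {0..<card (edges G)}"
    using ex_bij_betw_finite_nat by blast
  have "c ` edges G \<subseteq> {..<card (edges G)}"
    using bij_betw_imp_surj_on[OF c] by (simp add: atLeast0LessThan)
  moreover have "c e \<noteq> c f" if "e \<in> edges G" "f \<in> edges G" "e \<noteq> f" for e f
    using inj_onD[OF bij_betw_imp_inj_on[OF c] _ that(1,2)] that(3) by blast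
  ultimately have "proper_edge_coloring G (card (edges G)) c"
    unfolding proper_edge_coloring_def by blast
  then have "\<exists>c. proper_edge_coloring G (card (edges G)) c"
    by (rule exI[of _ c])
  then show ?thesis
    unfolding chromatic_index_def by (rule LeastI)
qed

definition delete_edge :: "'a set \<Rightarrow> 'a ugraph \<Rightarrow> 'a ugraph" where
  "delete_edge e G = \<lparr>verts = verts G, edges = edges G - {e}\<rparr>"

definition edge_critical :: "'a ugraph \<Rightarrow> bool" where
  "edge_critical G \<longleftrightarrow>
     finite_simple_graph G \<and> connected_graph G \<and>
     chromatic_index G > max_degree G \<and>
     (\<forall>e \<in> edges G. chromatic_index (delete_edge e G) \<le> max_degree G)"

definition complete_graph :: "nat \<Rightarrow> nat ugraph" where
  "complete_graph n = \<lparr>verts = {..<n}, edges = {e. e \<subseteq> {..<n} \<and> card e = 2}\<rparr>"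

end

theory Submission
  imports Defs "HOL-Library.Multiset" "HOL-Combinatorics.Transposition"
begin

text \<open>
  \<^bold>\<open>The counting.\<close> Give a vertex of degree \<open>d\<close> the charge \<open>5 * d - 18\<close>, that is \<open>2\<close>, \<open>-3\<close> or
  \<open>-8\<close> for degree 4, 3 or 2; smaller degrees do not occur, because the two ends of an edge of a
  critical graph have degree sum at least 6. The average degree is at least 3.6 if and only if the
  total charge is not negative. So the vertices of degree 4 have to pay for the others. A vertex of
  degree 3 asks each neighbour for 1, and a vertex of degree 4 has at most two neighbours of degree
  3, so it can afford this. A vertex \<open>x\<close> of degree 2 asks both neighbours for 4. A neighbour \<open>y\<close> of
  \<open>x\<close> has only 2, it is \<open>needy\<close>; it collects the missing 2 from its other neighbours, each of which
  splits what it has left evenly between its needy neighbours (\<open>share\<close>). The exact rule is \<open>send\<close>, which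
  also moves some charge towards adjacent vertices of degree 3. The collection succeeds
  (\<open>needy_receives\<close>) because too many vertices of degree 3 and needy vertices near each other would form
  one of twenty-seven small configurations, subgraphs with prescribed degrees in \<open>G\<close>, and these do not
  occur in critical graphs.

  \<^bold>\<open>The configurations.\<close> Suppose that the edge set \<open>H\<close> of a configuration is in \<open>G\<close>. The graph \<open>G\<close>
  without one edge of \<open>H\<close> has a 4-colouring; uncolour the rest of \<open>H\<close>. What matters for completing the
  colouring is its \<^emph>\<open>state\<close>: which colours are free at which vertices of the configuration. Exchanging
  two colours on Kempe chains changes the state. One does not know which vertices are ends of the same
  chain, but a chain has at most two ends (\<open>kempe_component_two_ends\<close>), so there are only finitely many
  pairings. A state is refuted if the edges of \<open>H\<close> can be coloured from the free colours, or if for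
  some two colours every pairing allows an exchange that leads to a refuted state. If all possible
  states are refuted then \<open>G\<close> is 4-colourable after all. The search is kept small by adding the edges
  of \<open>H\<close> one at a time and keeping after each edge only a few normal forms to which all unrefuted
  states can be brought. \<open>reducible\<close> checks a certificate for such a search, \<open>reducible_configuration\<close>
  is its correctness, and the simplifier evaluates it for each configuration.

  \<^bold>\<open>Sharpness.\<close> A colour class on five vertices has at most two edges, and the complete graph on
  five vertices without an edge has nine, which is more than four times two; without another edge the
  remaining eight edges split into four pairs of disjoint edges.
\<close>

section \<open>Kempe chains\<close>

text \<open>A longest path from the end \<open>u\<close> is closed under adjacency: an inner vertex has both its neighbours on
  the path already. So the path exhausts the component, and its last vertex is the only other end.\<close>
lemma path_component_two_ends:
  fixes R :: "'a \<Rightarrow> 'a \<Rightarrow> bool"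
  assumes sym: "\<And>x y. R x y \<Longrightarrow> R y x" and V: "finite V" "\<And>x y. R x y \<Longrightarrow> x \<in> V \<and> x \<noteq> y"
    and two: "\<And>x a b c. R x a \<Longrightarrow> R x b \<Longrightarrow> R x c \<Longrightarrow> a = b \<or> a = c \<or> b = c"
    and ends: "\<And>x a b. x \<in> {u, v, w} \<Longrightarrow> R x a \<Longrightarrow> R x b \<Longrightarrow> a = b"
    and conn: "R\<^sup>*\<^sup>* u v" "R\<^sup>*\<^sup>* u w"
    and dist: "u \<noteq> v" "u \<noteq> w" "v \<noteq> w"
  shows False
proof -
  define P where "P = {p. p \<noteq> [] \<and> hd p = u \<and> distinct p \<and> successively R p}"
  have "p \<in> P \<Longrightarrow> set p \<subseteq> insert u V" for p
  proof
    fix x assume p: "p \<in> P" and x: "x \<in> set p"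
    then obtain i where i: "i < length p" "p ! i = x" by (auto simp: in_set_conv_nth)
    show "x \<in> insert u V"
    proof (cases i)
      case 0 then show ?thesis using i p by (auto simp: P_def hd_conv_nth)
    next
      case (Suc j)
      have "R (p ! j) (p ! Suc j)" using p i(1) Suc by (simp add: P_def successively_conv_nth)
      then show ?thesis using V(2) sym i Suc by blast
    qed
  qed
  then have len: "p \<in> P \<Longrightarrow> length p < Suc (card (insert u V))" for p
    using V(1) by (metis (mono_tags, lifting) P_def card_mono distinct_card finite_insert
      le_imp_less_Suc mem_Collect_eq)
  have "[u] \<in> P" by (simp add: P_def)
  then obtain p where p: "p \<in> P" and max: "\<And>q. q \<in> P \<Longrightarrow> length q \<le> length p"
    using ex_has_greatest_nat[of "\<lambda>p. p \<in> P" _ length] len by (metis less_or_eq_imp_le)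
  have nth: "p \<noteq> []" "p ! 0 = u" "distinct p" "\<And>i. Suc i < length p \<Longrightarrow> R (p ! i) (p ! Suc i)"
    using p by (auto simp: P_def hd_conv_nth successively_conv_nth)
  have inner: "p ! i \<in> {p ! 0, p ! (length p - 1)} \<or>
      (R (p ! i) (p ! (i - 1)) \<and> R (p ! i) (p ! Suc i) \<and> p ! (i - 1) \<noteq> p ! Suc i \<and> Suc i < length
        p)"
    if "i < length p" for i
  proof (cases "i = 0 \<or> i = length p - 1")
    case False
    then have "Suc i < length p" "i \<noteq> 0" using that by auto
    then obtain j where j: "i = Suc j" "Suc i < length p" by (metis not0_implies_Suc)
    have "R (p ! Suc j) (p ! j)" "R (p ! i) (p ! Suc i)" using nth(4) j that sym by auto
    moreover have "p ! j \<noteq> p ! Suc i" using nth(3) j by (simp add: nth_eq_iff_index_eq)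
    ultimately show ?thesis using j by simp
  qed auto
  have closed: "y \<in> set p" if x: "x \<in> set p" and R: "R x y" for x y
  proof (rule ccontr)
    assume y: "y \<notin> set p"
    obtain i where i: "i < length p" "p ! i = x" using x by (auto simp: in_set_conv_nth)
    show False
    proof (cases "i = length p - 1")
      case True
      have "successively R (p @ [y])"
        using p R i True nth(1) by (simp add: P_def successively_append_iff last_conv_nth)
      then have "p @ [y] \<in> P" using p y nth(1) by (simp add: P_def)
      then show False using max by fastforce
    next
      case False
      then have s: "Suc i < length p" using i by simp
      have Rs: "R x (p ! Suc i)" "p ! Suc i \<noteq> y" using nth(4)[OF s] i y s
        by (auto simp: in_set_conv_nth)
      show False
      proof (cases i)
        case 0 then show False using ends[of u y "p ! Suc i"] R Rs i nth(2) by auto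
      next
        case (Suc j)
        have "R x (p ! j)" "p ! j \<noteq> y" using nth(4)[of j] sym i Suc y
          by (auto simp: in_set_conv_nth)
        moreover have "p ! j \<noteq> p ! Suc i" using nth(3) s Suc by (simp add: nth_eq_iff_index_eq)
        ultimately show False using two[OF R, of "p ! j" "p ! Suc i"] Rs by auto
      qed
    qed
  qed
  have reach: "x \<in> set p" if "R\<^sup>*\<^sup>* u x" for x
    using that by (induction rule: rtranclp_induct) (use nth closed in \<open>auto simp: in_set_conv_nth\<close>)
  have last: "x = p ! (length p - 1)" if x: "x \<in> {v, w}" for x
  proof -
    obtain i where i: "i < length p" "p ! i = x" using reach[of x] conn x
      by (auto simp: in_set_conv_nth)
    show ?thesis using inner[OF i(1)] ends[of x "p ! (i - 1)" "p ! Suc i"] i x nth(2) dist by auto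
  qed
  show False using last[of v] last[of w] dist by simp
qed

definition colouring :: "nat \<Rightarrow> 'a set set \<Rightarrow> ('a set \<Rightarrow> nat) \<Rightarrow> bool" where
  "colouring k E \<phi> \<longleftrightarrow> \<phi> ` E \<subseteq> {..<k} \<and> (\<forall>e \<in> E. \<forall>f \<in> E. e \<noteq> f \<and> e \<inter> f \<noteq> {} \<longrightarrow> \<phi> e \<noteq> \<phi> f)"

definition free :: "'a set set \<Rightarrow> ('a set \<Rightarrow> nat) \<Rightarrow> nat \<Rightarrow> 'a \<Rightarrow> bool" where
  "free E \<phi> c v \<longleftrightarrow> (\<forall>e \<in> E. v \<in> e \<longrightarrow> \<phi> e \<noteq> c)"

lemma colouringD:
  assumes "colouring k E \<phi>" "e \<in> E" "f \<in> E" "v \<in> e" "v \<in> f" "\<phi> e = \<phi> f"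
  shows "e = f"
  using assms unfolding colouring_def by blast

text \<open>\<open>X\<close> is a union of Kempe chains: an edge with colour \<open>i\<close> or \<open>j\<close> lies in \<open>X\<close> or avoids it, so the exchange
  of \<open>i\<close> and \<open>j\<close> in \<open>X\<close> causes no conflict at the border.\<close>
lemma kempe_swap:
  assumes col: "colouring k E \<phi>" and ij: "i < k" "j < k"
    and closed: "\<And>e. e \<in> E \<Longrightarrow> \<phi> e \<in> {i, j} \<Longrightarrow> e \<inter> X \<noteq> {} \<Longrightarrow> e \<subseteq> X"
  obtains \<psi> where "colouring k E \<psi>"
    "\<And>c v. free E \<psi> c v = free E \<phi> (if v \<in> X then transpose i j c else c) v"
proof
  define \<psi> where "\<psi> e = (if e \<inter> X \<noteq> {} then transpose i j (\<phi> e) else \<phi> e)" for e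
  have other: "\<psi> e = \<phi> e" if "\<phi> e \<notin> {i, j}" for e using that by (auto simp: \<psi>_def)
  have at: "\<psi> e = (if v \<in> X then transpose i j (\<phi> e) else \<phi> e)" if "e \<in> E" "v \<in> e" for e v
  proof (cases "\<phi> e \<in> {i, j}")
    case True
    show ?thesis
    proof (cases "v \<in> X")
      case True then have "e \<inter> X \<noteq> {}" using that(2) by blast
      then show ?thesis using True by (simp add: \<psi>_def)
    next
      case False
      then have "e \<inter> X = {}" using closed[OF that(1) True] that(2) by blast
      then show ?thesis using False by (simp add: \<psi>_def)
    qed
  next
    case False then show ?thesis using other[OF False] by (auto simp: transpose_def)
  qed
  have "\<psi> e < k" if "e \<in> E" for e
  proof -
    have "\<phi> e < k" using col that by (auto simp: colouring_def)
    then show ?thesis using ij by (auto simp: \<psi>_def transpose_def)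
  qed
  moreover have "e = f" if ef: "e \<in> E" "f \<in> E" "v \<in> e" "v \<in> f" "\<psi> e = \<psi> f" for e f v
  proof -
    have "\<phi> e = \<phi> f"
      using ef(5) unfolding at[OF ef(1,3)] at[OF ef(2,4)] by (metis transpose_involutory)
    then show ?thesis by (rule colouringD[OF col ef(1-4)])
  qed
  ultimately show "colouring k E \<psi>"
    unfolding colouring_def by (metis disjoint_iff image_subsetI lessThan_iff)
  have "\<psi> e = c \<longleftrightarrow> \<phi> e = (if v \<in> X then transpose i j c else c)" if "e \<in> E" "v \<in> e" for e c v
    unfolding at[OF that] by (metis transpose_involutory)
  then show "free E \<psi> c v = free E \<phi> (if v \<in> X then transpose i j c else c) v" for c v
    unfolding free_def by blast
qed

definition kempe_adj :: "'a set set \<Rightarrow> ('a set \<Rightarrow> nat) \<Rightarrow> nat \<Rightarrow> nat \<Rightarrow> 'a \<Rightarrow> 'a \<Rightarrow> bool" where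
  "kempe_adj E \<phi> i j u v \<longleftrightarrow> u \<noteq> v \<and> (\<exists>e \<in> E. \<phi> e \<in> {i, j} \<and> u \<in> e \<and> v \<in> e)"

text \<open>The edges with two given colours form paths and cycles, and a vertex at which exactly one of the two
  colours is free is an end of a path.\<close>
lemma kempe_component_two_ends:
  assumes col: "colouring k E \<phi>" and fin: "finite E" "\<And>e. e \<in> E \<Longrightarrow> card e = 2"
    and ends: "\<And>x. x \<in> {u, v, w} \<Longrightarrow> free E \<phi> i x \<noteq> free E \<phi> j x"
    and conn: "(kempe_adj E \<phi> i j)\<^sup>*\<^sup>* u v" "(kempe_adj E \<phi> i j)\<^sup>*\<^sup>* u w"
    and dist: "u \<noteq> v" "u \<noteq> w" "v \<noteq> w"
  shows False
proof (rule path_component_two_ends[where R = "kempe_adj E \<phi> i j" and V = "\<Union> E", OF _ _ _ _ _ conn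
  dist])
  have edge: "{x, y} \<in> E \<and> \<phi> {x, y} \<in> {i, j} \<and> x \<noteq> y" if "kempe_adj E \<phi> i j x y" for x y
  proof -
    obtain e where e: "e \<in> E" "\<phi> e \<in> {i, j}" "x \<in> e" "y \<in> e" "x \<noteq> y" using \<open>kempe_adj E \<phi> i j x y\<close>
      by (auto simp: kempe_adj_def)
    moreover have "e = {x, y}" using e fin(2)[OF e(1)] by (auto simp: card_2_iff)
    ultimately show ?thesis by auto
  qed
  have same: "y = z" if "kempe_adj E \<phi> i j x y" "kempe_adj E \<phi> i j x z" "\<phi> {x, y} = \<phi> {x, z}" for x
    y z
  proof -
    have "{x, y} = {x, z}" using colouringD[OF col, of "{x, y}" "{x, z}" x] edge[OF that(1)] edge[OF
      that(2)] that(3) by auto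
    then show ?thesis by (auto simp: doubleton_eq_iff)
  qed
  show "kempe_adj E \<phi> i j y x" if "kempe_adj E \<phi> i j x y" for x y using that
    by (auto simp: kempe_adj_def)
  show "finite (\<Union> E)" using fin by (metis card.infinite finite_Union zero_neq_numeral)
  show "x \<in> \<Union> E \<and> x \<noteq> y" if "kempe_adj E \<phi> i j x y" for x y using edge[OF that] by auto
  show "a = b \<or> a = c \<or> b = c"
    if adj: "kempe_adj E \<phi> i j x a" "kempe_adj E \<phi> i j x b" "kempe_adj E \<phi> i j x c" for x a b c
  proof -
    have "\<phi> {x, a} = \<phi> {x, b} \<or> \<phi> {x, a} = \<phi> {x, c} \<or> \<phi> {x, b} = \<phi> {x, c}"
      using edge[OF adj(1)] edge[OF adj(2)] edge[OF adj(3)] by (metis empty_iff insert_iff)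
    then show ?thesis using same[OF adj(1,2)] same[OF adj(1,3)] same[OF adj(2,3)] by argo
  qed
  show "a = b" if x: "x \<in> {u, v, w}" and adj: "kempe_adj E \<phi> i j x a" "kempe_adj E \<phi> i j x b" for x
    a b
  proof -
    obtain c where "c \<in> {i, j}" "free E \<phi> c x" using ends[OF x] by blast
    then have "\<phi> {x, a} \<noteq> c" "\<phi> {x, b} \<noteq> c" using edge[OF adj(1)] edge[OF adj(2)]
      by (auto simp: free_def)
    then have "\<phi> {x, a} = \<phi> {x, b}" using edge[OF adj(1)] edge[OF adj(2)] \<open>c \<in> {i, j}\<close> by auto
    then show ?thesis by (rule same[OF adj])
  qed
qed

section \<open>States of a configuration\<close>

text \<open>A row of flags is stored as a binary numeral, first flag least significant, with the leading 1 as end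
  mark. So a state is written as a few decimal literals, and functions on it recurse over the
  constructors of \<open>num\<close>.\<close>
fun encode :: "bool list \<Rightarrow> num" where
  "encode [] = num.One"
| "encode (b # bs) = (if b then num.Bit1 else num.Bit0) (encode bs)"

fun flag :: "nat \<Rightarrow> num \<Rightarrow> bool" where
  "flag i num.One = False"
| "flag 0 (num.Bit0 c) = False"
| "flag 0 (num.Bit1 c) = True"
| "flag (Suc i) (num.Bit0 c) = flag i c"
| "flag (Suc i) (num.Bit1 c) = flag i c"

fun flip :: "nat \<Rightarrow> num \<Rightarrow> num" where
  "flip i num.One = num.One"
| "flip 0 (num.Bit0 c) = num.Bit1 c"
| "flip 0 (num.Bit1 c) = num.Bit0 c"
| "flip (Suc i) (num.Bit0 c) = num.Bit0 (flip i c)"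
| "flip (Suc i) (num.Bit1 c) = num.Bit1 (flip i c)"

fun drop_first :: "num \<Rightarrow> num" where
  "drop_first num.One = num.One"
| "drop_first (num.Bit0 c) = c"
| "drop_first (num.Bit1 c) = c"

lemma flag_encode [simp]: "flag i (encode bs) \<longleftrightarrow> i < length bs \<and> bs ! i"
proof (induction bs arbitrary: i)
  case (Cons b bs) then show ?case by (cases i) auto
qed auto

lemma flip_encode: "flip i (encode bs) = encode (if i < length bs then bs[i := \<not> bs ! i] else bs)"
proof (induction bs arbitrary: i)
  case (Cons b bs) then show ?case by (cases i) auto
qed auto

lemma flip_encode_map:
  assumes "distinct vs" "p < length vs" "\<And>v. v \<in> set vs \<Longrightarrow> Q v = (if v = vs ! p then \<not> P v else P v)"
  shows "encode (map Q vs) = flip p (encode (map P vs))"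
proof -
  have "map Q vs = (map P vs)[p := \<not> P (vs ! p)]"
    using assms by (intro nth_equalityI) (auto simp: nth_list_update nth_eq_iff_index_eq)
  then show ?thesis using assms(2) by (simp add: flip_encode)
qed

text \<open>The column of a colour says at which of the vertices \<open>vs\<close> it is free.\<close>
definition column :: "'a set set \<Rightarrow> ('a set \<Rightarrow> nat) \<Rightarrow> 'a list \<Rightarrow> nat \<Rightarrow> num" where
  "column E \<phi> vs c = encode (map (free E \<phi> c) vs)"

text \<open>\<open>S\<close> is the state of some colouring of \<open>F\<close> without the edges \<open>H\<close> of the configuration, which are
  uncoloured. The order of the colours is left open, because colours may be renamed.\<close>
definition realised :: "nat \<Rightarrow> 'a set set \<Rightarrow> 'a set set \<Rightarrow> 'a list \<Rightarrow> num list \<Rightarrow> bool" where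
  "realised k F H vs S \<longleftrightarrow>
     (\<exists>\<phi> cs. colouring k (F - H) \<phi> \<and> distinct cs \<and> set cs = {..<k} \<and> S = map (column (F - H) \<phi> vs)
       cs)"

lemma mset_map_reorder: "mset T = mset (map f cs) \<Longrightarrow> \<exists>ds. mset ds = mset cs \<and> T = map f ds"
proof (induction T arbitrary: cs)
  case (Cons x T)
  then obtain c where c: "c \<in> set cs" "f c = x"
    by (metis image_iff list.set_intros(1) list.set_map mset_eq_setD)
  then obtain as bs where "cs = as @ c # bs" by (meson split_list)
  then have "mset T = mset (map f (as @ bs))" using Cons.prems c(2) by simp
  then obtain ds where "mset ds = mset (as @ bs)" "T = map f ds" using Cons.IH by blast
  then show ?case using \<open>cs = as @ c # bs\<close> c(2) by (intro exI[of _ "c # ds"]) simp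
qed auto

lemma realised_reorder:
  assumes "realised k F H vs S" "mset T = mset S"
  shows "realised k F H vs T"
proof -
  obtain \<phi> cs where *: "colouring k (F - H) \<phi>" "distinct cs" "set cs = {..<k}"
    "S = map (column (F - H) \<phi> vs) cs"
    using assms(1) by (auto simp: realised_def)
  then obtain ds where "mset ds = mset cs" "T = map (column (F - H) \<phi> vs) ds"
    using mset_map_reorder assms(2) by blast
  then show ?thesis unfolding realised_def using * by (metis mset_eq_imp_distinct_iff mset_eq_setD)
qed

lemma colour_edge:
  assumes col: "colouring k E \<phi>" and e: "e \<notin> E" "e = {u, w}" and j: "j < k" "free E \<phi> j u"
    "free E \<phi> j w"
  shows "colouring k (insert e E) (\<phi>(e := j))"
    and "free (insert e E) (\<phi>(e := j)) c v \<longleftrightarrow> free E \<phi> c v \<and> \<not> (v \<in> e \<and> c = j)"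
proof -
  have clash: "\<phi> f \<noteq> j" if "f \<in> E" "e \<inter> f \<noteq> {}" for f
    using that e(2) j(2,3) by (auto simp: free_def)
  have old: "(\<phi>(e := j)) f = \<phi> f" if "f \<in> E" for f using that e(1) by auto
  have "(\<phi>(e := j)) f \<noteq> (\<phi>(e := j)) g"
    if fg: "f \<in> insert e E" "g \<in> insert e E" "f \<noteq> g \<and> f \<inter> g \<noteq> {}" for f g
  proof -
    consider "f = e" "g \<in> E" | "g = e" "f \<in> E" | "f \<in> E" "g \<in> E" using fg by blast
    then show ?thesis
    proof cases
      case 1 then show ?thesis using clash[of g] old[of g] fg(3) by auto
    next
      case 2 then show ?thesis using clash[of f] old[of f] fg(3) by auto
    next
      case 3 then show ?thesis using col fg(3) unfolding old[OF 3(1)] old[OF 3(2)] colouring_def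
        by blast
    qed
  qed
  moreover have "(\<phi>(e := j)) ` insert e E \<subseteq> {..<k}" using col j(1) by (auto simp: colouring_def)
  ultimately show "colouring k (insert e E) (\<phi>(e := j))" unfolding colouring_def by blast
  show "free (insert e E) (\<phi>(e := j)) c v \<longleftrightarrow> free E \<phi> c v \<and> \<not> (v \<in> e \<and> c = j)"
    using old unfolding free_def by auto
qed

lemma uncolour_edge:
  assumes col: "colouring k (insert e E) \<phi>" and e: "e \<notin> E"
  shows "colouring k E \<phi>"
    and "free E \<phi> c v \<longleftrightarrow> free (insert e E) \<phi> c v \<or> (v \<in> e \<and> c = \<phi> e)"
proof -
  show "colouring k E \<phi>" using col unfolding colouring_def by auto
  have "\<phi> f \<noteq> \<phi> e" if "f \<in> E" "v \<in> e" "v \<in> f" for f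
    using colouringD[OF col, of f e v] that e by auto
  then show "free E \<phi> c v \<longleftrightarrow> free (insert e E) \<phi> c v \<or> (v \<in> e \<and> c = \<phi> e)"
    unfolding free_def by auto
qed

text \<open>A configuration is built edge by edge, and the newest vertex comes first in the list of its vertices.
  \<open>Attach p\<close> joins a new vertex to the one at position \<open>p\<close>; \<open>Join p q\<close> joins two old vertices.\<close>
datatype step = Attach nat | Join nat nat

text \<open>Conjunction and negation are copied to functions on truth values, so that the simplifier computes
  with them by these equations alone.\<close>
fun cnj :: "bool \<Rightarrow> bool \<Rightarrow> bool" where "cnj True b = b" | "cnj False b = False"

lemma cnj_iff [simp]: "cnj a b \<longleftrightarrow> a \<and> b" by (cases a) auto

text \<open>\<open>colourable st c\<close> says that the colour with column \<open>c\<close> is free at both ends of the newest edge, and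
  \<open>coloured st c cs\<close> is the state after that edge has received it: the configuration has lost the edge,
  and also the newest vertex if the edge was attached.\<close>
fun colourable :: "step \<Rightarrow> num \<Rightarrow> bool" where
  "colourable (Attach p) num.One = False"
| "colourable (Attach p) (num.Bit0 c) = False"
| "colourable (Attach p) (num.Bit1 c) = flag p c"
| "colourable (Join p q) c = cnj (flag p c) (flag q c)"

fun coloured :: "step \<Rightarrow> num \<Rightarrow> num list \<Rightarrow> num list" where
  "coloured (Attach p) c cs = flip p (drop_first c) # map drop_first cs"
| "coloured (Join p q) c cs = flip p (flip q c) # cs"

fun step_ok :: "'a set set \<Rightarrow> 'a set set \<Rightarrow> 'a list \<Rightarrow> step \<Rightarrow> 'a set set \<Rightarrow> 'a list \<Rightarrow> bool" where
  "step_ok F H vs (Attach p) H' vs' \<longleftrightarrow>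
     (\<exists>w. vs' = w # vs \<and> w \<notin> set vs \<and> p < length vs \<and> {vs ! p, w} \<in> F - H \<and> H' = insert {vs ! p, w}
       H)"
| "step_ok F H vs (Join p q) H' vs' \<longleftrightarrow>
     vs' = vs \<and> p < length vs \<and> q < length vs \<and> p \<noteq> q \<and> {vs ! p, vs ! q} \<in> F - H \<and> H' = insert {vs !
       p, vs ! q} H"

lemma realised_coloured:
  assumes R: "realised k F H' vs' (c # cs)" and st: "step_ok F H vs st H' vs'" and d: "distinct vs"
    and c: "colourable st c"
  shows "realised k F H vs (coloured st c cs)"
proof -
  obtain \<phi> j js where col: "colouring k (F - H') \<phi>" and js: "distinct (j # js)"
    "set (j # js) = {..<k}"
    and cols: "c = column (F - H') \<phi> vs' j" "cs = map (column (F - H') \<phi> vs') js"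
    using R by (auto simp: realised_def map_eq_Cons_conv Cons_eq_map_conv)
  define E where "E = F - H'"
  have jk: "j < k" using js by auto
  show ?thesis
  proof (cases st)
    case (Attach p)
    then obtain w where w: "vs' = w # vs" "w \<notin> set vs" and p: "p < length vs" and e:
      "{vs ! p, w} \<in> F - H" "H' = insert {vs ! p, w} H"
      using st by auto
    have E: "F - H = insert {vs ! p, w} E" "{vs ! p, w} \<notin> E" using e by (auto simp: E_def)
    have fr: "free E \<phi> j (vs ! p)" "free E \<phi> j w"
      using c cols(1) p unfolding Attach w column_def E_def by (auto split: if_splits)
    note new = colour_edge[OF col[folded E_def] E(2) refl jk fr]
    have c': "column (F - H) (\<phi>({vs ! p, w} := j)) vs i = (if i
      = j then flip p (drop_first (column E \<phi> vs' i)) else drop_first (column E \<phi> vs' i))" for i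
    proof (cases "i = j")
      case True
      have "encode (map (free (F - H) (\<phi>({vs ! p, w} := j)) j) vs)
        = flip p (encode (map (free E \<phi> j) vs))"
        by (rule flip_encode_map[OF d p]) (use new(2) fr w(2) E in auto)
      then show ?thesis using True fr by (simp add: column_def w)
    next
      case False
      then have "map (free (F - H) (\<phi>({vs ! p, w} := j)) i) vs = map (free E \<phi> i) vs" using new(2) E
        by auto
      then show ?thesis using False by (simp add: column_def w del: map_eq_conv)
    qed
    have "coloured st c cs = map (column (F - H) (\<phi>({vs ! p, w} := j)) vs) (j # js)"
      using cols js(1) by (auto simp: Attach c' E_def)
    then show ?thesis unfolding realised_def using new(1) js E by metis
  next
    case (Join p q)
    then have w: "vs' = vs" and p: "p < length vs" "q < length vs" "p \<noteq> q" and e: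
      "{vs ! p, vs ! q} \<in> F - H" "H' = insert {vs ! p, vs ! q} H"
      using st by auto
    have E: "F - H = insert {vs ! p, vs ! q} E" "{vs ! p, vs ! q} \<notin> E" using e by (auto simp: E_def)
    have fr: "free E \<phi> j (vs ! p)" "free E \<phi> j (vs ! q)"
      using c cols(1) p unfolding Join w column_def E_def by auto
    have ne: "vs ! p \<noteq> vs ! q" using p d by (simp add: nth_eq_iff_index_eq)
    note new = colour_edge[OF col[folded E_def] E(2) refl jk fr]
    have c': "column (F - H) (\<phi>({vs ! p, vs ! q} := j)) vs i = (if i
      = j then flip p (flip q (column E \<phi> vs' i)) else column E \<phi> vs' i)" for i
    proof (cases "i = j")
      case True
      have "encode (map (free (F - H) (\<phi>({vs ! p, vs ! q} := j)) j) vs) =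
          flip p (encode (map (\<lambda>v. if v = vs ! q then \<not> free E \<phi> j v else free E \<phi> j v) vs))"
        by (rule flip_encode_map[OF d p(1)]) (use new(2) fr E ne in auto)
      also have "encode (map (\<lambda>v. if v = vs ! q then \<not> free E \<phi> j v else free E \<phi> j v) vs)
        = flip q (encode (map (free E \<phi> j) vs))"
        by (rule flip_encode_map[OF d p(2)]) auto
      finally show ?thesis using True by (simp only: column_def w if_True simp_thms)
    next
      case False
      then have "map (free (F - H) (\<phi>({vs ! p, vs ! q} := j)) i) vs = map (free E \<phi> i) vs"
        using new(2) E by auto
      then show ?thesis using False by (simp add: column_def w del: map_eq_conv)
    qed
    have "coloured st c cs = map (column (F - H) (\<phi>({vs ! p, vs ! q} := j)) vs) (j # js)"
      using cols js(1) by (auto simp: Join c' E_def w)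
    then show ?thesis unfolding realised_def using new(1) js E by metis
  qed
qed

fun diffs :: "nat \<Rightarrow> num \<Rightarrow> num \<Rightarrow> nat list" where
  "diffs i num.One d = []"
| "diffs i (num.Bit0 c) num.One = []"
| "diffs i (num.Bit1 c) num.One = []"
| "diffs i (num.Bit0 c) (num.Bit0 d) = diffs (Suc i) c d"
| "diffs i (num.Bit1 c) (num.Bit1 d) = diffs (Suc i) c d"
| "diffs i (num.Bit0 c) (num.Bit1 d) = i # diffs (Suc i) c d"
| "diffs i (num.Bit1 c) (num.Bit0 d) = i # diffs (Suc i) c d"

lemma diffs_encode:
  "length as = length bs \<Longrightarrow>
     set (diffs n (encode as) (encode bs)) = {n + i |i. i < length as \<and> as ! i \<noteq> bs ! i} \<and>
     distinct (diffs n (encode as) (encode bs))"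
proof (induction as bs arbitrary: n rule: list_induct2)
  case (Cons a as b bs)
  have "{n + i |i. i < length (a # as) \<and> (a # as) ! i \<noteq> (b # bs) ! i} =
     (if a \<noteq> b then {n} else {}) \<union> {Suc n + i |i. i < length as \<and> as ! i \<noteq> bs ! i}"
    by (auto simp: less_Suc_eq_0_disj)
  then show ?case using Cons.IH[of "Suc n"] by auto
qed auto

lemma foldr_flip_encode:
  assumes "distinct is" "set is \<subseteq> {..<length bs}"
  shows "foldr flip is (encode bs) = encode (map (\<lambda>i. if i \<in> set is then \<not> bs ! i else bs ! i)
    [0..<length bs])"
  using assms
proof (induction "is")
  case Nil then show ?case by (simp add: map_nth)
next
  case (Cons i "is")
  then have "foldr flip (i # is) (encode bs) = flip i (encode (map (\<lambda>i. if i \<in> set is then \<not> bs ! i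
    else bs ! i) [0..<length bs]))"
    by simp
  also have "\<dots> = encode (map (\<lambda>j. if j \<in> set (i # is) then \<not> bs ! j else bs ! j) [0..<length bs])"
    (is "flip i (encode ?bs) = encode ?cs")
  proof -
    have "?bs[i := \<not> ?bs ! i] = ?cs"
    proof (rule nth_equalityI)
      fix j assume "j < length (?bs[i := \<not> ?bs ! i])"
      then have j: "j < length bs" by simp
      show "?bs[i := \<not> ?bs ! i] ! j = ?cs ! j"
        using Cons.prems j by (cases "j = i") simp_all
    qed simp
    then show ?thesis using Cons.prems by (simp add: flip_encode)
  qed
  finally show ?case .
qed

text \<open>The positions in \<open>D\<close> are the ends of chains for the colours with columns \<open>a\<close> and \<open>b\<close>. The involution
  sends an end to the other end of its chain, or to itself if the chain ends outside of the
  configuration. Exchanging the colours on some chains flips both columns at their ends.\<close>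
lemma kempe_realised:
  assumes R: "realised k F H vs (a # b # S)" and fin: "finite F" "\<And>e. e \<in> F \<Longrightarrow> card e = 2" and d:
    "distinct vs"
  defines "D \<equiv> set (diffs 0 a b)"
  obtains \<mu> where "\<And>i. i \<in> D \<Longrightarrow> \<mu> i \<in> D \<and> \<mu> (\<mu> i) = i"
    "\<And>is. distinct is \<Longrightarrow> set is \<subseteq> D \<Longrightarrow> (\<And>i. i \<in> set is \<Longrightarrow> \<mu> i \<in> set is) \<Longrightarrow>
       realised k F H vs (foldr flip is a # foldr flip is b # S)"
    "distinct (diffs 0 a b)"
proof -
  define E where "E = F - H"
  obtain \<phi> i j js where col: "colouring k E \<phi>" and js: "distinct (i # j # js)"
    "set (i # j # js) = {..<k}"
    and cols: "a = column E \<phi> vs i" "b = column E \<phi> vs j" "S = map (column E \<phi> vs) js"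
    using R by (auto simp: realised_def Cons_eq_map_conv E_def)
  have E: "finite E" "\<And>e. e \<in> E \<Longrightarrow> card e = 2" using fin by (auto simp: E_def)
  have D: "D = {n. n < length vs \<and> free E \<phi> i (vs ! n) \<noteq> free E \<phi> j (vs ! n)}"
    "distinct (diffs 0 a b)"
    unfolding D_def cols column_def
    using diffs_encode[of "map (free E \<phi> i) vs" "map (free E \<phi> j) vs" 0]
      by (simp_all cong: conj_cong)
  define linked where "linked m n \<longleftrightarrow> (kempe_adj E \<phi> i j)\<^sup>*\<^sup>* (vs ! m) (vs ! n)" for m n
  have sym: "kempe_adj E \<phi> i j x y \<Longrightarrow> kempe_adj E \<phi> i j y x" for x y by (auto simp: kempe_adj_def)
  have rsym: "(kempe_adj E \<phi> i j)\<^sup>*\<^sup>* x y \<Longrightarrow> (kempe_adj E \<phi> i j)\<^sup>*\<^sup>* y x" for x y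
    by (induction rule: rtranclp_induct) (auto intro: converse_rtranclp_into_rtranclp sym)
  have lsym: "linked m n \<Longrightarrow> linked n m" for m n unfolding linked_def by (rule rsym)
  have uniq: "n = n'" if "m \<in> D" "n \<in> D" "n' \<in> D" "linked m n" "linked m n'" "m \<noteq> n" "m \<noteq> n'" for m
    n n'
  proof (rule ccontr)
    assume "n \<noteq> n'"
    with that d have "vs ! m \<noteq> vs ! n" "vs ! m \<noteq> vs ! n'" "vs ! n \<noteq> vs ! n'"
      by (auto simp: D nth_eq_iff_index_eq)
    then show False
      using kempe_component_two_ends[OF col E, of "vs ! m" "vs ! n" "vs ! n'" i j] that
        by (auto simp: D linked_def)
  qed
  \<comment> \<open>A position that is linked to no other position becomes a fixed point.\<close>
  define \<mu> where "\<mu> m = (if \<exists>n \<in> D. n \<noteq> m \<and> linked m n then SOME n. n \<in> D \<and> n \<noteq> m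
    \<and> linked m n else m)" for m
  have mu: "\<mu> m \<in> D \<and> linked m (\<mu> m) \<and> (\<forall>n \<in> D. linked m n \<longrightarrow> n = m \<or> n = \<mu> m)" if "m \<in> D" for m
  proof (cases "\<exists>n \<in> D. n \<noteq> m \<and> linked m n")
    case True
    then have "\<mu> m \<in> D \<and> \<mu> m \<noteq> m \<and> linked m (\<mu> m)" unfolding \<mu>_def
      using someI_ex[of "\<lambda>n. n \<in> D \<and> n \<noteq> m \<and> linked m n"] by auto
    then show ?thesis using uniq[OF that] by metis
  next
    case False then show ?thesis using that by (auto simp: \<mu>_def linked_def)
  qed
  show thesis
  proof (rule that)
    fix m assume m: "m \<in> D"
    have "\<mu> (\<mu> m) = m"
    proof (cases "\<mu> m = m")
      case False
      then show ?thesis using mu[OF m] mu[of "\<mu> m"] lsym m by metis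
    qed auto
    then show "\<mu> m \<in> D \<and> \<mu> (\<mu> m) = m" using mu[OF m] by simp
  next
    fix "is" assume dis: "distinct is" "set is \<subseteq> D" "\<And>i. i \<in> set is \<Longrightarrow> \<mu> i \<in> set is"
    define X where "X = {v. \<exists>m \<in> set is. (kempe_adj E \<phi> i j)\<^sup>*\<^sup>* (vs ! m) v}"
    have "e \<subseteq> X" if e: "e \<in> E" "\<phi> e \<in> {i, j}" "e \<inter> X \<noteq> {}" for e
    proof
      fix y assume y: "y \<in> e"
      obtain x m where x: "x \<in> e" "m \<in> set is" "(kempe_adj E \<phi> i j)\<^sup>*\<^sup>* (vs ! m) x" using e(3)
        by (auto simp: X_def)
      have "x = y \<or> kempe_adj E \<phi> i j x y" using x y e by (auto simp: kempe_adj_def)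
      then show "y \<in> X" using x unfolding X_def by (auto intro: rtranclp.rtrancl_into_rtrancl)
    qed
    moreover have "i < k" "j < k" using js by auto
    ultimately obtain \<psi> where \<psi>: "colouring k E \<psi>"
        "\<And>c v. free E \<psi> c v = free E \<phi> (if v \<in> X then transpose i j c else c) v"
      using kempe_swap[OF col, of i j X] by blast
    have inX: "vs ! n \<in> X \<longleftrightarrow> n \<in> set is" if n: "n \<in> D" for n
    proof
      assume "vs ! n \<in> X"
      then obtain m where "m \<in> set is" "linked m n" by (auto simp: X_def linked_def)
      then show "n \<in> set is" using mu[of m] dis n by blast
    qed (auto simp: X_def)
    have sub: "set is \<subseteq> {..<length vs}" using dis(2) D by auto
    have enc: "foldr flip is (column E \<phi> vs c) = column E \<psi> vs c" if "c \<in> {i, j}" for c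
    proof -
      have "(if n \<in> set is then \<not> free E \<phi> c (vs ! n) else free E \<phi> c (vs ! n))
        = free E \<psi> c (vs ! n)" if n: "n < length vs" for n
      proof (cases "n \<in> D")
        case True
        then show ?thesis using inX[OF True] \<psi>(2)[of c "vs ! n"] \<open>c \<in> {i, j}\<close> by (auto simp: D)
      next
        case False
        then have "free E \<phi> i (vs ! n) = free E \<phi> j (vs ! n)" using n D by auto
        moreover have "n \<notin> set is" using False dis by auto
        ultimately show ?thesis using \<psi>(2)[of c "vs ! n"] \<open>c \<in> {i, j}\<close> by auto
      qed
      note flipped = this
      have "map (\<lambda>n. if n \<in> set is then \<not> map (free E \<phi> c) vs ! n else map (free E \<phi> c) vs ! n)
        [0..<length vs] = map (free E \<psi> c) vs"
      proof (rule nth_equalityI)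
        fix n assume "n < length (map (\<lambda>n. if n \<in> set is then \<not> map (free E \<phi> c) vs ! n else map
          (free E \<phi> c) vs ! n) [0..<length vs])"
        then have "n < length vs" by simp
        then show "map (\<lambda>n. if n \<in> set is then \<not> map (free E \<phi> c) vs ! n else map (free E \<phi> c) vs !
          n) [0..<length vs] ! n = map (free E \<psi> c) vs ! n"
          using flipped[of n] by (cases "n \<in> set is") simp_all
      qed simp
      then show ?thesis unfolding column_def
        using foldr_flip_encode[OF dis(1), of "map (free E \<phi> c) vs"] sub by simp
    qed
    have "map (column E \<phi> vs) js = map (column E \<psi> vs) js"
    proof (rule map_cong[OF refl])
      fix c assume "c \<in> set js"
      then have "transpose i j c = c" using js by (auto simp: transpose_def)
      then have "free E \<phi> c = free E \<psi> c" using \<psi>(2) by (intro ext) auto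
      then show "column E \<phi> vs c = column E \<psi> vs c" by (simp add: column_def)
    qed
    then have "foldr flip is a # foldr flip is b # S = map (column E \<psi> vs) (i # j # js)"
      using enc cols by simp
    then show "realised k F H vs (foldr flip is a # foldr flip is b # S)"
      unfolding realised_def E_def[symmetric] using \<psi>(1) js
        by (intro exI[of _ \<psi>] exI[of _ "i # j # js"]) simp
  qed (rule D(2))
qed

section \<open>Certified refutation of states\<close>

fun col_le :: "num \<Rightarrow> num \<Rightarrow> bool" where
  "col_le num.One d = True"
| "col_le (num.Bit0 c) num.One = False"
| "col_le (num.Bit1 c) num.One = False"
| "col_le (num.Bit0 c) (num.Bit0 d) = col_le c d"
| "col_le (num.Bit0 c) (num.Bit1 d) = True"
| "col_le (num.Bit1 c) (num.Bit0 d) = False"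
| "col_le (num.Bit1 c) (num.Bit1 d) = col_le c d"

fun insert_col :: "num \<Rightarrow> num list \<Rightarrow> num list"
  and insert_col_if :: "bool \<Rightarrow> num \<Rightarrow> num \<Rightarrow> num list \<Rightarrow> num list" where
  "insert_col c [] = [c]"
| "insert_col c (d # ds) = insert_col_if (col_le c d) c d ds"
| "insert_col_if True c d ds = c # d # ds"
| "insert_col_if False c d ds = d # insert_col c ds"

fun sort_cols :: "num list \<Rightarrow> num list" where
  "sort_cols [] = []"
| "sort_cols (c # cs) = insert_col c (sort_cols cs)"

lemma mset_insert_col:
  "mset (insert_col c ds) = add_mset c (mset ds)"
  "mset (insert_col_if b c d ds) = add_mset c (add_mset d (mset ds))"
  by (induction c ds and b c d ds rule: insert_col_insert_col_if.induct) auto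

lemma mset_sort_cols [simp]: "mset (sort_cols cs) = mset cs"
  by (induction cs) (auto simp: mset_insert_col)

text \<open>Tables of states are tries over the concatenated columns; \<open>Next\<close> marks the end of a column. A state is
  looked up with its columns sorted, which makes the order of the colours irrelevant.\<close>
datatype trie = Absent | Present | Next trie | Branch trie trie

fun descend :: "num \<Rightarrow> trie \<Rightarrow> trie" where
  "descend c Absent = Absent"
| "descend c Present = Absent"
| "descend num.One (Next t) = t"
| "descend (num.Bit0 c) (Next t) = Absent"
| "descend (num.Bit1 c) (Next t) = Absent"
| "descend num.One (Branch l r) = Absent"
| "descend (num.Bit0 c) (Branch l r) = descend c l"
| "descend (num.Bit1 c) (Branch l r) = descend c r"

fun is_present :: "trie \<Rightarrow> bool" where
  "is_present Present = True"
| "is_present Absent = False"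
| "is_present (Next t) = False"
| "is_present (Branch l r) = False"

fun member :: "num list \<Rightarrow> trie \<Rightarrow> bool" where
  "member [] t = is_present t"
| "member (c # cs) t = member cs (descend c t)"

fun add :: "num list \<Rightarrow> trie \<Rightarrow> trie" where
  "add [] t = Present"
| "add (c # cs) Present = Present"
| "add (num.One # cs) Absent = Next (add cs Absent)"
| "add (num.Bit0 c # cs) Absent = Branch (add (c # cs) Absent) Absent"
| "add (num.Bit1 c # cs) Absent = Branch Absent (add (c # cs) Absent)"
| "add (num.One # cs) (Next t) = Next (add cs t)"
| "add (num.Bit0 c # cs) (Next t) = Next t"
| "add (num.Bit1 c # cs) (Next t) = Next t"
| "add (num.One # cs) (Branch l r) = Branch l r"
| "add (num.Bit0 c # cs) (Branch l r) = Branch (add (c # cs) l) r"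
| "add (num.Bit1 c # cs) (Branch l r) = Branch l (add (c # cs) r)"

lemma member_Absent [simp]: "\<not> member cs Absent"
  by (induction cs) auto

lemma member_Present [simp]: "member cs Present \<longleftrightarrow> cs = []"
  by (cases cs) auto

lemma member_Next [simp]: "member ds (Next t) \<longleftrightarrow> (\<exists>cs. ds = num.One # cs \<and> member cs t)"
proof (cases ds)
  case (Cons d ds') then show ?thesis by (cases d) auto
qed auto

lemma member_Branch [simp]:
  "member ds (Branch l r) \<longleftrightarrow>
     (\<exists>c cs. ds = num.Bit0 c # cs \<and> member (c # cs) l \<or> ds = num.Bit1 c # cs \<and> member (c # cs) r)"
proof (cases ds)
  case (Cons d ds') then show ?thesis by (cases d) auto
qed auto

declare member.simps(2) [simp del]

lemma member_add: "member ds (add cs t) \<Longrightarrow> ds = cs \<or> member ds t"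
proof (induction cs t arbitrary: ds rule: add.induct)
  case (4 c cs) then show ?case by simp (metis list.inject)
next
  case (5 c cs) then show ?case by simp (metis list.inject)
next
  case (10 c cs l r) then show ?case by simp (metis list.inject)
next
  case (11 c cs l r) then show ?case by simp (metis list.inject)
qed auto

type_synonym level = "step \<times> trie"

fun prepend_rev :: "'a list \<Rightarrow> 'a list \<Rightarrow> 'a list" where
  "prepend_rev [] ys = ys"
| "prepend_rev (x # xs) ys = prepend_rev xs (x # ys)"

lemma prepend_rev: "prepend_rev xs ys = rev xs @ ys"
  by (induction xs ys rule: prepend_rev.induct) auto

fun picks :: "num list \<Rightarrow> num list \<Rightarrow> (num \<times> num list) list" where
  "picks pre [] = []"
| "picks pre (c # cs) = (c, prepend_rev pre cs) # picks (c # pre) cs"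

text \<open>A level consists of the step that added the newest edge and a table of states that are known to be
  impossible with this edge included. A state is refuted if it is in the table, or if the newest edge can
  be coloured so that the rest is refuted on the previous level. With no level left, all edges are
  coloured, which contradicts that the graph is not colourable.\<close>
fun refuted :: "num list \<Rightarrow> level list \<Rightarrow> bool" where
  "refuted S [] = True"
| "refuted S (l # ls) =
     (member (sort_cols S) (snd l) \<or>
      (\<exists>x \<in> set (picks [] S). colourable (fst l) (fst x) \<and> refuted (coloured (fst l) (fst x) (snd
        x)) ls))"

fun level_ok :: "nat \<Rightarrow> 'a set set \<Rightarrow> 'a set set \<Rightarrow> 'a list \<Rightarrow> level list \<Rightarrow> bool" where
  "level_ok k F H vs [] \<longleftrightarrow> H = {} \<and> (\<nexists>\<phi>. colouring k F \<phi>)"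
| "level_ok k F H vs (l # ls) \<longleftrightarrow>
     (\<forall>S. member (sort_cols S) (snd l) \<longrightarrow> \<not> realised k F H vs S) \<and>
     (\<exists>H' vs'. step_ok F H' vs' (fst l) H vs \<and> distinct vs' \<and> level_ok k F H' vs' ls)"

lemma mset_picks: "x \<in> set (picks pre S) \<Longrightarrow> mset pre + mset S = mset (fst x # snd x)"
  by (induction pre S rule: picks.induct) (auto simp: prepend_rev)

lemma refuted_sound: "level_ok k F H vs ls \<Longrightarrow> refuted S ls \<Longrightarrow> \<not> realised k F H vs S"
proof (induction ls arbitrary: H vs S)
  case Nil then show ?case by (auto simp: realised_def)
next
  case (Cons l ls)
  show ?case
  proof (cases "member (sort_cols S) (snd l)")
    case True then show ?thesis using Cons.prems(1) by auto
  next
    case False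
    then obtain c cs where x: "(c, cs) \<in> set (picks [] S)" "colourable (fst l) c"
      "refuted (coloured (fst l) c cs) ls"
      using Cons.prems(2) by auto
    obtain H' vs' where ok: "step_ok F H' vs' (fst l) H vs" "distinct vs'" "level_ok k F H' vs' ls"
      using Cons.prems(1) by auto
    have "mset (c # cs) = mset S" using mset_picks[OF x(1)] by simp
    then show ?thesis
      using realised_reorder[of k F H vs S "c # cs"] realised_coloured[OF _ ok(1,2) x(2)] Cons.IH[OF
        ok(3) x(3)] by blast
  qed
qed

abbreviation flip_each :: "nat \<Rightarrow> (num \<times> num) list \<Rightarrow> (num \<times> num) list" where
  "flip_each i \<equiv> map (map_prod (flip i) (flip i))"

fun any_refuted :: "(num \<times> num) list \<Rightarrow> num list \<Rightarrow> level list \<Rightarrow> bool" where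
  "any_refuted [] S ls = False"
| "any_refuted (u # us) S ls = (refuted (fst u # snd u # S) ls \<or> any_refuted us S ls)"

fun partners :: "nat list \<Rightarrow> nat list \<Rightarrow> (nat \<times> nat list) list" where
  "partners pre [] = []"
| "partners pre (j # post) = (j, prepend_rev pre post) # partners (j # pre) post"

lemma mset_partners: "x \<in> set (partners pre post) \<Longrightarrow> mset (fst x # snd x) = mset pre + mset post"
  by (induction pre post rule: partners.induct) (auto simp: prepend_rev)

lemma partners_fst: "j \<in> set post \<Longrightarrow> \<exists>rest. (j, rest) \<in> set (partners pre post)"
  by (induction pre post rule: partners.induct) auto

text \<open>The exchange game for two colours. \<open>is\<close> are the ends whose chains are still unknown, and \<open>us\<close> are the
  pairs of columns that arise by exchanging the colours on some of the known chains. The opponent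
  decides which end is joined to the first one, \<open>i\<close>, and loses when an exchange leads to a refuted state.
  If \<open>od\<close> holds, the number of ends is odd and \<open>i\<close> may also be joined to none of them. Two ends that are
  both joined to none can be treated as a pair, because their chains may be exchanged together; so
  a single end needs to be considered only once.\<close>
function beats :: "bool \<Rightarrow> nat list \<Rightarrow> (num \<times> num) list \<Rightarrow> num list \<Rightarrow> level list \<Rightarrow> bool" where
  "beats od [] us S ls = False"
| "beats od (i # is) us S ls \<longleftrightarrow>
     (od \<longrightarrow> any_refuted (flip_each i us) S ls \<or> beats False is (flip_each i us @ us) S ls) \<and>
     (\<forall>x \<in> set (partners [] is).
        any_refuted (flip_each (fst x) (flip_each i us)) S ls \<or>
        beats od (snd x) (flip_each (fst x) (flip_each i us) @ us) S ls)"
  by pat_completeness auto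
termination
proof (relation "measure (\<lambda>(od, is, us, S, ls). length is)", goal_cases)
  case (3 od i "is" us S ls x)
  then have "size (mset (fst x # snd x)) = size (mset is)" using mset_partners by fastforce
  then show ?case by simp
qed auto

lemma any_refuted_iff: "any_refuted us S ls \<longleftrightarrow> (\<exists>u \<in> set us. refuted (fst u # snd u # S) ls)"
  by (induction us) auto

lemma involution_fixed_point:
  assumes "finite A" "odd (card A)" "\<And>x. x \<in> A \<Longrightarrow> \<mu> x \<in> A \<and> \<mu> (\<mu> x) = x"
  shows "\<exists>x \<in> A. \<mu> x = x"
  using assms
proof (induction "card A" arbitrary: A rule: less_induct)
  case less
  then obtain x where x: "x \<in> A" by fastforce
  show ?case
  proof (cases "\<mu> x = x")
    case False
    let ?B = "A - {x, \<mu> x}"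
    have "card ?B = card A - 2" using less.prems x False by (simp add: card_Diff_subset)
    moreover have "2 \<le> card A" using card_mono[of A "{x, \<mu> x}"] less.prems x False by auto
    moreover have "\<mu> y \<in> ?B \<and> \<mu> (\<mu> y) = y" if "y \<in> ?B" for y
      using that less.prems(3)[of y] less.prems(3)[OF x] by auto
    ultimately have "\<exists>y \<in> ?B. \<mu> y = y" using less.hyps[of ?B] less.prems(1,2) by auto
    then show ?thesis by blast
  qed (use x in auto)
qed

text \<open>\<open>\<mu>\<close> is the true pairing. The induction follows the choices that agree with it; if \<open>i\<close> is a fixed point
  and the number of ends is even, then parity gives another fixed point to pair \<open>i\<close> with.\<close>
lemma beats_sound:
  assumes "beats od is us S ls" and "distinct is" "od \<longleftrightarrow> odd (length is)"
    and "\<And>i. i \<in> set is \<Longrightarrow> \<mu> i \<in> set is \<and> \<mu> (\<mu> i) = i" "set is \<subseteq> D" 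
    and "\<And>u. u \<in> set us \<Longrightarrow> \<exists>js. distinct js \<and> set js \<subseteq> D - set is \<and> (\<forall>j \<in> set js. \<mu> j \<in> set js) \<and>
           u = (foldr flip js a, foldr flip js b)"
  shows "\<exists>js. distinct js \<and> set js \<subseteq> D \<and> (\<forall>j \<in> set js. \<mu> j \<in> set js) \<and>
           refuted (foldr flip js a # foldr flip js b # S) ls"
  using assms
proof (induction od "is" us S ls rule: beats.induct)
  case (2 od i "is" us S ls)
  have mi: "\<mu> i \<in> set (i # is)" "\<mu> (\<mu> i) = i" using 2(6)[of i] by auto
  show ?case
  proof (cases "od \<and> \<mu> i = i")
    case True
    have inv: "\<exists>js. distinct js \<and> set js \<subseteq> D - set is \<and> (\<forall>j \<in> set js. \<mu> j \<in> set js) \<and>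
           u = (foldr flip js a, foldr flip js b)" if "u \<in> set (flip_each i us) \<or> u \<in> set us" for u
      using that
    proof
      assume "u \<in> set us"
      then obtain js where "distinct js" "set js \<subseteq> D - set (i # is)" "\<forall>j \<in> set js. \<mu> j \<in> set js"
        "u = (foldr flip js a, foldr flip js b)"
        using 2(8)[of u] by blast
      then show ?thesis by (intro exI[of _ js]) auto
    next
      assume "u \<in> set (flip_each i us)"
      then obtain u' where u': "u' \<in> set us" "u = (flip i (fst u'), flip i (snd u'))"
        by (auto simp: map_prod_def split: prod.splits)
      obtain js where "distinct js" "set js \<subseteq> D - set (i # is)" "\<forall>j \<in> set js. \<mu> j \<in> set js"
        "u' = (foldr flip js a, foldr flip js b)"
        using 2(8)[OF u'(1)] by blast
      then show ?thesis using u' 2(7) True \<open>distinct (i # is)\<close> by (intro exI[of _ "i # js"]) auto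
    qed
    consider "any_refuted (flip_each i us) S ls" | "beats False is (flip_each i us @ us) S ls"
      using 2(3) True by auto
    then show ?thesis
    proof cases
      case 1
      then obtain u where "u \<in> set (flip_each i us)" "refuted (fst u # snd u # S) ls"
        unfolding any_refuted_iff by blast
      then show ?thesis using inv[of u] by fastforce
    next
      case b: 2
      have "\<mu> x \<in> set is \<and> \<mu> (\<mu> x) = x" if "x \<in> set is" for x
        using 2(6)[of x] that True \<open>distinct (i # is)\<close> by auto
      then show ?thesis
        using True 2(4,5,7) inv by (intro 2(1)[OF _ b]) auto
    qed
  next
    case False
    obtain j where j: "j \<in> set is" "{\<mu> i, \<mu> j} = {i, j}"
    proof (cases "\<mu> i = i")
      case True
      then have "odd (card (set is))" using False 2(4,5) by (simp add: distinct_card)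
      moreover have "\<mu> x \<in> set is \<and> \<mu> (\<mu> x) = x" if "x \<in> set is" for x
        using 2(6)[of x] that True \<open>distinct (i # is)\<close> by auto
      ultimately show ?thesis using involution_fixed_point[of "set is" \<mu>] that True by auto
    next
      case False
      then show ?thesis using mi that[of "\<mu> i"] by auto
    qed
    obtain rest where rest: "(j, rest) \<in> set (partners [] is)" using partners_fst[OF j(1)] by blast
    have ms: "mset is = add_mset j (mset rest)" using mset_partners[OF rest] by simp
    then have dr: "distinct rest" "j \<notin> set rest" "set is = insert j (set rest)"
      "length is = Suc (length rest)"
      using \<open>distinct (i # is)\<close> mset_eq_imp_distinct_iff[of "is" "j # rest"] mset_eq_setD[of "is"
        "j # rest"] mset_eq_length[of "is" "j # rest"] by auto
    have inv: "\<exists>js. distinct js \<and> set js \<subseteq> D - set rest \<and> (\<forall>j \<in> set js. \<mu> j \<in> set js) \<and>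
           u = (foldr flip js a, foldr flip js b)" if "u \<in> set (flip_each j (flip_each i us)) \<or> u \<in>
             set us" for u
      using that
    proof
      assume "u \<in> set us"
      then obtain js where "distinct js" "set js \<subseteq> D - set (i # is)" "\<forall>j \<in> set js. \<mu> j \<in> set js"
        "u = (foldr flip js a, foldr flip js b)"
        using 2(8)[of u] by blast
      then show ?thesis using dr(3) by (intro exI[of _ js]) auto
    next
      assume "u \<in> set (flip_each j (flip_each i us))"
      then obtain u' where u': "u' \<in> set us"
        "u = (flip j (flip i (fst u')), flip j (flip i (snd u')))"
        by (auto simp: map_prod_def split: prod.splits)
      obtain js where "distinct js" "set js \<subseteq> D - set (i # is)" "\<forall>j \<in> set js. \<mu> j \<in> set js"
        "u' = (foldr flip js a, foldr flip js b)"
        using 2(8)[OF u'(1)] by blast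
      moreover have "\<mu> i \<in> {i, j}" "\<mu> j \<in> {i, j}" using j(2) by auto
      ultimately show ?thesis using u' 2(7) \<open>distinct (i # is)\<close> j dr
        by (intro exI[of _ "j # i # js"]) auto
    qed
    consider "any_refuted (flip_each j (flip_each i us)) S ls" |
      "beats od rest (flip_each j (flip_each i us) @ us) S ls"
      using 2(3) rest by fastforce
    then show ?thesis
    proof cases
      case 1
      then obtain u where "u \<in> set (flip_each j (flip_each i us))" "refuted (fst u # snd u # S) ls"
        unfolding any_refuted_iff by blast
      then show ?thesis using inv[of u] by fastforce
    next
      case b: 2
      have closed: "\<mu> x \<in> set rest \<and> \<mu> (\<mu> x) = x" if x: "x \<in> set rest" for x
      proof -
        have "\<mu> x \<in> set (i # is)" "\<mu> (\<mu> x) = x" using 2(6)[of x] x dr by auto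
        moreover have "\<mu> x \<notin> {i, j}"
        proof
          assume "\<mu> x \<in> {i, j}"
          then have "x \<in> {\<mu> i, \<mu> j}" using \<open>\<mu> (\<mu> x) = x\<close> by auto
          then show False using j(2) x dr \<open>distinct (i # is)\<close> by auto
        qed
        ultimately show ?thesis using dr by auto
      qed
      have "\<exists>js. distinct js \<and> set js \<subseteq> D \<and> (\<forall>j \<in> set js. \<mu> j \<in> set js) \<and>
           refuted (foldr flip js a # foldr flip js b # S) ls"
      proof (rule 2(2)[OF rest])
        show "beats od (snd (j, rest)) (flip_each (fst (j, rest)) (flip_each i us) @ us) S ls"
          using b by simp
        show "distinct (snd (j, rest))" "od = odd (length (snd (j, rest)))"
          "set (snd (j, rest)) \<subseteq> D"
          using dr 2(5,7) by auto
      qed (use closed inv in auto)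
      then show ?thesis .
    qed
  qed
qed auto

fun odd_length :: "nat list \<Rightarrow> bool" where
  "odd_length [] = False"
| "odd_length [i] = True"
| "odd_length (i # j # is) = odd_length is"

lemma odd_length_iff: "odd_length is \<longleftrightarrow> odd (length is)"
  by (induction "is" rule: odd_length.induct) auto

fun forced :: "num list \<Rightarrow> level list \<Rightarrow> bool" where
  "forced [] ls = False"
| "forced [a] ls = False"
| "forced (a # b # S) ls = beats (odd_length (diffs 0 a b)) (diffs 0 a b) [(a, b)] S ls"

lemma forced_sound:
  assumes f: "forced S ls" and ok: "level_ok k F H vs ls"
    and fin: "finite F" "\<And>e. e \<in> F \<Longrightarrow> card e = 2" and d: "distinct vs"
  shows "\<not> realised k F H vs S"
proof
  assume R: "realised k F H vs S"
  obtain a b S' where S: "S = a # b # S'" using f by (cases "(S, ls)" rule: forced.cases) auto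
  obtain \<mu> where mu: "\<And>i. i \<in> set (diffs 0 a b) \<Longrightarrow> \<mu> i \<in> set (diffs 0 a b) \<and> \<mu> (\<mu> i) = i"
    and swap: "\<And>is. distinct is \<Longrightarrow> set is \<subseteq> set (diffs 0 a b) \<Longrightarrow> (\<And>i. i \<in> set is \<Longrightarrow> \<mu> i \<in> set is) \<Longrightarrow>
       realised k F H vs (foldr flip is a # foldr flip is b # S')"
    and dd: "distinct (diffs 0 a b)"
    using kempe_realised[OF R[unfolded S] fin d] by blast
  have "\<exists>js. distinct js \<and> set js \<subseteq> set (diffs 0 a b) \<and> (\<forall>j \<in> set js. \<mu> j \<in> set js) \<and>
           refuted (foldr flip js a # foldr flip js b # S') ls"
  proof (rule beats_sound)
    show "beats (odd_length (diffs 0 a b)) (diffs 0 a b) [(a, b)] S' ls" using f by (simp add: S)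
  qed (use dd mu in \<open>auto simp: odd_length_iff intro: exI[of _ "[]"]\<close>)
  then show False using swap refuted_sound[OF ok] by blast
qed

abbreviation nums :: "nat list \<Rightarrow> num list" where "nums \<equiv> map num_of_nat"

fun add_if :: "bool \<Rightarrow> num list \<Rightarrow> trie \<Rightarrow> trie" where
  "add_if True S t = add (sort_cols S) t"
| "add_if False S t = t"

text \<open>Each listed state is tested before it enters the table, and it may use the earlier ones. An entry
  that fails the test is skipped, so correctness does not depend on the certificate.\<close>
fun collect :: "nat list list \<Rightarrow> step \<Rightarrow> trie \<Rightarrow> level list \<Rightarrow> trie" where
  "collect [] st t ls = t"
| "collect (S # Ss) st t ls = collect Ss st (add_if (forced (nums S) ((st, t) # ls)) (nums S) t) ls"

fun add_all :: "nat list list \<Rightarrow> trie \<Rightarrow> trie" where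
  "add_all [] t = t"
| "add_all (S # Ss) t = add_all Ss (add (sort_cols (nums S)) t)"

lemma level_ok_add:
  assumes "level_ok k F H vs ((st, t) # ls)" "\<not> realised k F H vs S"
  shows "level_ok k F H vs ((st, add (sort_cols S) t) # ls)"
proof -
  have "\<not> realised k F H vs T" if T: "member (sort_cols T) (add (sort_cols S) t)" for T
  proof (cases "sort_cols T = sort_cols S")
    case True
    then have "mset T = mset S" by (metis mset_sort_cols)
    then show ?thesis using assms(2) realised_reorder by metis
  next
    case False then show ?thesis using member_add[OF T] assms(1) by auto
  qed
  then show ?thesis using assms(1) by auto
qed

lemma level_ok_collect:
  assumes "finite F" "\<And>e. e \<in> F \<Longrightarrow> card e = 2" "distinct vs"
  shows "level_ok k F H vs ((st, t) # ls) \<Longrightarrow> level_ok k F H vs ((st, collect Ss st t ls) # ls)"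
proof (induction Ss arbitrary: t)
  case (Cons S Ss)
  show ?case
  proof (cases "forced (nums S) ((st, t) # ls)")
    case True
    then show ?thesis using Cons.IH level_ok_add[OF Cons.prems] forced_sound[OF True Cons.prems
      assms] by (simp del: level_ok.simps)
  next
    case False then show ?thesis using Cons by (simp del: level_ok.simps)
  qed
qed simp

lemma level_ok_add_all:
  "level_ok k F H vs ((st, t) # ls) \<Longrightarrow> \<forall>S \<in> set Ss. \<not> realised k F H vs (nums S) \<Longrightarrow>
     level_ok k F H vs ((st, add_all Ss t) # ls)"
  by (induction Ss arbitrary: t) (simp_all add: level_ok_add del: level_ok.simps)

fun neg :: "bool \<Rightarrow> bool" where "neg True = False" | "neg False = True"

lemma neg_iff [simp]: "neg b \<longleftrightarrow> \<not> b" by (cases b) auto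

text \<open>All ways to put a flag for a new vertex in front of the columns such that exactly \<open>m\<close> of them are set.\<close>
fun choices :: "nat \<Rightarrow> num list \<Rightarrow> num list list" where
  "choices 0 [] = [[]]"
| "choices (Suc m) [] = []"
| "choices 0 (c # cs) = map ((#) (num.Bit0 c)) (choices 0 cs)"
| "choices (Suc m) (c # cs) =
     map ((#) (num.Bit1 c)) (choices m cs) @ map ((#) (num.Bit0 c)) (choices (Suc m) cs)"

lemma choices_complete:
  "map (\<lambda>c. (if P c then num.Bit1 else num.Bit0) (f c)) cs \<in> set (choices (length (filter P cs))
    (map f cs))"
proof (induction cs)
  case (Cons c cs)
  show ?case
  proof (cases "P c")
    case False
    then show ?thesis using Cons by (cases "length (filter P cs)") auto
  qed (use Cons in auto)
qed auto

text \<open>The reverse of \<open>coloured\<close>: when the next edge is uncoloured, its colour becomes free at both ends, and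
  so this colour was not free there before. \<open>extend\<close> lists the states that may arise.\<close>
fun usable :: "step \<Rightarrow> num \<Rightarrow> bool" where
  "usable (Attach p) c = neg (flag p c)"
| "usable (Join p q) c = cnj (neg (flag p c)) (neg (flag q c))"

fun extend_by :: "bool \<Rightarrow> step \<Rightarrow> nat \<Rightarrow> num \<Rightarrow> num list \<Rightarrow> num list list" where
  "extend_by False st m c cs = []"
| "extend_by True (Attach p) m c cs = map ((#) (num.Bit1 (flip p c))) (choices m cs)"
| "extend_by True (Join p q) m c cs = [flip p (flip q c) # cs]"

fun extend :: "step \<Rightarrow> nat \<Rightarrow> num list \<Rightarrow> num list \<Rightarrow> num list list" where
  "extend st m pre [] = []"
| "extend st m pre (c # cs) =
     extend_by (usable st c) st m c (prepend_rev pre cs) @ extend st m (c # pre) cs"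

lemma extend_mem:
  "T \<in> set (extend_by (usable st c) st m c (rev pre @ as @ bs)) \<Longrightarrow> T \<in> set (extend st m pre (as @ c #
    bs))"
  by (induction as arbitrary: pre) (auto simp: prepend_rev)

lemma card_free:
  assumes col: "colouring k E \<phi>" and fin: "finite E" and cs: "distinct cs" "set cs = {..<k}"
  shows "length (filter (\<lambda>c. free E \<phi> c w) cs) = k - card {e \<in> E. w \<in> e}"
proof -
  let ?A = "{e \<in> E. w \<in> e}"
  have "inj_on \<phi> ?A" using colouringD[OF col] by (auto intro!: inj_onI)
  then have "card (\<phi> ` ?A) = card ?A" by (rule card_image)
  moreover have "\<phi> ` ?A \<subseteq> {..<k}" using col by (auto simp: colouring_def)
  moreover have "{c. c < k \<and> free E \<phi> c w} = {..<k} - \<phi> ` ?A" by (auto simp: free_def)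
  moreover have "set (filter (\<lambda>c. free E \<phi> c w) cs) = {c. c < k \<and> free E \<phi> c w}" using cs by auto
  ultimately show ?thesis using cs(1) fin
    by (metis card_Diff_subset card_lessThan distinct_card distinct_filter finite_lessThan
    finite_subset)
qed

lemma realised_extend:
  assumes R: "realised k F H vs S" and st: "step_ok F H vs st H' vs'" and d: "distinct vs"
    and H: "\<Union> H \<subseteq> set vs" and fin: "finite F" and m:
      "\<And>w. vs' = w # vs \<Longrightarrow> card {e \<in> F. w \<in> e} + m = k"
  obtains T where "T \<in> set (extend st m [] S)" "realised k F H' vs' T"
proof -
  obtain \<phi> cs where col: "colouring k (F - H) \<phi>" and cs: "distinct cs" "set cs = {..<k}" and S:
    "S = map (column (F - H) \<phi> vs) cs"
    using R by (auto simp: realised_def)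
  define E where "E = F - H'"
  show thesis
  proof (cases st)
    case (Attach p)
    then obtain w where w: "vs' = w # vs" "w \<notin> set vs" and p: "p < length vs" and e:
      "{vs ! p, w} \<in> F - H" "H' = insert {vs ! p, w} H"
      using st by auto
    define e where "e = {vs ! p, w}"
    have E: "F - H = insert e E" "e \<notin> E" using e by (auto simp: E_def e_def)
    note un = uncolour_edge[OF col[unfolded E] E(2)]
    define j where "j = \<phi> e"
    have "j < k" using col e by (auto simp: colouring_def j_def e_def)
    then obtain as bs where ab: "cs = as @ j # bs" using cs(2) by (metis lessThan_iff split_list)
    have nofree: "\<not> free (F - H) \<phi> j v" if "v \<in> e" for v using that E by (auto simp: free_def j_def)
    have cj: "column E \<phi> vs' j = num.Bit1 (flip p (column (F - H) \<phi> vs j))"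
    proof -
      have "encode (map (free E \<phi> j) vs) = flip p (encode (map (free (F - H) \<phi> j) vs))"
        by (rule flip_encode_map[OF d p]) (use un(2) nofree w(2) in \<open>auto simp: E(1) j_def e_def\<close>)
      moreover have "free E \<phi> j w" using un(2) by (auto simp: j_def e_def)
      ultimately show ?thesis by (simp add: column_def w)
    qed
    have ci: "column E \<phi> vs' i = (if free (F - H) \<phi> i w then num.Bit1 else num.Bit0) (column (F - H)
      \<phi> vs i)" if "i \<noteq> j" for i
    proof -
      have "free E \<phi> i = free (F - H) \<phi> i" using un(2) that by (intro ext) (auto simp: E(1) j_def)
      then show ?thesis by (simp add: column_def w)
    qed
    have "{f \<in> F - H. w \<in> f} = {f \<in> F. w \<in> f}" using H w(2) by auto
    then have "length (filter (\<lambda>c. free (F - H) \<phi> c w) cs) = m"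
      using card_free[OF col _ cs, of w] fin m[OF w(1)] by simp
    then have len: "length (filter (\<lambda>c. free (F - H) \<phi> c w) (as @ bs)) = m"
      using nofree[of w] by (simp add: ab e_def)
    let ?T = "map (column E \<phi> vs') (j # as @ bs)"
    have "?T \<in> set (extend_by True st m (column (F - H) \<phi> vs j) (map (column (F - H) \<phi> vs) (as @
      bs)))"
    proof -
      have "map (column E \<phi> vs') (as @ bs) =
          map (\<lambda>i. (if free (F - H) \<phi> i w then num.Bit1 else num.Bit0) (column (F - H) \<phi> vs i)) (as
            @ bs)"
      proof (rule map_cong[OF refl])
        fix i assume "i \<in> set (as @ bs)"
        then have "i \<noteq> j" using cs(1) ab by auto
        then show "column E \<phi> vs' i = (if free (F - H) \<phi> i w then num.Bit1 else num.Bit0) (column (F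
          - H) \<phi> vs i)" by (rule ci)
      qed
      then have "map (column E \<phi> vs') (as @ bs) \<in> set (choices m (map (column (F - H) \<phi> vs) (as @
        bs)))"
        using choices_complete[of "\<lambda>c. free (F - H) \<phi> c w" "column (F - H) \<phi> vs" "as @ bs"] len
          by metis
      then show ?thesis using cj by (simp add: Attach)
    qed
    moreover have "usable st (column (F - H) \<phi> vs j)" using nofree[of "vs ! p"] p
      by (simp add: Attach column_def e_def)
    ultimately have "?T \<in> set (extend st m [] S)"
      unfolding S ab using extend_mem[of ?T st _ m "[]"] by simp
    moreover have "realised k F H' vs' ?T"
      unfolding realised_def E_def[symmetric] using un(1) cs ab
        by (intro exI[of _ \<phi>] exI[of _ "j # as @ bs"]) auto
    ultimately show thesis by (rule that)
  next
    case (Join p q)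
    then have w: "vs' = vs" and p: "p < length vs" "q < length vs" "p \<noteq> q" and e:
      "{vs ! p, vs ! q} \<in> F - H" "H' = insert {vs ! p, vs ! q} H"
      using st by auto
    define e where "e = {vs ! p, vs ! q}"
    have ne: "vs ! p \<noteq> vs ! q" using p d by (simp add: nth_eq_iff_index_eq)
    have E: "F - H = insert e E" "e \<notin> E" using e by (auto simp: E_def e_def)
    note un = uncolour_edge[OF col[unfolded E] E(2)]
    define j where "j = \<phi> e"
    have "j < k" using col e by (auto simp: colouring_def j_def e_def)
    then obtain as bs where ab: "cs = as @ j # bs" using cs(2) by (metis lessThan_iff split_list)
    have nofree: "\<not> free (F - H) \<phi> j v" if "v \<in> e" for v using that E by (auto simp: free_def j_def)
    have cj: "column E \<phi> vs' j = flip p (flip q (column (F - H) \<phi> vs j))"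
    proof -
      have "encode (map (free E \<phi> j) vs) =
          flip p (encode (map (\<lambda>v.
            if v = vs ! q then \<not> free (F - H) \<phi> j v else free (F - H) \<phi> j v) vs))"
        by (rule flip_encode_map[OF d p(1)]) (use un(2) nofree ne in \<open>auto simp: E(1) j_def e_def\<close>)
      also have "encode (map (\<lambda>v. if v = vs ! q then \<not> free (F - H) \<phi> j v else free (F - H) \<phi> j v)
        vs) =
          flip q (encode (map (free (F - H) \<phi> j) vs))"
        by (rule flip_encode_map[OF d p(2)]) auto
      finally show ?thesis by (simp only: column_def w)
    qed
    have ci: "column E \<phi> vs' i = column (F - H) \<phi> vs i" if "i \<noteq> j" for i
    proof -
      have "free E \<phi> i = free (F - H) \<phi> i" using un(2) that by (intro ext) (auto simp: E(1) j_def)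
      then show ?thesis by (simp add: column_def w)
    qed
    let ?T = "map (column E \<phi> vs') (j # as @ bs)"
    have "map (column E \<phi> vs') (as @ bs) = map (column (F - H) \<phi> vs) (as @ bs)"
    proof (rule map_cong[OF refl])
      fix i assume "i \<in> set (as @ bs)"
      then have "i \<noteq> j" using cs(1) ab by auto
      then show "column E \<phi> vs' i = column (F - H) \<phi> vs i" by (rule ci)
    qed
    then have "?T \<in> set (extend_by True st m (column (F - H) \<phi> vs j) (map (column (F - H) \<phi> vs) (as
      @ bs)))"
      using cj by (simp add: Join)
    moreover have "usable st (column (F - H) \<phi> vs j)"
      using nofree[of "vs ! p"] nofree[of "vs ! q"] p by (simp add: Join column_def e_def)
    ultimately have "?T \<in> set (extend st m [] S)"
      unfolding S ab using extend_mem[of ?T st _ m "[]"] by simp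
    moreover have "realised k F H' vs' ?T"
      unfolding realised_def E_def[symmetric] using un(1) cs ab
        by (intro exI[of _ \<phi>] exI[of _ "j # as @ bs"]) auto
    ultimately show thesis by (rule that)
  qed
qed

fun all_refuted :: "num list list \<Rightarrow> level list \<Rightarrow> bool" where
  "all_refuted [] ls = True"
| "all_refuted (S # Ss) ls = cnj (refuted S ls) (all_refuted Ss ls)"

lemma all_refuted_iff: "all_refuted Ss ls \<longleftrightarrow> (\<forall>S \<in> set Ss. refuted S ls)" by (induction Ss) auto

fun extensions_refuted :: "step \<Rightarrow> nat \<Rightarrow> num list list \<Rightarrow> level list \<Rightarrow> bool" where
  "extensions_refuted st m [] ls = True"
| "extensions_refuted st m (S # Ss) ls =
     cnj (all_refuted (extend st m [] S) ls) (extensions_refuted st m Ss ls)"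

lemma extensions_refuted_iff:
  "extensions_refuted st m Ss ls \<longleftrightarrow> (\<forall>S \<in> set Ss. \<forall>T \<in> set (extend st m [] S). refuted T ls)"
  by (induction Ss) (auto simp: all_refuted_iff)

text \<open>One stage of a certificate: the step; the number of colours that are free at an attached vertex before
  its new edge is uncoloured; the states to be refuted outright; the states from which a normal form can
  be reached; the normal forms.\<close>
datatype stage = Stage step nat "nat list list" "nat list list" "nat list list"

text \<open>The normal forms and the states that lead to them are put into a table \<open>t'\<close> that is used for one
  purpose only: if all extensions of the previous normal forms are refuted by \<open>t'\<close>, then they cannot all
  occur without some new normal form occurring. The search continues with the new normal forms and with
  the table \<open>t\<close>, which is free of this assumption, and succeeds when no normal form is left.\<close>
fun reducible :: "stage list \<Rightarrow> num list list \<Rightarrow> level list \<Rightarrow> bool"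
  and reducible_with :: "trie \<Rightarrow> step \<Rightarrow> nat \<Rightarrow> nat list list \<Rightarrow> nat list list \<Rightarrow> stage list \<Rightarrow> num list
    list \<Rightarrow> level list \<Rightarrow> bool" where
  "reducible [] [] ls = True"
| "reducible [] (S # Ss) ls = False"
| "reducible (Stage st m C R N # sts) Ss ls = reducible_with (collect C st Absent ls) st m R N sts
  Ss ls"
| "reducible_with t st m R N sts Ss ls =
     cnj (extensions_refuted st m Ss ((st, collect R st (add_all N t) ls) # ls)) (reducible sts (map
       nums N) ((st, t) # ls))"

text \<open>\<open>ws\<close> are vertices of the graph that realise the attached vertices of the certificate.\<close>
fun fits :: "nat \<Rightarrow> 'a set set \<Rightarrow> 'a set set \<Rightarrow> 'a list \<Rightarrow> stage list \<Rightarrow> 'a list \<Rightarrow> bool" where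
  "fits k F H vs [] ws = True"
| "fits k F H vs (Stage (Attach p) m C R N # sts) [] = False"
| "fits k F H vs (Stage (Attach p) m C R N # sts) (w # ws) \<longleftrightarrow>
     p < length vs \<and> w \<notin> set vs \<and> {vs ! p, w} \<in> F \<and> card {e \<in> F. w \<in> e} + m = k \<and>
     fits k F (insert {vs ! p, w} H) (w # vs) sts ws"
| "fits k F H vs (Stage (Join p q) m C R N # sts) ws \<longleftrightarrow>
     p < length vs \<and> q < length vs \<and> p \<noteq> q \<and> {vs ! p, vs ! q} \<in> F - H \<and>
     fits k F (insert {vs ! p, vs ! q} H) vs sts ws"

lemma reducible_sound:
  assumes fin: "finite F" "\<And>e. e \<in> F \<Longrightarrow> card e = 2"
  shows "reducible sts Ss ls \<Longrightarrow> level_ok k F H vs ls \<Longrightarrow> distinct vs \<Longrightarrow> \<Union> H \<subseteq> set vs \<Longrightarrow>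
     \<exists>S \<in> set Ss. realised k F H vs S \<Longrightarrow> \<not> fits k F H vs sts ws"
proof (induction sts arbitrary: Ss ls H vs ws)
  case Nil then show ?case by (cases Ss) auto
next
  case (Cons sg sts)
  obtain st m C R N where sg: "sg = Stage st m C R N" by (cases sg)
  define t where "t = collect C st Absent ls"
  have red: "extensions_refuted st m Ss ((st, collect R st (add_all N t) ls) # ls)"
    "reducible sts (map nums N) ((st, t) # ls)"
    using Cons.prems(1) by (auto simp: sg t_def)
  show ?case
  proof
    assume f: "fits k F H vs (sg # sts) ws"
    obtain H' vs' ws' where st: "step_ok F H vs st H' vs'" and d: "distinct vs'" "\<Union> H' \<subseteq> set vs'"
      and m: "\<And>w. vs' = w # vs \<Longrightarrow> card {e \<in> F. w \<in> e} + m = k" and f': "fits k F H' vs' sts ws'"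
    proof (cases st)
      case (Attach p)
      then obtain w ws' where w: "ws = w # ws'" using f by (cases ws) (auto simp: sg)
      then have "p < length vs" "w \<notin> set vs" "{vs ! p, w} \<in> F" "card {e \<in> F. w \<in> e} + m = k"
        "fits k F (insert {vs ! p, w} H) (w # vs) sts ws'"
        using f by (auto simp: sg Attach)
      then show thesis using Cons.prems(3,4) Attach
        by (intro that[of "insert {vs ! p, w} H" "w # vs" ws']) auto
    next
      case (Join p q)
      then have "p < length vs" "q < length vs" "p \<noteq> q" "{vs ! p, vs ! q} \<in> F - H"
        "fits k F (insert {vs ! p, vs ! q} H) vs sts ws"
        using f by (auto simp: sg Join)
      then show thesis using Cons.prems(3,4) Join
        by (intro that[of "insert {vs ! p, vs ! q} H" vs ws]) auto
    qed
    have ok0: "level_ok k F H' vs' ((st, Absent) # ls)" using st Cons.prems(2,3) by auto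
    have ok: "level_ok k F H' vs' ((st, t) # ls)"
      unfolding t_def by (rule level_ok_collect[OF fin d(1) ok0])
    obtain S where S: "S \<in> set Ss" "realised k F H vs S" using Cons.prems(5) by blast
    obtain T where T: "T \<in> set (extend st m [] S)" "realised k F H' vs' T"
      using realised_extend[OF S(2) st Cons.prems(3,4) fin(1) m] by blast
    \<comment> \<open>Otherwise the table that contains the normal forms would be correct and refute the state
      \<open>T\<close>.\<close>
    have "\<exists>S \<in> set (map nums N). realised k F H' vs' S"
    proof (rule ccontr)
      assume "\<not> ?thesis"
      then have "level_ok k F H' vs' ((st, add_all N t) # ls)" using level_ok_add_all[OF ok] by auto
      from level_ok_collect[OF fin d(1) this]
      have "level_ok k F H' vs' ((st, collect R st (add_all N t) ls) # ls)" .
      then show False using refuted_sound red(1) S(1) T by (metis extensions_refuted_iff)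
    qed
    then show False using Cons.IH[OF red(2) ok d] f' by blast
  qed
qed

text \<open>The state of a configuration that consists of one uncoloured edge between vertices of degrees \<open>dx\<close> and
  \<open>dy\<close>. It is unique because no colour is free at both ends.\<close>
definition start :: "nat \<Rightarrow> nat \<Rightarrow> nat \<Rightarrow> num list" where
  "start k dx dy = replicate (k + 1 - dx) (num.Bit0 (num.Bit1 num.One)) @
     replicate (k + 1 - dy) (num.Bit1 (num.Bit0 num.One)) @
     replicate (k - (k + 1 - dx) - (k + 1 - dy)) (num.Bit0 (num.Bit0 num.One))"

lemma realised_start:
  assumes fin: "finite F" and e: "{x, y} \<in> F" "x \<noteq> y" and no: "\<nexists>\<phi>. colouring k F \<phi>"
    and crit: "\<exists>\<phi>. colouring k (F - {{x, y}}) \<phi>"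
  shows "k + 2 \<le> card {e \<in> F. x \<in> e} + card {e \<in> F. y \<in> e}"
    and "realised k F {{x, y}} [y, x] (start k (card {e \<in> F. x \<in> e}) (card {e \<in> F. y \<in> e}))"
proof -
  define E where "E = F - {{x, y}}"
  obtain \<phi> where col: "colouring k E \<phi>" using crit by (auto simp: E_def)
  have F: "F = insert {x, y} E" "{x, y} \<notin> E" using e by (auto simp: E_def)
  have disj: "\<not> (free E \<phi> c x \<and> free E \<phi> c y)" if "c < k" for c
    using colour_edge(1)[OF col F(2) refl that] no F(1) by metis
  define A where "A = filter (\<lambda>c. free E \<phi> c x) [0..<k]"
  define B where "B = filter (\<lambda>c. free E \<phi> c y) [0..<k]"
  define C where "C = filter (\<lambda>c. \<not> free E \<phi> c x \<and> \<not> free E \<phi> c y) [0..<k]"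
  have deg: "card {f \<in> F. v \<in> f} = Suc (card {f \<in> E. v \<in> f})" if "v \<in> {x, y}" for v
  proof -
    have "{f \<in> F. v \<in> f} = insert {x, y} {f \<in> E. v \<in> f}" using that F by auto
    then show ?thesis using F fin by simp
  qed
  have lA: "length A = k + 1 - card {e \<in> F. x \<in> e}" and lB: "length B = k + 1 - card {e \<in> F. y \<in> e}"
    unfolding A_def B_def using card_free[OF col, of "[0..<k]"] fin deg
      by (auto simp: E_def atLeast0LessThan)
  have dist: "distinct (A @ B @ C)" unfolding A_def B_def C_def using disj by auto
  have set: "set (A @ B @ C) = {..<k}" unfolding A_def B_def C_def by auto
  have len: "length A + length B + length C = k" using distinct_card[OF dist] set by simp
  then show "k + 2 \<le> card {e \<in> F. x \<in> e} + card {e \<in> F. y \<in> e}" using lA lB by linarith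
  have cols: "map (column E \<phi> [y, x]) A = replicate (length A) (num.Bit0 (num.Bit1 num.One))"
    "map (column E \<phi> [y, x]) B = replicate (length B) (num.Bit1 (num.Bit0 num.One))"
    "map (column E \<phi> [y, x]) C = replicate (length C) (num.Bit0 (num.Bit0 num.One))"
    unfolding map_replicate_const[symmetric] using disj by (auto simp: A_def B_def C_def column_def)
  have "length C = k - length A - length B" using len by simp
  then have "start k (card {e \<in> F. x \<in> e}) (card {e \<in> F. y \<in> e})
    = map (column E \<phi> [y, x]) (A @ B @ C)"
    unfolding start_def lA[symmetric] lB[symmetric] using cols by simp
  then show "realised k F {{x, y}} [y, x] (start k (card {e \<in> F. x \<in> e}) (card {e \<in> F. y \<in> e}))"
    unfolding realised_def E_def[symmetric] using col dist set by blast
qed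

lemma reducible_configuration:
  assumes fin: "finite F" "\<And>e. e \<in> F \<Longrightarrow> card e = 2" and no: "\<nexists>\<phi>. colouring k F \<phi>"
    and crit: "\<exists>\<phi>. colouring k (F - {{x, y}}) \<phi>" and e: "{x, y} \<in> F"
    and red: "reducible sts [start k (card {e \<in> F. x \<in> e}) (card {e \<in> F. y \<in> e})] [(Attach 0,
      Absent)]"
  shows "\<not> fits k F {{x, y}} [y, x] sts ws"
proof -
  have xy: "x \<noteq> y" using fin(2)[OF e] by auto
  have "level_ok k F {} [x] []" using no by simp
  then have "level_ok k F {{x, y}} [y, x] [(Attach 0, Absent)]"
    using e xy by (auto intro!: exI[of _ "{}"] exI[of _ "[x]"])
  then show ?thesis
    using reducible_sound[OF fin red] realised_start(2)[OF fin(1) e xy no crit] xy by simp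
qed

text \<open>The simplifier computes arguments before it unfolds a function. In order not to compute what is not
  needed, each case distinction of the search is made a function of its own, whose first argument is the
  truth value that decides the case. The levels, which are large terms, come last: a rewrite step
  inspects the partial applications of a function, too, and they should be small.\<close>
definition refuted_or :: "bool \<Rightarrow> num list \<Rightarrow> step \<Rightarrow> level list \<Rightarrow> bool" where
  "refuted_or b S st ls \<longleftrightarrow>
     b \<or> (\<exists>x \<in> set (picks [] S). colourable st (fst x) \<and> refuted (coloured st (fst x) (snd x)) ls)"
definition refuted_by :: "num list \<Rightarrow> num list \<Rightarrow> step \<Rightarrow> level list \<Rightarrow> bool" where
  "refuted_by pre cs st ls \<longleftrightarrow>
     (\<exists>x \<in> set (picks pre cs). colourable st (fst x) \<and> refuted (coloured st (fst x) (snd x)) ls)"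
definition refuted_by_if :: "bool \<Rightarrow> num \<Rightarrow> num list \<Rightarrow> num list \<Rightarrow> step \<Rightarrow> level list \<Rightarrow> bool" where
  "refuted_by_if b c pre cs st ls \<longleftrightarrow>
     b \<and> refuted (coloured st c (prepend_rev pre cs)) ls \<or> refuted_by (c # pre) cs st ls"
definition refuted_by_or :: "bool \<Rightarrow> num \<Rightarrow> num list \<Rightarrow> num list \<Rightarrow> step \<Rightarrow> level list \<Rightarrow> bool" where
  "refuted_by_or b c pre cs st ls \<longleftrightarrow> b \<or> refuted_by (c # pre) cs st ls"

lemma refuted_eval:
  "refuted S [] = True"
  "refuted S ((st, t) # ls) = refuted_or (member (sort_cols S) t) S st ls"
  "refuted_or True S st ls = True"
  "refuted_or False S st ls = refuted_by [] S st ls"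
  "refuted_by pre [] st ls = False"
  "refuted_by pre (c # cs) st ls = refuted_by_if (colourable st c) c pre cs st ls"
  "refuted_by_if False c pre cs st ls = refuted_by (c # pre) cs st ls"
  "refuted_by_if True c pre cs st ls =
     refuted_by_or (refuted (coloured st c (prepend_rev pre cs)) ls) c pre cs st ls"
  "refuted_by_or True c pre cs st ls = True"
  "refuted_by_or False c pre cs st ls = refuted_by (c # pre) cs st ls"
  by (auto simp: refuted_or_def refuted_by_def refuted_by_if_def refuted_by_or_def)

definition any_refuted_or :: "bool \<Rightarrow> (num \<times> num) list \<Rightarrow> num list \<Rightarrow> level list \<Rightarrow> bool" where
  "any_refuted_or b us S ls \<longleftrightarrow> b \<or> any_refuted us S ls"

lemma any_refuted_eval:
  "any_refuted [] S ls = False"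
  "any_refuted ((a, b) # us) S ls = any_refuted_or (refuted (a # b # S) ls) us S ls"
  "any_refuted_or True us S ls = True"
  "any_refuted_or False us S ls = any_refuted us S ls"
  by (simp_all add: any_refuted_or_def)

definition pairs_beaten :: "bool \<Rightarrow> (num \<times> num) list \<Rightarrow> nat list \<Rightarrow> nat list \<Rightarrow> (num \<times> num) list \<Rightarrow> num
  list \<Rightarrow> level list \<Rightarrow> bool" where
  "pairs_beaten od vs pre post us S ls \<longleftrightarrow>
     (\<forall>x \<in> set (partners pre post). any_refuted (flip_each (fst x) vs) S ls \<or>
        beats od (snd x) (flip_each (fst x) vs @ us) S ls)"
definition pairs_beaten_or :: "bool \<Rightarrow> bool \<Rightarrow> (num \<times> num) list \<Rightarrow> nat \<Rightarrow> nat list \<Rightarrow> nat list \<Rightarrow> (num \<times>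
  num) list \<Rightarrow> num list \<Rightarrow> level list \<Rightarrow> bool" where
  "pairs_beaten_or b od vs j pre post us S ls \<longleftrightarrow>
     (b \<or> beats od (prepend_rev pre post) (flip_each j vs @ us) S ls) \<and> pairs_beaten od vs (j # pre)
       post us S ls"
definition pairs_beaten_and :: "bool \<Rightarrow> bool \<Rightarrow> (num \<times> num) list \<Rightarrow> nat list \<Rightarrow> nat list \<Rightarrow> (num \<times> num)
  list \<Rightarrow> num list \<Rightarrow> level list \<Rightarrow> bool" where
  "pairs_beaten_and b od vs pre post us S ls \<longleftrightarrow> b \<and> pairs_beaten od vs pre post us S ls"
definition single_beaten_or :: "bool \<Rightarrow> (num \<times> num) list \<Rightarrow> nat list \<Rightarrow> (num \<times> num) list \<Rightarrow> num list \<Rightarrow>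
  level list \<Rightarrow> bool" where
  "single_beaten_or b vs is us S ls \<longleftrightarrow>
     (b \<or> beats False is (vs @ us) S ls) \<and> pairs_beaten True vs [] is us S ls"

lemma beats_eval:
  "beats od [] us S ls = False"
  "beats False (i # is) us S ls = pairs_beaten False (flip_each i us) [] is us S ls"
  "beats True (i # is) us S ls =
     single_beaten_or (any_refuted (flip_each i us) S ls) (flip_each i us) is us S ls"
  "single_beaten_or True vs is us S ls = pairs_beaten True vs [] is us S ls"
  "single_beaten_or False vs is us S ls =
     pairs_beaten_and (beats False is (vs @ us) S ls) True vs [] is us S ls"
  "pairs_beaten od vs pre [] us S ls = True"
  "pairs_beaten od vs pre (j # post) us S ls =
     pairs_beaten_or (any_refuted (flip_each j vs) S ls) od vs j pre post us S ls"
  "pairs_beaten_or True od vs j pre post us S ls = pairs_beaten od vs (j # pre) post us S ls"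
  "pairs_beaten_or False od vs j pre post us S ls =
     pairs_beaten_and (beats od (prepend_rev pre post) (flip_each j vs @ us) S ls) od vs (j # pre)
       post us S ls"
  "pairs_beaten_and True od vs pre post us S ls = pairs_beaten od vs pre post us S ls"
  "pairs_beaten_and False od vs pre post us S ls = False"
  by (simp_all add: pairs_beaten_def pairs_beaten_or_def pairs_beaten_and_def single_beaten_or_def)

lemmas reducible_eval = col_le.simps insert_col.simps insert_col_if.simps sort_cols.simps
  descend.simps is_present.simps
  member.simps add.simps flag.simps flip.simps drop_first.simps cnj.simps neg.simps
  colourable.simps prepend_rev.simps coloured.simps refuted_eval list.map map_prod_simp
    any_refuted_eval append_Nil append_Cons
  beats_eval diffs.simps odd_length.simps num_of_nat_numeral_eq forced.simps add_if.simps
    collect.simps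
  add_all.simps choices.simps usable.simps extend_by.simps extend.simps
  all_refuted.simps extensions_refuted.simps reducible.simps reducible_with.simps

lemma start_eval:
  "start 4 2 4 = nums [6, 6, 6, 5]" "start 4 3 3 = nums [6, 6, 5, 5]"
    "start 4 3 4 = nums [6, 6, 5, 4]"
  by (simp_all add: start_def numeral_eq_Suc num_of_nat.simps)

section \<open>Certificates\<close>

text \<open>
  Each list below builds a configuration from one uncoloured edge, edge by edge. Its tables come from
  an exhaustive computation of the recolouring game; in each state the two colours to be exchanged
  come first, and the tables are ordered so that each exchange leads to a state that was treated
  before. The lemmas about critical graphs in the next section draw the configurations: their
  variables appear there in the order in which the vertices are added. The names use \<open>three\<close> for a
  vertex of degree 3, \<open>needy\<close> for a vertex of degree 4 together with a neighbour of degree 2, and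
  \<open>partner\<close> for the other neighbour of that vertex of degree 2; \<open>hub\<close> is a vertex of degree 4 in a triangle
  with two vertices of degree 3, which form a \<open>pair\<close>.
\<close>

text \<open>Positions are written in unary, since the evaluation rules match on \<open>0\<close> and \<open>Suc\<close>.\<close>

abbreviation (input) "i1 \<equiv> Suc 0"
abbreviation (input) "i2 \<equiv> Suc (Suc 0)"
abbreviation (input) "i3 \<equiv> Suc (Suc (Suc 0))"
abbreviation (input) "i4 \<equiv> Suc (Suc (Suc (Suc 0)))"
abbreviation (input) "i5 \<equiv> Suc (Suc (Suc (Suc (Suc 0))))"
abbreviation (input) "i6 \<equiv> Suc (Suc (Suc (Suc (Suc (Suc 0)))))"
abbreviation (input) "i7 \<equiv> Suc (Suc (Suc (Suc (Suc (Suc (Suc 0))))))"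

definition path_2_4_3 :: "stage list" where
  "path_2_4_3 = [
    Stage (Attach 0) i1 [[10,13,12,15]] [] []]"

lemma reducible_path_2_4_3: "reducible path_2_4_3 [start 4 2 4] [(Attach 0, Absent)]"
  by (simp only: path_2_4_3_def start_eval reducible_eval)

definition path_2_4_2 :: "stage list" where
  "path_2_4_2 = [
    Stage (Attach 0) i2 [[10,13,13,15]] [] []]"

lemma reducible_path_2_4_2: "reducible path_2_4_2 [start 4 2 4] [(Attach 0, Absent)]"
  by (simp only: path_2_4_2_def start_eval reducible_eval)

definition path_2_4_4_2 :: "stage list" where
  "path_2_4_4_2 = [
    Stage (Attach 0) 0 [] [] [[12,12,10,15]],
    Stage (Attach 0) i2 [[21,27,24,31], [20,25,27,31], [30,21,25,27], [25,23,30,25]] [] []]"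

lemma reducible_path_2_4_4_2: "reducible path_2_4_4_2 [start 4 2 4] [(Attach 0, Absent)]"
  by (simp only: path_2_4_4_2_def start_eval reducible_eval)

definition path_3_3_3 :: "stage list" where
  "path_3_3_3 = [
    Stage (Attach 0) i1 [[10,13,10,15]] [] []]"

lemma reducible_path_3_3_3: "reducible path_3_3_3 [start 4 3 3] [(Attach 0, Absent)]"
  by (simp only: path_3_3_3_def start_eval reducible_eval)

definition path_3_3_4_3 :: "stage list" where
  "path_3_3_4_3 = [
    Stage (Attach 0) 0 [] [] [[12,10,10,15]],
    Stage (Attach 0) i1 [[30,21,24,23], [20,25,30,23], [21,27,20,30], [20,31,20,27]] [] []]"

lemma reducible_path_3_3_4_3: "reducible path_3_3_4_3 [start 4 3 3] [(Attach 0, Absent)]"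
  by (simp only: path_3_3_4_3_def start_eval reducible_eval)

definition star_4_333 :: "stage list" where
  "star_4_333 = [
    Stage (Attach 0) i1 [[10,13,8,15]] [[10,13,12,11]] [[12,12,11,11], [12,10,9,15]],
    Stage (Attach i1) i1 [[22,25,22,29], [20,19,30,29], [20,25,30,23], [20,31,18,29], [20,31,24,23]]
      [] []]"

lemma reducible_star_4_333: "reducible star_4_333 [start 4 3 4] [(Attach 0, Absent)]"
  by (simp only: star_4_333_def start_eval reducible_eval)

definition needy_shared_and_needy :: "stage list" where
  "needy_shared_and_needy = [
    Stage (Attach 0) 0 [] [] [[12,12,10,15]],
    Stage (Attach 0) 0 [] [] [[24,20,30,27], [24,24,30,23]],
    Stage (Attach 0) i2
      []
      [
        [60,47,49,51], [43,55,60,49], [41,51,60,55], [40,61,51,55], [54,41,61,51],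
        [48,47,61,51], [49,43,54,61], [43,55,48,61], [41,63,54,49], [41,63,48,55],
        [46,49,49,63], [40,49,55,63]]
      [[46,49,61,51]],
    Stage (Attach i2) 0 [] [] [[92,122,102,107], [92,98,122,111]],
    Stage (Join i1 0) 0
      [
        [122,95,98,111], [106,127,70,123], [74,102,123,127], [94,107,102,123], [122,95,102,107]]
      []
      []]"

lemma reducible_needy_shared_and_needy: "reducible needy_shared_and_needy [start 4 2 4] [(Attach 0,
  Absent)]"
  by (simp only: needy_shared_and_needy_def start_eval reducible_eval)

definition needy_four :: "stage list" where
  "needy_four = [
    Stage (Attach 0) 0 [] [] [[12,12,10,15]],
    Stage (Attach 0) 0 [] [] [[24,20,30,27], [24,24,30,23]],
    Stage (Attach i1) 0 [] [] [[40,60,54,53], [48,60,46,53], [48,60,54,45]],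
    Stage (Attach i2) 0 [] [] [[120,92,106,105], [120,108,90,105], [120,108,106,89]],
    Stage (Attach 0) i2
      [
        [246,209,153,243], [250,209,149,243], [209,187,212,243], [209,251,148,243],
        [209,183,216,243], [209,247,152,243]]
      [
        [178,213,217,243], [180,211,217,243], [184,211,213,243], [241,183,210,217],
        [210,185,213,243], [212,185,211,243], [216,181,211,243], [241,187,210,213],
        [241,187,212,211], [241,183,216,211], [181,219,210,241], [179,219,212,241],
        [185,215,210,241], [179,215,216,241], [178,213,241,219], [180,211,241,219],
        [178,217,241,215], [184,211,241,215], [240,181,211,219], [240,179,213,219],
        [240,185,211,215], [240,179,217,215], [213,187,240,211], [217,183,240,211]]
      [[250,145,213,243], [210,217,181,243]],
    Stage (Attach i2) i2
      [
        [509,291,486,427], [309,491,486,427], [510,417,491,295], [377,423,486,427],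
        [365,423,434,491], [493,423,306,491], [379,423,420,491], [507,423,294,489],
        [507,423,292,491], [442,291,493,487], [494,419,489,311], [417,507,486,303],
        [418,503,489,303], [366,483,433,431], [365,483,434,431], [317,483,482,431],
        [445,483,354,431], [369,431,486,427], [418,375,489,431], [419,367,438,489],
        [417,367,438,491], [417,443,486,367], [442,417,487,367], [483,431,432,367],
        [318,419,481,495], [506,419,293,495], [445,419,354,495], [494,289,435,495],
        [418,365,435,495], [290,493,435,495], [357,427,434,495], [356,427,435,495],
        [289,443,486,495], [419,507,292,495], [506,417,295,495], [504,419,295,495],
        [362,423,433,495], [360,423,435,495], [442,289,487,495], [291,495,496,431],
        [416,367,435,495], [419,319,486,489], [483,319,480,431], [291,447,486,489],
        [483,447,480,303], [291,447,480,495], [357,427,494,435], [437,299,486,491],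
        [510,291,489,423], [362,423,493,435], [441,363,486,423], [365,487,434,427],
        [291,439,494,489], [430,291,489,503], [418,509,483,303], [500,427,483,303],
        [418,485,507,303], [425,371,486,431], [428,483,435,367], [418,437,491,367],
        [418,439,489,367], [418,373,427,495], [372,419,427,495], [416,371,431,495],
        [418,487,489,319], [418,359,489,447], [418,383,489,423]]
      [
        [364,491,435,423], [500,423,299,491], [364,487,435,427], [429,363,434,487],
        [442,295,489,487], [358,427,489,439], [498,485,427,303], [374,483,425,431],
        [364,431,483,435], [438,495,489,291], [290,427,501,495], [420,371,427,495],
        [368,423,427,495], [311,495,418,489], [497,495,418,303], [290,447,489,487],
        [295,511,418,489], [365,423,498,427], [442,357,491,423], [426,373,427,487],
        [504,427,295,487], [422,375,489,427], [442,357,483,431], [419,495,364,435],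
        [422,369,427,495], [417,363,438,495], [437,363,418,495], [291,507,420,495],
        [424,371,423,495], [362,417,487,447], [483,383,420,427], [490,417,295,511],
        [429,483,438,363], [494,507,417,295], [429,363,498,423], [363,423,420,507],
        [377,487,422,427], [362,437,427,487], [442,357,419,495], [362,421,435,495],
        [363,447,420,483], [483,383,424,423], [497,427,494,295], [427,487,442,357],
        [441,363,422,487], [359,447,424,483], [302,487,497,427], [356,443,427,487],
        [420,379,427,487], [362,423,441,487], [492,291,483,447], [360,423,483,447],
        [486,357,427,443], [429,435,362,487], [290,509,427,487], [363,443,420,487],
        [490,485,291,447], [480,363,423,447], [421,363,486,443], [418,509,363,423],
        [426,291,509,487], [418,363,485,447], [429,503,418,363], [486,435,429,363]]
      [[426,501,299,487], [362,421,443,487], [426,501,291,495], [500,291,427,495]],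
    Stage (Attach i4) i2
      [
        [885,583,990,1003], [885,599,974,1003], [965,875,734,887], [1001,583,990,887],
        [1022,853,611,975], [894,613,979,975], [761,975,854,871], [881,975,862,743],
        [1002,599,885,975], [761,975,870,855], [758,975,841,887], [757,975,842,887],
        [854,975,1009,623], [1008,855,975,623], [598,1003,853,1007], [1002,599,853,1007],
        [1003,599,852,1007], [729,1007,870,855], [636,855,963,1007], [714,887,853,1007],
        [594,975,885,1007], [964,747,887,863], [966,735,877,883], [1002,583,885,991],
        [582,1001,887,991], [740,843,887,991], [580,1003,887,991], [1000,583,887,991],
        [738,853,879,991], [834,757,975,895], [582,1003,853,1023], [1001,583,854,1023],
        [1002,583,853,1023], [1003,583,852,1023], [582,1001,855,1023], [1000,583,855,1023],
        [974,757,843,887], [974,725,875,887], [757,835,894,975], [757,867,862,975],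
        [757,875,854,975], [598,1003,885,975], [874,757,855,975], [1002,631,853,975],
        [724,875,887,975], [756,843,855,1007], [842,725,887,1007], [724,843,887,1007],
        [885,875,966,735], [875,735,964,887], [582,885,1003,991], [1002,615,853,991],
        [615,855,1000,991], [886,843,757,975], [886,725,843,1007], [886,965,875,735],
        [725,975,886,875]]
      []
      []]"

lemma reducible_needy_four: "reducible needy_four [start 4 2 4] [(Attach 0, Absent)]"
  by (simp only: needy_four_def start_eval reducible_eval)

definition two_threes_vs_three :: "stage list" where
  "two_threes_vs_three = [
    Stage (Attach 0) 0 [] [] [[12,12,10,15]],
    Stage (Attach 0) i1
      [[26,29,16,31]]
      [[26,23,24,29], [20,27,24,31], [30,21,24,27], [30,25,24,23], [20,25,30,27]]
      [[24,18,29,31]],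
    Stage (Attach i1) i1
      [
        [36,59,62,53], [52,58,61,39], [40,55,62,53], [52,47,58,53], [36,49,62,63],
        [52,63,34,61], [36,51,60,63], [36,63,48,63], [36,57,62,55], [36,55,58,61], [36,50,61,63]]
      [[36,58,53,63]]
      [[40,54,53,63]],
    Stage (Attach i3) 0 [] [[114,125,72,126], [80,108,126,123], [80,106,126,125]]
      [[72,116,126,123]],
    Stage (Attach 0) i1
      [
        [246,253,144,235], [246,233,144,255], [252,145,246,235], [232,145,246,255],
        [233,147,252,246], [253,147,232,246], [252,247,232,147]]
      []
      []]"

lemma reducible_two_threes_vs_three: "reducible two_threes_vs_three [start 4 2 4] [(Attach 0,
  Absent)]"
  by (simp only: two_threes_vs_three_def start_eval reducible_eval)

definition two_threes_vs_shared_three :: "stage list" where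
  "two_threes_vs_shared_three = [
    Stage (Attach 0) 0 [] [] [[12,12,10,15]],
    Stage (Attach 0) i1
      [[26,29,16,31]]
      [[26,23,24,29], [20,27,24,31], [30,21,24,27], [30,25,24,23], [20,25,30,27]]
      [[24,18,29,31]],
    Stage (Attach i1) i1
      [[36,59,62,53], [36,49,62,63], [36,51,60,63], [36,63,48,63]]
      [[36,58,53,63]]
      [[40,54,53,63]],
    Stage (Attach i3) 0 [] [[114,125,72,126], [80,108,126,123], [80,106,126,125]]
      [[72,116,126,123]],
    Stage (Join i2 0) 0 [[126,77,114,125], [116,123,126,77]] [] []]"

lemma reducible_two_threes_vs_shared_three:
  "reducible two_threes_vs_shared_three [start 4 2 4] [(Attach 0, Absent)]"
  by (simp only: two_threes_vs_shared_three_def start_eval reducible_eval)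

definition three_needy_vs_three :: "stage list" where
  "three_needy_vs_three = [
    Stage (Attach 0) 0 [] [] [[12,12,10,15]],
    Stage (Attach 0) i1
      [[26,21,24,31], [26,29,16,31]]
      [[26,23,24,29], [20,27,24,31], [30,21,24,27], [30,25,24,23], [20,25,30,27]]
      [[24,18,29,31]],
    Stage (Attach i1) 0 [] [[52,63,48,46], [36,62,48,63]] [[36,58,62,53], [48,60,46,55]],
    Stage (Attach 0) i2
      [
        [118,73,125,107], [126,105,69,123], [114,109,77,123], [102,73,125,123],
        [109,83,108,123], [109,115,76,123], [105,71,124,123], [73,103,124,123],
        [73,119,124,107], [105,119,76,123], [116,105,123,79], [104,117,123,79],
        [121,103,120,79], [105,119,120,79], [126,73,113,111], [94,121,97,111], [118,73,121,111],
        [81,111,124,107], [121,71,120,111], [73,119,120,111], [105,119,88,111], [110,121,97,95],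
        [105,95,116,107], [121,111,96,95], [126,73,97,127], [102,73,121,127], [114,105,77,127],
        [73,99,124,127], [105,127,68,123], [105,71,120,127], [105,103,88,127], [105,127,112,79],
        [73,127,112,111], [72,127,97,127], [73,101,126,123], [110,73,117,123], [118,73,109,123],
        [93,123,110,97], [126,105,121,71], [104,125,123,71], [104,93,123,103], [104,87,109,123],
        [104,93,107,119], [72,119,109,123], [104,119,121,79], [81,105,126,111],
        [110,81,121,111], [73,115,124,111], [91,111,116,105], [73,111,116,123],
        [90,101,105,127], [104,93,99,127], [72,101,123,127], [104,113,79,127], [104,81,111,127],
        [110,121,93,99], [101,75,126,121], [78,121,101,123], [92,107,101,123], [110,73,121,119],
        [90,105,109,119], [108,119,73,123], [122,117,73,111], [122,109,81,111],
        [114,125,73,111], [83,111,104,125], [104,93,115,111], [120,101,91,111],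
        [108,81,123,111], [117,95,104,107], [69,127,104,123], [122,125,101,75],
        [126,103,73,121], [105,119,78,121], [73,119,122,109], [105,119,92,107],
        [105,91,108,119], [90,121,101,111], [66,121,125,111], [121,83,108,111],
        [72,115,125,111], [73,119,104,127], [90,107,101,125], [125,99,108,91], [126,73,105,119],
        [110,89,105,119], [72,125,107,119], [92,99,121,111], [72,127,105,119], [90,109,125,99],
        [109,123,90,101], [106,73,125,119], [120,93,99,111], [104,111,89,119], [97,95,126,105],
        [72,127,125,99], [117,75,106,125], [120,103,89,111], [120,111,97,95]]
      [[117,107,126,73], [106,127,73,117], [116,127,73,107], [72,127,117,107]]
      [[126,73,109,115]],
    Stage (Attach i4) 0
      []
      [
        [254,177,218,230], [144,254,230,251], [228,179,218,254], [228,146,254,251],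
        [252,230,218,179], [252,230,146,251]]
      [[180,218,230,251]],
    Stage (Attach 0) i1
      [
        [502,461,436,363], [502,361,436,463], [502,509,288,463], [502,321,428,511],
        [354,485,412,511], [354,469,428,511], [502,333,416,511], [460,437,502,363],
        [360,437,502,463], [460,289,502,511], [460,437,354,511], [361,439,460,502],
        [461,439,360,502], [509,439,460,354], [360,503,460,439]]
      []
      []]"

lemma reducible_three_needy_vs_three: "reducible three_needy_vs_three [start 4 2 4] [(Attach 0,
  Absent)]"
  by (simp only: three_needy_vs_three_def start_eval reducible_eval)

definition three_needy_vs_shared_three :: "stage list" where
  "three_needy_vs_shared_three = [
    Stage (Attach 0) 0 [] [] [[12,12,10,15]],
    Stage (Attach 0) i1
      [[26,21,24,31], [26,29,16,31]]
      [[26,23,24,29], [20,27,24,31], [30,21,24,27], [30,25,24,23], [20,25,30,27]]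
      [[24,18,29,31]],
    Stage (Attach i1) 0 [] [[52,63,48,46], [36,62,48,63]] [[36,58,62,53], [48,60,46,55]],
    Stage (Attach 0) i2
      [
        [118,73,125,107], [126,105,69,123], [102,73,125,123], [109,115,76,123],
        [105,71,124,123], [73,103,124,123], [73,119,124,107], [116,105,123,79],
        [104,117,123,79], [121,103,120,79], [105,119,120,79], [126,73,113,111], [94,121,97,111],
        [118,73,121,111], [81,111,124,107], [121,71,120,111], [105,119,88,111], [110,121,97,95],
        [105,95,100,123], [121,111,96,95], [126,73,97,127], [102,73,121,127], [73,99,124,127],
        [73,127,112,111], [73,101,126,123], [110,73,117,123], [118,73,109,123], [93,123,110,97],
        [104,125,123,71], [104,93,107,119], [104,119,121,79], [81,105,126,111],
        [110,81,121,111], [73,111,116,123], [104,101,123,95], [104,93,99,127], [104,81,111,127],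
        [110,121,93,99], [78,121,101,123], [92,107,101,123], [110,73,121,119], [108,119,73,123],
        [122,109,81,111], [83,111,104,125], [108,81,123,111], [117,95,104,107],
        [100,127,73,123], [126,103,73,121], [105,119,78,121], [73,119,122,109],
        [105,119,92,107], [105,91,108,119], [66,121,125,111], [121,83,108,111],
        [126,73,105,119], [72,125,107,119], [92,99,121,111], [106,73,125,119], [120,93,99,111],
        [97,95,126,105], [117,75,106,125], [120,111,97,95]]
      [
        [117,107,126,73], [114,127,73,109], [106,117,73,127], [116,127,73,107], [72,127,117,107]]
      [[126,73,109,115]],
    Stage (Attach i4) 0
      []
      [
        [254,177,218,230], [144,254,230,251], [228,179,218,254], [228,146,254,251],
        [252,230,218,179], [252,230,146,251]]
      [[180,218,230,251]],
    Stage (Join i3 0) 0 [[180,218,251,239]] [] []]"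

lemma reducible_three_needy_vs_shared_three:
  "reducible three_needy_vs_shared_three [start 4 2 4] [(Attach 0, Absent)]"
  by (simp only: three_needy_vs_shared_three_def start_eval reducible_eval)

definition three_partner_vs_three :: "stage list" where
  "three_partner_vs_three = [
    Stage (Attach 0) 0 [] [] [[12,12,10,15]],
    Stage (Attach 0) 0 [] [] [[24,20,30,27], [24,24,30,23]],
    Stage (Join i3 0) 0 [[26,29,24,31]] [] [[24,30,29,27]],
    Stage (Attach i1) i1
      [[52,58,61,55]]
      [[58,53,60,55], [52,63,60,51], [54,61,58,53], [54,59,60,53], [54,49,60,63]]
      [[60,60,51,55]],
    Stage (Attach i3) 0
      []
      [
        [118,125,120,106], [120,102,120,127], [98,126,120,125], [104,114,126,125],
        [120,119,104,126], [120,110,120,119]]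
      [[120,116,106,127]],
    Stage (Attach 0) i1
      [
        [254,233,212,243], [202,245,252,243], [250,237,212,243], [254,241,212,235],
        [252,197,250,243], [232,213,254,243], [232,222,245,243], [240,213,254,235],
        [246,221,232,243], [209,231,252,250], [241,215,232,254], [233,215,240,254],
        [245,219,232,246], [216,245,250,231], [228,250,245,219], [232,215,250,245],
        [240,255,232,215]]
      []
      []]"

lemma reducible_three_partner_vs_three: "reducible three_partner_vs_three [start 4 2 4] [(Attach 0,
  Absent)]"
  by (simp only: three_partner_vs_three_def start_eval reducible_eval)

definition three_partner_vs_shared_three :: "stage list" where
  "three_partner_vs_shared_three = [
    Stage (Attach 0) 0 [] [] [[12,12,10,15]],
    Stage (Attach 0) 0 [] [] [[24,20,30,27], [24,24,30,23]],
    Stage (Join i3 0) 0 [[26,29,24,31]] [] [[24,30,29,27]],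
    Stage (Attach i1) i1
      []
      [[58,53,60,55], [52,63,60,51], [54,61,58,53], [54,59,60,53], [54,49,60,63]]
      [[60,60,51,55]],
    Stage (Attach i3) 0
      []
      [
        [118,125,120,106], [120,102,120,127], [98,126,120,125], [104,114,126,125],
        [120,119,104,126], [120,110,120,119]]
      [[120,116,106,127]],
    Stage (Join i1 0) 0 [] [] []]"

lemma reducible_three_partner_vs_shared_three:
  "reducible three_partner_vs_shared_three [start 4 2 4] [(Attach 0, Absent)]"
  by (simp only: three_partner_vs_shared_three_def start_eval reducible_eval)

definition three_vs_two_needy :: "stage list" where
  "three_vs_two_needy = [
    Stage (Attach 0) 0 [] [] [[12,12,10,15]],
    Stage (Attach 0) 0 [] [] [[24,20,30,27], [24,24,30,23]],
    Stage (Attach 0) i2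
      [[58,53,33,63], [53,43,48,63], [53,59,32,63]]
      [
        [60,47,49,51], [43,55,60,49], [41,51,60,55], [40,61,51,55], [54,41,61,51],
        [48,47,61,51], [49,43,54,61], [43,55,48,61], [41,63,54,49], [41,63,48,55],
        [46,49,49,63], [40,49,55,63]]
      [[46,49,61,51]],
    Stage (Attach i2) 0 [] [[120,102,94,107], [92,122,102,107]] [[116,106,94,107], [92,98,122,111]],
    Stage (Attach 0) i2
      [
        [254,213,141,243], [230,221,157,243], [206,149,253,243], [246,221,133,251],
        [221,167,220,243], [221,231,156,243], [254,249,133,215], [221,163,252,215],
        [250,213,141,247], [238,209,157,247], [230,221,153,247], [250,221,133,247],
        [226,221,157,247], [221,163,220,247], [221,227,156,247], [221,187,196,247],
        [221,167,216,247], [221,231,152,247], [137,247,252,215], [213,143,252,243],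
        [149,207,252,243], [209,175,220,247], [254,213,225,159], [206,245,241,159],
        [230,209,253,159], [213,227,252,159], [236,213,243,159], [212,237,243,159],
        [245,203,244,159], [213,251,228,159], [209,231,252,159], [212,233,247,159],
        [245,207,240,159], [254,149,225,223], [238,149,241,223], [190,245,193,223],
        [206,245,177,223], [142,245,241,223], [212,173,243,223], [245,139,244,223],
        [245,203,180,223], [149,235,244,223], [245,187,196,223], [161,223,252,215],
        [245,143,240,223], [245,207,176,223], [222,245,193,191], [213,191,204,243],
        [245,223,192,191], [254,145,197,255], [206,149,241,255], [250,149,197,255],
        [206,213,177,255], [142,213,241,255], [154,245,197,255], [230,209,157,255],
        [226,213,157,255], [182,221,193,255], [213,163,220,255], [213,227,156,255],
        [213,255,140,243], [213,139,244,255], [149,203,244,255], [148,251,197,255],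
        [145,199,252,255], [209,167,220,255], [213,167,216,255], [185,215,196,255],
        [149,207,240,255], [213,207,176,255], [213,255,224,159], [208,191,197,255],
        [149,255,192,255], [190,213,221,227], [149,205,254,243], [222,149,237,243],
        [238,149,221,243], [142,245,221,243], [182,221,197,251], [245,155,252,199],
        [185,215,254,197], [172,215,221,243], [253,187,196,215], [195,183,252,221],
        [251,183,196,221], [190,247,193,221], [201,151,252,247], [212,253,243,143],
        [212,189,243,207], [145,207,252,247], [148,239,221,243], [209,229,254,159],
        [238,209,245,159], [246,209,237,159], [226,221,245,159], [194,253,245,159],
        [212,253,227,159], [212,235,245,159], [212,229,251,159], [212,249,231,159],
        [209,247,236,159], [200,247,245,159], [245,223,250,133], [149,227,252,223],
        [165,211,252,223], [149,223,236,243], [164,223,221,243], [208,175,245,223],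
        [218,245,197,191], [212,205,243,191], [202,149,245,255], [162,213,221,255],
        [148,205,243,255], [168,213,215,255], [190,245,221,195], [222,189,213,227],
        [222,149,253,227], [198,157,253,243], [237,211,252,151], [203,151,252,245],
        [186,253,197,215], [188,215,205,243], [204,189,243,215], [168,215,253,215],
        [186,247,197,221], [162,221,221,247], [149,219,236,247], [232,221,151,247],
        [246,209,253,143], [148,207,253,243], [212,185,247,207], [182,209,221,239],
        [220,239,149,243], [157,239,212,243], [209,239,252,151], [198,241,253,159],
        [208,231,253,159], [244,201,247,159], [208,237,247,159], [244,239,209,159],
        [241,239,212,159], [186,223,197,245], [138,245,245,223], [212,189,227,223],
        [172,245,211,223], [220,165,243,223], [209,183,236,223], [149,255,252,195],
        [204,255,149,243], [225,255,212,159], [228,255,209,159], [165,211,222,253],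
        [218,149,253,231], [142,215,241,253], [214,169,253,215], [226,215,157,253],
        [213,235,188,215], [218,149,237,247], [198,185,221,247], [221,247,172,211],
        [221,139,244,247], [220,165,219,247], [182,209,253,207], [222,149,241,239],
        [246,209,157,239], [149,219,244,239], [212,249,151,239], [209,183,220,239],
        [198,185,245,223], [198,241,189,223], [245,163,220,223], [245,223,232,151],
        [244,201,183,223], [222,149,225,255], [198,249,149,255], [213,255,186,197],
        [149,219,228,255], [254,231,209,157], [189,215,222,225], [182,201,253,215],
        [218,165,253,215], [253,215,220,163], [253,215,244,139], [221,247,142,241],
        [246,137,221,247], [218,165,221,247], [204,189,211,247], [169,215,220,247],
        [254,207,241,149], [251,207,244,149], [222,161,245,223], [182,201,245,223],
        [245,223,226,157], [166,221,241,223], [228,249,151,223], [169,215,244,223],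
        [231,191,220,209], [238,209,149,255], [182,201,213,255], [198,185,213,255],
        [218,165,213,255], [219,135,244,253], [221,135,244,251], [221,251,228,151],
        [254,213,169,215], [141,215,254,241], [225,215,254,157], [253,215,198,185],
        [134,249,253,215], [194,189,253,215], [195,183,220,253], [222,141,241,247],
        [201,157,246,247], [221,247,182,201], [149,251,204,247], [185,215,204,247],
        [200,183,221,247], [241,165,222,223], [245,223,218,165], [246,225,157,223],
        [164,219,245,223], [185,215,228,223], [245,195,220,191], [245,191,204,211],
        [145,255,204,247], [145,255,228,223], [254,149,253,195], [182,221,253,195],
        [197,251,246,157], [254,209,253,135], [218,245,253,135], [220,245,251,135],
        [221,151,254,225], [198,151,249,253], [158,253,225,215], [166,217,253,215],
        [242,253,141,215], [157,251,228,215], [184,199,253,215], [216,167,253,215],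
        [213,183,204,251], [222,197,185,247], [250,197,157,247], [206,177,221,247],
        [178,205,221,247], [210,173,221,247], [155,247,228,221], [212,251,141,247],
        [248,247,221,135], [220,201,183,247], [214,169,245,223], [150,233,245,223],
        [154,229,245,223], [234,149,245,223], [188,223,245,195], [179,223,204,245],
        [244,165,219,223], [241,191,204,215], [213,179,204,255], [213,155,228,255],
        [208,255,253,135], [212,137,247,255], [212,161,223,255], [213,189,254,195],
        [197,147,254,253], [182,243,205,221], [253,203,150,245], [197,219,182,253],
        [246,213,141,251], [249,213,254,135], [253,167,210,221], [254,197,249,151],
        [222,253,225,151], [226,253,221,151], [234,149,253,215], [164,219,253,215],
        [252,185,199,215], [198,183,217,253], [197,183,218,253], [197,251,220,183],
        [199,183,216,253], [200,183,253,215], [222,245,137,247], [222,205,177,247],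
        [149,205,250,247], [222,161,221,247], [221,247,150,233], [234,149,221,247],
        [194,189,221,247], [139,247,220,245], [232,247,157,215], [136,247,253,215],
        [218,159,229,245], [246,137,245,223], [134,249,245,223], [245,223,210,173],
        [246,221,161,223], [230,223,177,221], [130,253,245,223], [197,187,244,223],
        [245,223,216,167], [172,223,241,215], [160,223,253,215], [184,223,197,247],
        [160,223,221,247], [212,233,215,191], [222,161,213,255], [246,137,213,255],
        [194,149,253,255], [213,255,188,195], [212,205,179,255], [206,147,245,253],
        [237,211,150,253], [222,245,205,179], [214,189,205,243], [214,139,245,253],
        [157,203,246,245], [214,165,253,219], [149,205,246,251], [149,199,254,249],
        [209,167,222,253], [206,151,249,245], [237,151,210,253], [254,215,177,205],
        [253,215,222,161], [253,215,246,137], [206,209,253,183], [214,201,253,183],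
        [221,183,194,253], [212,205,251,183], [217,183,252,199], [217,165,222,247],
        [184,199,221,247], [153,231,220,247], [188,201,215,247], [213,239,222,177],
        [214,233,245,159], [242,165,221,223], [226,181,221,223], [162,245,221,223],
        [194,189,245,223], [226,149,253,223], [184,199,245,223], [232,181,215,223],
        [245,191,216,199], [145,229,222,255], [213,255,234,149], [246,145,205,255],
        [209,199,188,255], [254,205,245,147], [189,211,246,205], [254,213,245,139],
        [213,235,214,189], [254,213,165,219], [245,187,214,205], [213,251,222,165],
        [190,245,217,199], [249,199,246,157], [250,157,245,199], [245,219,188,199],
        [245,167,222,217], [254,213,153,231], [145,231,222,253], [250,205,245,151],
        [185,215,222,229], [185,215,246,205], [254,213,201,183], [254,205,209,183],
        [222,241,205,183], [233,221,214,183], [156,249,199,247], [213,207,254,177],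
        [145,207,246,253], [149,237,242,223], [213,191,210,237], [213,191,226,221],
        [213,191,232,215], [213,203,246,189], [213,171,222,245], [222,185,245,199],
        [185,221,246,199], [182,221,249,199], [186,221,245,199], [185,213,222,231],
        [238,213,185,215], [233,213,222,183], [185,213,246,207]]
      [
        [145,253,254,199], [210,237,149,255], [148,255,221,227], [216,231,149,255],
        [220,179,253,199], [244,155,253,199], [189,215,210,237], [221,183,216,231],
        [214,161,221,255], [164,211,221,255], [211,167,220,253], [203,151,244,253],
        [245,207,210,189], [245,207,216,183], [213,239,244,155], [233,149,214,255],
        [148,237,211,255], [189,215,214,233], [188,215,237,211], [173,247,220,211],
        [184,215,245,207], [233,223,244,151], [145,223,244,239], [233,215,188,215],
        [188,205,211,247], [240,189,215,207], [248,229,151,223], [226,221,189,215],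
        [212,235,189,215], [232,215,189,215], [213,239,188,211], [213,239,248,151],
        [254,145,229,223], [198,243,221,189], [148,253,211,239], [208,253,151,239],
        [161,213,254,223], [222,197,189,243], [214,145,253,239], [245,187,222,197],
        [161,223,214,253], [230,145,253,223], [164,211,253,223], [244,173,211,223],
        [236,247,145,223], [205,179,244,223], [220,161,247,223], [182,241,205,223],
        [241,167,220,223], [244,223,161,223], [164,241,223,223], [199,191,220,241],
        [214,173,241,223], [188,223,241,199], [196,191,241,223], [244,185,199,223],
        [185,247,196,223], [205,191,214,241], [233,213,214,191]]
      [[182,221,221,227], [254,185,213,199], [226,149,221,255]],
    Stage (Attach i5) 0
      []
      [[464,430,510,363], [320,507,430,510], [452,298,510,507]]
      [[452,442,510,363], [508,370,398,491], [364,442,454,507], [508,370,426,463]],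
    Stage (Attach 0) i1
      [
        [886,765,908,979], [726,1021,884,907], [782,757,1012,987], [982,741,796,1019],
        [926,741,852,1019], [782,725,1012,1019], [974,725,820,1019], [942,725,852,1019],
        [982,1017,796,743], [926,1017,852,743], [1020,727,884,907], [1014,685,856,983],
        [1014,969,604,951], [726,1017,844,951], [726,1005,856,951], [970,1021,596,951],
        [726,1021,840,951], [886,985,908,759], [1014,729,884,911], [1014,985,628,911],
        [1014,733,880,911], [731,943,980,884], [886,753,908,991], [1014,657,844,1023],
        [726,905,884,1023], [1014,725,776,1023], [726,949,840,1023], [1020,885,726,907],
        [1014,909,884,731], [908,886,757,987], [740,853,926,1019], [908,886,725,1019],
        [740,797,982,1019], [1016,853,926,743], [1016,797,982,743], [728,813,1014,983],
        [1020,841,726,951], [1020,597,970,951], [728,845,1014,951], [728,885,1014,911],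
        [908,593,1014,1023], [904,885,726,1023], [1013,731,908,886], [1017,855,740,926],
        [741,855,1016,926], [905,887,1020,726], [729,887,908,1014], [661,887,1020,970],
        [909,887,728,1014], [1021,887,904,726], [890,1015,908,725], [858,1015,908,757],
        [1017,799,740,982], [741,799,1016,982], [1014,885,908,731], [904,727,1020,887],
        [728,887,908,1015], [740,983,1016,799], [1016,927,740,855]]
      []
      []]"

lemma reducible_three_vs_two_needy: "reducible three_vs_two_needy [start 4 2 4] [(Attach 0,
  Absent)]"
  by (simp only: three_vs_two_needy_def start_eval reducible_eval)

definition needy_triangle_three :: "stage list" where
  "needy_triangle_three = [
    Stage (Attach i1) 0 [] [] [[12,12,12,15]],
    Stage (Join i1 0) 0 [] [] [[12,12,15,15]],
    Stage (Attach i1) 0 [] [] [[24,30,30,29]],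
    Stage (Attach 0) i1 [[58,61,48,63], [60,49,58,63], [61,51,60,58], [60,59,60,51]] [] []]"

lemma reducible_needy_triangle_three: "reducible needy_triangle_three [start 4 2 4] [(Attach 0,
  Absent)]"
  by (simp only: needy_triangle_three_def start_eval reducible_eval)

definition needy_triangle_two_needy :: "stage list" where
  "needy_triangle_two_needy = [
    Stage (Attach i1) 0 [] [] [[12,12,12,15]],
    Stage (Join i1 0) 0 [] [] [[12,12,15,15]],
    Stage (Attach i1) 0 [] [] [[24,30,30,29]],
    Stage (Attach 0) 0 [] [] [[60,60,58,51], [48,60,58,63]],
    Stage (Attach 0) i2
      [
        [114,125,105,119], [125,115,104,119], [122,117,97,127], [117,123,96,127],
        [106,113,125,119], [98,121,117,127], [122,103,121,117], [114,111,113,125],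
        [118,121,121,103], [126,113,113,111]]
      [
        [113,109,126,115], [108,119,121,115], [121,103,126,113], [100,123,121,119],
        [120,103,121,119], [122,125,113,103], [117,123,120,103], [118,111,113,121],
        [101,123,118,121], [114,121,125,103], [116,121,123,103], [99,127,120,117],
        [102,117,121,123], [98,119,121,125], [116,121,99,127], [126,117,121,99],
        [126,97,117,123], [126,97,121,119], [102,121,121,119], [97,123,116,127]]
      [[126,121,101,115]],
    Stage (Attach i2) 0
      []
      [
        [252,242,206,235], [212,254,234,235], [218,230,252,235], [236,210,254,235],
        [202,251,252,230], [250,239,236,210], [216,238,230,251], [248,238,210,239],
        [240,206,238,251], [218,239,240,238], [216,242,238,239], [252,202,242,239]]
      [[244,250,206,235], [244,234,222,235]],
    Stage (Attach 0) i2
      [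
        [509,455,444,467], [445,451,508,471], [413,487,504,471], [413,483,476,503],
        [469,427,476,503], [469,495,408,503], [462,501,497,415], [486,501,473,415],
        [485,415,504,471], [501,463,496,415], [404,507,485,479], [504,407,485,479],
        [494,469,465,447], [469,495,464,447], [466,445,453,511], [436,475,453,511],
        [472,439,453,511], [510,469,413,483], [430,469,509,467], [404,507,509,455],
        [507,423,476,469], [474,445,485,471], [500,491,413,471], [444,475,485,471],
        [501,463,466,445], [498,413,469,495], [470,489,501,415], [500,489,471,415],
        [488,471,501,415], [452,437,507,479], [437,455,504,479], [450,509,469,447],
        [488,471,469,447], [456,503,469,447], [484,405,475,511], [405,487,472,511],
        [414,509,469,483], [470,501,413,491], [390,469,509,507], [474,509,469,423],
        [470,489,445,471], [469,491,444,471], [445,471,484,475], [445,471,472,487],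
        [489,471,444,471], [413,503,452,507], [413,503,504,455], [509,399,498,469],
        [496,471,445,463], [464,503,413,495], [468,489,471,447], [452,473,503,447],
        [470,427,469,509], [469,491,470,445], [468,491,445,471], [412,505,487,471],
        [488,471,445,471], [486,413,473,503], [500,459,413,503], [456,503,413,503],
        [501,491,412,471], [470,489,413,503], [489,447,470,469]]
      []
      []]"

lemma reducible_needy_triangle_two_needy:
  "reducible needy_triangle_two_needy [start 4 2 4] [(Attach 0, Absent)]"
  by (simp only: needy_triangle_two_needy_def start_eval reducible_eval)

definition pair_between_needy :: "stage list" where
  "pair_between_needy = [
    Stage (Attach 0) 0 [] [] [[12,12,10,15]],
    Stage (Attach 0) i1
      [[26,21,24,31], [26,29,16,31]]
      [[26,23,24,29], [20,27,24,31], [30,21,24,27], [30,25,24,23], [20,25,30,27]]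
      [[24,18,29,31]],
    Stage (Attach 0) i1
      [
        [50,41,62,55], [50,37,58,63], [58,53,34,63], [40,50,55,63], [42,61,50,55],
        [36,51,58,63], [46,53,58,51]]
      [[58,37,62,51], [36,59,62,51], [49,39,58,62]]
      [[40,62,51,55]],
    Stage (Attach i1) 0 [] [[110,85,124,102]] [[124,102,118,77]],
    Stage (Attach 0) 0
      []
      [
        [184,206,220,235], [136,254,220,235], [248,156,206,235], [200,156,254,235],
        [238,251,136,220], [204,158,248,235], [188,222,200,235], [236,222,136,251],
        [204,154,236,251], [250,207,200,188], [154,239,248,204], [232,218,188,207],
        [184,236,218,207], [248,154,236,207]]
      [[200,220,190,235]],
    Stage (Attach 0) i2
      [
        [378,437,473,407], [378,413,497,407], [474,509,305,407], [498,509,281,407],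
        [338,509,441,407], [509,275,504,407], [349,435,504,407], [381,403,440,471],
        [413,443,368,471], [509,443,272,471], [442,469,281,503], [474,437,497,287],
        [437,275,504,479], [477,499,400,319], [344,509,435,407], [380,401,443,471],
        [443,375,400,477], [282,441,469,503], [282,479,497,437], [444,497,275,479],
        [470,381,401,443], [441,403,380,471], [445,475,400,375], [308,411,497,479],
        [441,403,470,381], [436,409,475,375], [368,437,411,479], [509,407,368,411],
        [379,471,436,409], [378,401,509,407], [400,445,379,471], [441,469,378,407],
        [381,443,400,471], [402,383,441,469], [470,401,441,383]]
      []
      []]"

lemma reducible_pair_between_needy: "reducible pair_between_needy [start 4 2 4] [(Attach 0,
  Absent)]"
  by (simp only: pair_between_needy_def start_eval reducible_eval)

definition pair_same_needy :: "stage list" where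
  "pair_same_needy = [
    Stage (Attach 0) 0 [] [] [[12,12,10,15]],
    Stage (Attach 0) i1
      [[26,21,24,31]]
      [[26,23,24,29], [20,27,24,31], [30,21,24,27], [30,25,24,23], [20,25,30,27]]
      [[24,18,29,31]],
    Stage (Attach 0) 0 [] [[36,62,58,51]] [[52,58,46,51], [48,58,62,39]],
    Stage (Join i3 0) 0
      [[42,49,62,63], [58,39,56,63], [42,63,48,63], [40,55,58,63], [40,50,63,63]]
      [
        [58,45,62,51], [54,59,40,63], [46,61,58,51], [42,57,54,63], [62,43,54,57], [58,39,62,57]]
      [[40,62,51,63]],
    Stage (Attach i1) i1 [[102,85,126,125]] [] []]"

lemma reducible_pair_same_needy: "reducible pair_same_needy [start 4 2 4] [(Attach 0, Absent)]"
  by (simp only: pair_same_needy_def start_eval reducible_eval)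

definition pair_partner_needy :: "stage list" where
  "pair_partner_needy = [
    Stage (Attach 0) 0 [] [] [[12,12,10,15]],
    Stage (Attach 0) i1
      [[26,29,16,31]]
      [[26,23,24,29], [20,27,24,31], [30,21,24,27], [30,25,24,23], [20,25,30,27]]
      [[24,18,29,31]],
    Stage (Attach 0) 0 [] [[36,62,58,51]] [[52,58,46,51], [48,58,62,39]],
    Stage (Attach 0) 0
      []
      [
        [116,78,124,99], [104,92,102,119], [124,86,96,111], [78,127,96,116], [78,119,96,124]]
      [
        [108,124,86,99], [116,92,102,107], [72,124,102,119], [96,84,126,111], [104,116,102,95],
        [96,116,110,95]],
    Stage (Join i5 0) 0
      []
      [
        [126,117,108,99], [117,111,96,126], [116,111,124,99], [110,125,116,99],
        [113,103,108,126], [122,101,116,111], [98,125,116,111], [124,119,96,111],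
        [114,125,108,103], [124,114,101,111], [102,113,124,111], [105,119,124,102],
        [120,117,102,111], [125,103,120,102], [116,106,125,103], [102,107,116,125]]
      [[96,126,125,103], [108,124,99,119], [100,116,123,111]],
    Stage (Attach i2) i1
      [
        [250,221,232,207], [220,251,232,207], [200,223,232,255], [206,221,232,251],
        [252,201,250,207], [252,201,206,251], [250,253,206,201]]
      []
      []]"

lemma reducible_pair_partner_needy: "reducible pair_partner_needy [start 4 2 4] [(Attach 0,
  Absent)]"
  by (simp only: pair_partner_needy_def start_eval reducible_eval)

definition triangle_other_needy :: "stage list" where
  "triangle_other_needy = [
    Stage (Attach i1) 0 [] [] [[12,12,10,15]],
    Stage (Join i1 0) 0 [] [] [[12,10,15,15]],
    Stage (Attach i2) 0 [] [] [[24,30,30,29]],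
    Stage (Attach 0) 0 [] [] [[60,60,58,51], [48,60,58,63]],
    Stage (Attach 0) i2
      [
        [117,123,120,103], [117,99,120,127], [117,123,96,127], [116,121,123,103],
        [116,121,99,127], [116,97,123,127], [126,117,121,99], [126,117,97,123],
        [102,117,121,123], [97,119,126,121], [121,119,102,121]]
      []
      []]"

lemma reducible_triangle_other_needy: "reducible triangle_other_needy [start 4 3 3] [(Attach 0,
  Absent)]"
  by (simp only: triangle_other_needy_def start_eval reducible_eval)

definition triangle_needy :: "stage list" where
  "triangle_needy = [
    Stage (Attach i1) 0 [] [] [[12,12,10,15]],
    Stage (Join i1 0) 0 [] [] [[12,10,15,15]],
    Stage (Attach 0) 0 [] [] [[20,30,30,27], [24,30,30,23]],
    Stage (Attach 0) i2
      [
        [61,43,60,55], [61,51,60,47], [46,61,49,63], [54,61,41,63], [46,61,61,51], [54,61,61,43]]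
      []
      []]"

lemma reducible_triangle_needy: "reducible triangle_needy [start 4 3 3] [(Attach 0, Absent)]"
  by (simp only: triangle_needy_def start_eval reducible_eval)

definition triangle_hub_three :: "stage list" where
  "triangle_hub_three = [
    Stage (Attach i1) 0 [] [] [[12,12,10,15]],
    Stage (Join i1 0) 0 [] [] [[12,10,15,15]],
    Stage (Attach 0) 0 [] [] [[20,30,30,27], [24,30,30,23]],
    Stage (Attach 0) i1
      [
        [54,61,40,63], [46,61,48,63], [60,49,46,63], [60,41,54,63], [61,51,60,46],
        [61,43,60,54], [60,55,60,43], [60,47,60,51]]
      []
      []]"

lemma reducible_triangle_hub_three: "reducible triangle_hub_three [start 4 3 3] [(Attach 0,
  Absent)]"
  by (simp only: triangle_hub_three_def start_eval reducible_eval)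

definition triangle_hub_two_needy :: "stage list" where
  "triangle_hub_two_needy = [
    Stage (Attach i1) 0 [] [] [[12,12,10,15]],
    Stage (Join i1 0) 0 [[14,9,14,15]] [] [[12,10,15,15]],
    Stage (Attach 0) 0 [] [] [[20,30,30,27], [24,30,30,23]],
    Stage (Attach 0) 0 [] [] [[60,60,46,51], [60,60,54,43], [40,60,54,63], [48,60,46,63]],
    Stage (Attach 0) i2
      [
        [117,123,120,79], [117,123,88,111], [106,125,113,95], [101,123,120,95],
        [117,123,104,95], [90,109,113,127], [122,93,97,127], [122,125,65,127], [74,125,113,127],
        [85,123,104,127], [117,123,72,127], [109,123,80,127], [93,123,96,127], [116,121,123,79],
        [114,105,125,95], [116,105,123,95], [100,121,123,95], [98,121,93,127], [66,121,125,127],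
        [68,121,123,127], [126,85,105,123], [78,117,121,123]]
      [
        [117,123,110,89], [126,103,89,121], [122,109,89,119], [117,107,126,89],
        [122,125,89,103], [114,127,89,109], [100,127,89,123], [121,85,126,107],
        [90,121,125,103], [120,83,109,127], [92,97,123,127], [108,81,123,127], [126,109,81,123],
        [126,93,97,123], [123,87,120,109], [98,95,121,125], [116,95,121,107], [121,99,92,127],
        [93,99,120,127], [108,121,83,127], [126,93,121,99], [126,109,121,83], [86,121,109,123],
        [123,103,92,121], [123,103,120,93], [108,121,123,87], [121,111,126,81],
        [121,111,120,87], [121,95,126,97], [102,121,121,95], [120,103,121,95], [102,121,93,123],
        [86,121,121,111]]
      [[110,89,121,119]],
    Stage (Attach i2) 0
      []
      [
        [216,246,254,171], [200,187,246,254], [220,234,246,187], [242,238,220,187],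
        [170,251,220,246], [178,238,220,251]]
      [[212,250,254,171]],
    Stage (Attach 0) i2
      [
        [501,427,508,343], [510,401,365,503], [346,509,421,503], [425,343,508,503],
        [504,343,485,447], [454,501,313,511], [346,501,421,511], [482,501,285,511],
        [322,501,445,511], [433,511,492,343], [465,511,428,375], [366,509,401,503],
        [342,425,509,503], [500,489,343,447], [358,409,501,511], [500,425,343,511],
        [424,501,343,511], [392,501,375,511], [501,427,342,509], [509,427,500,343],
        [424,343,509,503], [342,425,501,511]]
      []
      []]"

lemma reducible_triangle_hub_two_needy: "reducible triangle_hub_two_needy [start 4 3 3] [(Attach 0,
  Absent)]"
  by (simp only: triangle_hub_two_needy_def start_eval reducible_eval)

definition triangle_hub_partners :: "stage list" where
  "triangle_hub_partners = [
    Stage (Attach i1) 0 [] [] [[12,12,10,15]],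
    Stage (Join i1 0) 0 [[14,9,14,15]] [] [[12,10,15,15]],
    Stage (Attach 0) 0 [] [] [[20,30,30,27], [24,30,30,23]],
    Stage (Attach 0) 0 [] [] [[60,60,46,51], [60,60,54,43], [40,60,54,63], [48,60,46,63]],
    Stage (Attach i1) 0
      []
      []
      [
        [120,92,126,101], [120,108,126,85], [120,92,102,125], [120,108,86,125],
        [80,108,126,125], [96,92,126,125]],
    Stage (Attach i1) i2
      [
        [254,249,225,157], [254,185,225,221], [233,245,218,189], [222,233,177,253],
        [254,153,225,253], [190,217,225,253], [222,185,225,253], [254,249,129,253],
        [169,245,218,253], [217,245,170,253], [185,245,202,253], [244,249,253,139],
        [244,249,157,235], [244,185,221,235], [244,153,253,235], [180,217,253,235],
        [169,255,208,253], [217,255,160,253], [185,255,192,253], [228,251,249,157],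
        [228,251,185,221], [200,251,245,189], [228,251,153,253], [132,251,249,253],
        [244,237,153,251], [148,237,249,251], [156,241,237,251]]
      [
        [254,237,177,217], [232,223,177,253], [200,255,177,253], [220,251,177,237],
        [252,233,177,223], [240,169,253,223], [220,233,177,255], [184,193,253,255],
        [216,161,253,255], [222,249,161,253], [169,245,220,251], [252,205,177,251],
        [188,209,237,251], [212,185,237,251], [185,207,240,253], [217,175,240,253],
        [241,169,252,223], [233,189,240,223], [241,169,220,255], [252,217,161,255],
        [252,185,193,255], [241,169,222,253], [233,187,220,245], [252,173,209,251],
        [221,251,252,161], [189,251,252,193], [205,251,240,189], [184,241,253,207],
        [216,241,253,175], [232,241,189,223], [205,255,240,185], [173,255,240,217],
        [254,221,241,169], [250,205,241,189], [200,253,245,187], [173,221,240,251],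
        [204,241,189,251], [196,249,189,251], [232,213,189,251], [252,185,241,207],
        [252,217,241,175], [172,241,217,255], [204,241,185,255], [184,241,205,255],
        [216,241,173,255], [185,245,250,205], [173,221,250,241], [252,203,241,189],
        [184,203,245,253], [252,171,241,221], [216,171,245,253], [228,217,253,187],
        [252,169,213,251], [185,245,204,251], [212,173,249,251], [172,241,221,251],
        [217,245,250,173], [197,253,250,185], [250,165,217,253], [252,185,245,203],
        [252,217,245,171], [252,197,185,251], [217,165,252,251], [217,245,172,251],
        [184,251,245,205], [216,245,173,251], [197,251,184,253], [165,251,216,253]]
      [[238,177,217,253]],
    Stage (Join i1 0) 0 [] [] []]"

lemma reducible_triangle_hub_partners: "reducible triangle_hub_partners [start 4 3 3] [(Attach 0,
  Absent)]"
  by (simp only: triangle_hub_partners_def start_eval reducible_eval)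

definition two_hubs :: "stage list" where
  "two_hubs = [
    Stage (Attach i1) 0 [] [] [[12,12,10,15]],
    Stage (Join i1 0) 0 [] [] [[12,10,15,15]],
    Stage (Attach 0) 0 [] [] [[20,30,30,27], [24,30,30,23]],
    Stage (Attach 0) 0 [] [] [[60,60,46,51], [60,60,54,43], [40,60,54,63], [48,60,46,63]],
    Stage (Attach 0) i1
      [[122,101,88,127], [122,85,104,127], [90,117,104,127], [90,109,112,127]]
      [
        [93,123,96,126], [120,97,126,95], [108,83,120,127], [126,109,120,83], [123,87,120,108],
        [92,127,96,123], [93,99,120,126], [108,121,126,83], [81,111,120,126], [92,121,126,99],
        [81,123,108,126], [80,121,126,111], [92,127,120,99], [92,97,126,123], [86,121,108,123],
        [80,109,126,123], [123,103,120,92], [80,127,108,123], [102,121,92,123],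
        [120,109,86,123], [120,93,102,123], [121,111,120,86], [120,87,120,111],
        [121,95,120,102], [120,103,120,95]]
      [[96,126,121,95], [120,106,85,127]],
    Stage (Attach i1) i1
      [
        [166,217,254,245], [246,201,182,253], [180,227,254,221], [180,233,254,215],
        [180,241,254,207], [212,241,254,175], [245,175,240,222], [174,245,240,223],
        [252,191,192,247], [212,255,184,231], [228,255,184,215], [212,175,240,255],
        [246,174,217,245], [186,197,246,253], [193,255,180,254], [242,190,197,253],
        [216,247,174,245], [244,190,193,255], [254,167,216,245], [252,247,190,193],
        [252,191,242,197], [212,171,254,245]]
      [
        [246,197,184,255], [166,255,216,245], [252,187,246,197], [212,170,245,255],
        [190,243,252,197]]
      [[216,246,245,175], [184,198,245,255]],
    Stage (Join i1 0) 0 [[246,219,245,175], [245,187,198,255]] [] []]"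

lemma reducible_two_hubs: "reducible two_hubs [start 4 3 3] [(Attach 0, Absent)]"
  by (simp only: two_hubs_def start_eval reducible_eval)

definition four_clique :: "stage list" where
  "four_clique = [
    Stage (Attach i1) 0 [] [] [[12,12,10,15]],
    Stage (Join i1 0) 0 [] [] [[12,10,15,15]],
    Stage (Attach i2) 0 [] [] [[24,30,30,29]],
    Stage (Join i2 0) 0 [] [] [[30,30,29,29]],
    Stage (Join i1 0) 0 [] [] []]"

lemma reducible_four_clique: "reducible four_clique [start 4 3 3] [(Attach 0, Absent)]"
  by (simp only: four_clique_def start_eval reducible_eval)

section \<open>Critical graphs of maximum degree four\<close>

locale critical_graph =
  fixes G :: "'a ugraph"
  assumes critical: "edge_critical G" and max_deg: "max_degree G = 4"
begin

abbreviation adj :: "'a \<Rightarrow> 'a \<Rightarrow> bool" where "adj u v \<equiv> {u, v} \<in> edges G"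
abbreviation d :: "'a \<Rightarrow> nat" where "d v \<equiv> degree G v"

definition nbrs :: "'a \<Rightarrow> 'a set" where "nbrs v = {u. adj v u}"

lemma finite_edges: "finite (edges G)" and edge_card: "e \<in> edges G \<Longrightarrow> card e = 2"
  and edge_verts: "e \<in> edges G \<Longrightarrow> e \<subseteq> verts G" and finite_verts: "finite (verts G)"
proof -
  have simple: "finite_simple_graph G" using critical by (simp add: edge_critical_def)
  then show "finite (verts G)" "e \<in> edges G \<Longrightarrow> card e = 2" "e \<in> edges G \<Longrightarrow> e \<subseteq> verts G"
    by (auto simp: finite_simple_graph_def)
  have "edges G \<subseteq> Pow (verts G)" using simple by (auto simp: finite_simple_graph_def)
  then show "finite (edges G)" using \<open>finite (verts G)\<close> by (meson finite_Pow_iff finite_subset)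
qed

lemma proper_iff_colouring: "proper_edge_coloring H k \<phi> \<longleftrightarrow> colouring k (edges H) \<phi>"
  by (simp add: proper_edge_coloring_def colouring_def)

lemma not_colourable: "\<nexists>\<phi>. colouring 4 (edges G) \<phi>"
proof
  assume "\<exists>\<phi>. colouring 4 (edges G) \<phi>"
  then have "chromatic_index G \<le> 4" unfolding chromatic_index_def proper_iff_colouring
    by (rule Least_le)
  then show False using critical max_deg by (simp add: edge_critical_def)
qed

lemma colourable_minus_edge:
  assumes "e \<in> edges G" shows "\<exists>\<phi>. colouring 4 (edges G - {e}) \<phi>"
proof -
  have "finite_simple_graph (delete_edge e G)"
    using critical by (auto simp: edge_critical_def finite_simple_graph_def delete_edge_def)
  then obtain \<phi> where "colouring (chromatic_index (delete_edge e G)) (edges G - {e}) \<phi>"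
    using chromatic_index_attained unfolding proper_iff_colouring
      by (fastforce simp: delete_edge_def)
  moreover have "chromatic_index (delete_edge e G) \<le> 4"
    using assms critical max_deg by (auto simp: edge_critical_def)
  ultimately have "colouring 4 (edges G - {e}) \<phi>" by (fastforce simp: colouring_def)
  then show ?thesis by blast
qed

lemma adj_sym: "adj u v \<longleftrightarrow> adj v u"
  by (simp add: insert_commute)

lemma adj_symD: "adj u v \<Longrightarrow> adj v u"
  by (simp add: insert_commute)

lemma adj_neq: "adj u v \<Longrightarrow> u \<noteq> v"
  using edge_card[of "{u, v}"] by auto

lemma adj_verts: "adj u v \<Longrightarrow> u \<in> verts G \<and> v \<in> verts G"
  using edge_verts[of "{u, v}"] by auto

lemma finite_nbrs [simp]: "finite (nbrs v)"
proof (rule finite_subset[OF _ finite_verts])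
  show "nbrs v \<subseteq> verts G" using adj_verts by (auto simp: nbrs_def)
qed

lemma card_nbrs: "card (nbrs v) = d v"
proof -
  have "bij_betw (\<lambda>u. {v, u}) (nbrs v) {e \<in> edges G. v \<in> e}"
  proof (rule bij_betwI')
    fix e assume "e \<in> {e \<in> edges G. v \<in> e}"
    then show "\<exists>u \<in> nbrs v. e = {v, u}" using edge_card[of e] adj_sym
      by (auto simp: card_2_iff nbrs_def doubleton_eq_iff)
  qed (auto simp: nbrs_def doubleton_eq_iff)
  then show ?thesis by (simp add: degree_def bij_betw_same_card)
qed

lemma degree_sum_edge: "adj u v \<Longrightarrow> 6 \<le> d u + d v"
  using realised_start(1)[OF finite_edges _ adj_neq not_colourable colourable_minus_edge]
    by (simp add: degree_def)

lemma degree_le_4: "v \<in> verts G \<Longrightarrow> d v \<le> 4"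
  using max_deg finite_verts unfolding max_degree_def by (metis Max_ge finite_imageI imageI)

lemma nbr_exists:
  assumes "v \<in> verts G" shows "\<exists>u. adj v u"
proof -
  have conn: "connected_graph G" using critical by (simp add: edge_critical_def)
  have "edges G \<noteq> {}" using not_colourable by (auto simp: colouring_def)
  then obtain a b where ab: "adj a b" using edge_card by (metis card_2_iff ex_in_conv)
  show ?thesis
  proof (cases "v = a")
    case False
    have "(v, a) \<in> {(x, y). {x, y} \<in> edges G}\<^sup>*" using conn assms adj_verts[OF ab]
      by (auto simp: connected_graph_def)
    then show ?thesis using False by (auto elim: converse_rtranclE)
  qed (use ab in blast)
qed

lemma degree_cases: "v \<in> verts G \<Longrightarrow> d v = 2 \<or> d v = 3 \<or> d v = 4"
proof -
  assume v: "v \<in> verts G"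
  then obtain u where u: "adj v u" using nbr_exists by blast
  show ?thesis using degree_sum_edge[OF u] degree_le_4[OF v] degree_le_4[of u] adj_verts[OF u]
    by auto
qed

lemma no_configuration:
  assumes "adj x y" "reducible sts [start 4 a b] [(Attach 0, Absent)]" "d x = a" "d y = b"
  shows "\<not> fits 4 (edges G) {{x, y}} [y, x] sts ws"
  using assms by (intro reducible_configuration[OF finite_edges edge_card not_colourable
    colourable_minus_edge])
    (auto simp: degree_def)

lemma no_path_2_4_3:
  assumes adj: "adj x y" "adj y t"
    and deg: "d x = 2" "d y = 4" "d t = 3"
  shows False
proof -
  have "distinct [x, y, t]"
    using deg by auto
  then show False
    using no_configuration[OF adj(1) reducible_path_2_4_3, of "[t]"] adj deg
    by (auto simp: path_2_4_3_def degree_def[symmetric] doubleton_eq_iff)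
qed

lemma no_path_2_4_2:
  assumes adj: "adj x y" "adj y t"
    and deg: "d x = 2" "d y = 4" "d t = 2"
    and dist: "x \<noteq> t"
  shows False
proof -
  have "distinct [x, y, t]"
    using deg dist by auto
  then show False
    using no_configuration[OF adj(1) reducible_path_2_4_2, of "[t]"] adj deg
    by (auto simp: path_2_4_2_def degree_def[symmetric] doubleton_eq_iff)
qed

lemma no_path_2_4_4_2:
  assumes adj: "adj x y" "adj y z" "adj z t"
    and deg: "d x = 2" "d y = 4" "d z = 4" "d t = 2"
    and dist: "x \<noteq> t"
  shows False
proof -
  have "distinct [x, y, z, t]"
    using deg dist adj_neq[OF adj(2)] by auto
  then show False
    using no_configuration[OF adj(1) reducible_path_2_4_4_2, of "[z, t]"] adj deg
    by (auto simp: path_2_4_4_2_def degree_def[symmetric] doubleton_eq_iff)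
qed

lemma no_path_3_3_3:
  assumes adj: "adj t u" "adj u v"
    and deg: "d t = 3" "d u = 3" "d v = 3"
    and dist: "t \<noteq> v"
  shows False
proof -
  have "distinct [t, u, v]"
    using deg dist adj_neq[OF adj(1)] adj_neq[OF adj(2)] by auto
  then show False
    using no_configuration[OF adj(1) reducible_path_3_3_3, of "[v]"] adj deg
    by (auto simp: path_3_3_3_def degree_def[symmetric] doubleton_eq_iff)
qed

lemma no_path_3_3_4_3:
  assumes adj: "adj v u" "adj u a" "adj a t"
    and deg: "d v = 3" "d u = 3" "d a = 4" "d t = 3"
    and dist: "v \<noteq> t" "u \<noteq> t"
  shows False
proof -
  have "distinct [v, u, a, t]"
    using deg dist adj_neq[OF adj(1)] by auto
  then show False
    using no_configuration[OF adj(1) reducible_path_3_3_4_3, of "[a, t]"] adj deg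
    by (auto simp: path_3_3_4_3_def degree_def[symmetric] doubleton_eq_iff)
qed

lemma no_star_4_333:
  assumes adj: "adj u a" "adj a v" "adj a w"
    and deg: "d u = 3" "d a = 4" "d v = 3" "d w = 3"
    and dist: "u \<noteq> v" "u \<noteq> w" "v \<noteq> w"
  shows False
proof -
  have "distinct [u, a, v, w]"
    using deg dist by auto
  then show False
    using no_configuration[OF adj(1) reducible_star_4_333, of "[v, w]"] adj deg
    by (auto simp: star_4_333_def degree_def[symmetric] doubleton_eq_iff)
qed

lemma no_needy_shared_and_needy:
  assumes adj: "adj x' y'" "adj y' a" "adj a y" "adj y x" "adj a z" "adj x z"
    and deg: "d x' = 2" "d y' = 4" "d a = 4" "d y = 4" "d x = 2" "d z = 4"
    and dist: "x' \<noteq> x" "y' \<noteq> y" "y' \<noteq> z" "y \<noteq> z"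
  shows False
proof -
  have "distinct [x', y', a, y, x, z]"
    using deg dist adj_neq[OF adj(2)] adj_neq[OF adj(3)] adj_neq[OF adj(5)] by auto
  then show False
    using no_configuration[OF adj(1) reducible_needy_shared_and_needy, of "[a, y, x, z]"] adj deg
    by (auto simp: needy_shared_and_needy_def degree_def[symmetric] doubleton_eq_iff)
qed

lemma no_needy_four:
  assumes adj: "adj x y" "adj y a" "adj a y'" "adj a y''" "adj a y'''" "adj y''' x'''" "adj y'' x''"
    "adj y' x'"
    and deg: "d x = 2" "d y = 4" "d a = 4" "d y' = 4" "d y'' = 4" "d y''' = 4" "d x''' = 2"
      "d x'' = 2" "d x' = 2"
    and dist: "x \<noteq> x'''" "x \<noteq> x''" "x \<noteq> x'" "y \<noteq> y'" "y \<noteq> y''" "y \<noteq> y'''" "y' \<noteq> y''" "y' \<noteq> y'''"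
      "y'' \<noteq> y'''" "x''' \<noteq> x''" "x''' \<noteq> x'" "x'' \<noteq> x'"
  shows False
proof -
  have "distinct [x, y, a, y', y'', y''', x''', x'', x']"
    using deg dist adj_neq[OF adj(2)] adj_neq[OF adj(3)] adj_neq[OF adj(4)] adj_neq[OF adj(5)]
      by auto
  then show False
    using no_configuration[OF adj(1) reducible_needy_four, of "[a, y', y'', y''', x''', x'', x']"]
      adj deg
    by (auto simp: needy_four_def degree_def[symmetric] doubleton_eq_iff)
qed

lemma no_two_threes_vs_three:
  assumes adj: "adj x y" "adj y a" "adj a v" "adj a w" "adj y b" "adj b u"
    and deg: "d x = 2" "d y = 4" "d a = 4" "d v = 3" "d w = 3" "d b = 4" "d u = 3"
    and dist: "a \<noteq> b" "v \<noteq> w" "v \<noteq> u" "w \<noteq> u"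
  shows False
proof -
  have "distinct [x, y, a, v, w, b, u]"
    using deg dist adj_neq[OF adj(2)] adj_neq[OF adj(5)] by auto
  then show False
    using no_configuration[OF adj(1) reducible_two_threes_vs_three, of "[a, v, w, b, u]"] adj deg
    by (auto simp: two_threes_vs_three_def degree_def[symmetric] doubleton_eq_iff)
qed

lemma no_two_threes_vs_shared_three:
  assumes adj: "adj x y" "adj y a" "adj a v" "adj a w" "adj y b" "adj v b"
    and deg: "d x = 2" "d y = 4" "d a = 4" "d v = 3" "d w = 3" "d b = 4"
    and dist: "a \<noteq> b" "v \<noteq> w"
  shows False
proof -
  have "distinct [x, y, a, v, w, b]"
    using deg dist adj_neq[OF adj(2)] adj_neq[OF adj(5)] by auto
  then show False
    using no_configuration[OF adj(1) reducible_two_threes_vs_shared_three, of "[a, v, w, b]"] adj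
      deg
    by (auto simp: two_threes_vs_shared_three_def degree_def[symmetric] doubleton_eq_iff)
qed

lemma no_three_needy_vs_three:
  assumes adj: "adj x y" "adj y a" "adj a w" "adj a y'" "adj y' x'" "adj y b" "adj b u"
    and deg: "d x = 2" "d y = 4" "d a = 4" "d w = 3" "d y' = 4" "d x' = 2" "d b = 4" "d u = 3"
    and dist: "x \<noteq> x'" "y \<noteq> y'" "a \<noteq> b" "w \<noteq> u" "y' \<noteq> b"
  shows False
proof -
  have "distinct [x, y, a, w, y', x', b, u]"
    using deg dist adj_neq[OF adj(2)] adj_neq[OF adj(4)] adj_neq[OF adj(6)] by auto
  then show False
    using no_configuration[OF adj(1) reducible_three_needy_vs_three, of "[a, w, y', x', b, u]"] adj
      deg
    by (auto simp: three_needy_vs_three_def degree_def[symmetric] doubleton_eq_iff)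
qed

lemma no_three_needy_vs_shared_three:
  assumes adj: "adj x y" "adj y a" "adj a w" "adj a y'" "adj y' x'" "adj y b" "adj w b"
    and deg: "d x = 2" "d y = 4" "d a = 4" "d w = 3" "d y' = 4" "d x' = 2" "d b = 4"
    and dist: "x \<noteq> x'" "y \<noteq> y'" "a \<noteq> b" "y' \<noteq> b"
  shows False
proof -
  have "distinct [x, y, a, w, y', x', b]"
    using deg dist adj_neq[OF adj(2)] adj_neq[OF adj(4)] adj_neq[OF adj(6)] by auto
  then show False
    using no_configuration[OF adj(1) reducible_three_needy_vs_shared_three, of "[a, w, y', x', b]"]
      adj deg
    by (auto simp: three_needy_vs_shared_three_def degree_def[symmetric] doubleton_eq_iff)
qed

lemma no_three_partner_vs_three:
  assumes adj: "adj x y" "adj y a" "adj a z" "adj x z" "adj a w" "adj y b" "adj b u"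
    and deg: "d x = 2" "d y = 4" "d a = 4" "d z = 4" "d w = 3" "d b = 4" "d u = 3"
    and dist: "y \<noteq> z" "a \<noteq> b" "z \<noteq> b" "w \<noteq> u"
  shows False
proof -
  have "distinct [x, y, a, z, w, b, u]"
    using deg dist adj_neq[OF adj(2)] adj_neq[OF adj(3)] adj_neq[OF adj(6)] by auto
  then show False
    using no_configuration[OF adj(1) reducible_three_partner_vs_three, of "[a, z, w, b, u]"] adj deg
    by (auto simp: three_partner_vs_three_def degree_def[symmetric] doubleton_eq_iff)
qed

lemma no_three_partner_vs_shared_three:
  assumes adj: "adj x y" "adj y a" "adj a z" "adj x z" "adj a w" "adj y b" "adj w b"
    and deg: "d x = 2" "d y = 4" "d a = 4" "d z = 4" "d w = 3" "d b = 4"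
    and dist: "y \<noteq> z" "a \<noteq> b" "z \<noteq> b"
  shows False
proof -
  have "distinct [x, y, a, z, w, b]"
    using deg dist adj_neq[OF adj(2)] adj_neq[OF adj(3)] adj_neq[OF adj(6)] by auto
  then show False
    using no_configuration[OF adj(1) reducible_three_partner_vs_shared_three, of "[a, z, w, b]"] adj
      deg
    by (auto simp: three_partner_vs_shared_three_def degree_def[symmetric] doubleton_eq_iff)
qed

lemma no_three_vs_two_needy:
  assumes adj: "adj x y" "adj y b" "adj b y'" "adj y' x'" "adj b y''" "adj y'' x''" "adj y a"
    "adj a w"
    and deg: "d x = 2" "d y = 4" "d b = 4" "d y' = 4" "d x' = 2" "d y'' = 4" "d x'' = 2" "d a = 4"
      "d w = 3"
    and dist: "x \<noteq> x'" "x \<noteq> x''" "y \<noteq> y'" "y \<noteq> y''" "b \<noteq> a" "y' \<noteq> y''" "y' \<noteq> a" "x' \<noteq> x''" "y'' \<noteq> a"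
  shows False
proof -
  have "distinct [x, y, b, y', x', y'', x'', a, w]"
    using deg dist adj_neq[OF adj(2)] adj_neq[OF adj(3)] adj_neq[OF adj(5)] adj_neq[OF adj(7)]
      by auto
  then show False
    using no_configuration[OF adj(1) reducible_three_vs_two_needy, of "[b, y', x', y'', x'', a, w]"]
      adj deg
    by (auto simp: three_vs_two_needy_def degree_def[symmetric] doubleton_eq_iff)
qed

lemma no_needy_triangle_three:
  assumes adj: "adj x y" "adj x z" "adj y z" "adj y b" "adj b w"
    and deg: "d x = 2" "d y = 4" "d z = 4" "d b = 4" "d w = 3"
    and dist: "z \<noteq> b"
  shows False
proof -
  have "distinct [x, y, z, b, w]"
    using deg dist adj_neq[OF adj(3)] adj_neq[OF adj(4)] by auto
  then show False
    using no_configuration[OF adj(1) reducible_needy_triangle_three, of "[z, b, w]"] adj deg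
    by (auto simp: needy_triangle_three_def degree_def[symmetric] doubleton_eq_iff)
qed

lemma no_needy_triangle_two_needy:
  assumes adj: "adj x y" "adj x z" "adj y z" "adj y b" "adj b y'" "adj y' x'" "adj b y''"
    "adj y'' x''"
    and deg: "d x = 2" "d y = 4" "d z = 4" "d b = 4" "d y' = 4" "d x' = 2" "d y'' = 4" "d x'' = 2"
    and dist: "x \<noteq> x'" "x \<noteq> x''" "y \<noteq> y'" "y \<noteq> y''" "z \<noteq> b" "z \<noteq> y'" "z \<noteq> y''" "y' \<noteq> y''" "x' \<noteq> x''"
  shows False
proof -
  have "distinct [x, y, z, b, y', x', y'', x'']"
    using deg dist adj_neq[OF adj(3)] adj_neq[OF adj(4)] adj_neq[OF adj(5)] adj_neq[OF adj(7)]
      by auto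
  then show False
    using no_configuration[OF adj(1) reducible_needy_triangle_two_needy, of
      "[z, b, y', x', y'', x'']"] adj deg
    by (auto simp: needy_triangle_two_needy_def degree_def[symmetric] doubleton_eq_iff)
qed

lemma no_pair_between_needy:
  assumes adj: "adj x y" "adj y p" "adj p u" "adj u v" "adj u q" "adj q y'" "adj y' x'"
    and deg: "d x = 2" "d y = 4" "d p = 4" "d u = 3" "d v = 3" "d q = 4" "d y' = 4" "d x' = 2"
    and dist: "x \<noteq> x'" "y \<noteq> q" "y \<noteq> y'" "p \<noteq> q" "p \<noteq> y'"
  shows False
proof -
  have "distinct [x, y, p, u, v, q, y', x']"
    using deg dist adj_neq[OF adj(2)] adj_neq[OF adj(4)] adj_neq[OF adj(6)] by auto
  then show False
    using no_configuration[OF adj(1) reducible_pair_between_needy, of "[p, u, v, q, y', x']"] adj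
      deg
    by (auto simp: pair_between_needy_def degree_def[symmetric] doubleton_eq_iff)
qed

lemma no_pair_same_needy:
  assumes adj: "adj x y" "adj y p" "adj p u" "adj u q" "adj y q" "adj u v"
    and deg: "d x = 2" "d y = 4" "d p = 4" "d u = 3" "d q = 4" "d v = 3"
    and dist: "p \<noteq> q"
  shows False
proof -
  have "distinct [x, y, p, u, q, v]"
    using deg dist adj_neq[OF adj(2)] adj_neq[OF adj(5)] adj_neq[OF adj(6)] by auto
  then show False
    using no_configuration[OF adj(1) reducible_pair_same_needy, of "[p, u, q, v]"] adj deg
    by (auto simp: pair_same_needy_def degree_def[symmetric] doubleton_eq_iff)
qed

lemma no_pair_partner_needy:
  assumes adj: "adj x y" "adj y p" "adj p u" "adj u q" "adj q z" "adj x z" "adj u v"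
    and deg: "d x = 2" "d y = 4" "d p = 4" "d u = 3" "d q = 4" "d z = 4" "d v = 3"
    and dist: "y \<noteq> q" "y \<noteq> z" "p \<noteq> q" "p \<noteq> z"
  shows False
proof -
  have "distinct [x, y, p, u, q, z, v]"
    using deg dist adj_neq[OF adj(2)] adj_neq[OF adj(5)] adj_neq[OF adj(7)] by auto
  then show False
    using no_configuration[OF adj(1) reducible_pair_partner_needy, of "[p, u, q, z, v]"] adj deg
    by (auto simp: pair_partner_needy_def degree_def[symmetric] doubleton_eq_iff)
qed

lemma no_triangle_other_needy:
  assumes adj: "adj u v" "adj u w" "adj v w" "adj u b" "adj b y" "adj y x"
    and deg: "d u = 3" "d v = 3" "d w = 4" "d b = 4" "d y = 4" "d x = 2"
    and dist: "w \<noteq> b" "w \<noteq> y"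
  shows False
proof -
  have "distinct [u, v, w, b, y, x]"
    using deg dist adj_neq[OF adj(1)] adj_neq[OF adj(5)] by auto
  then show False
    using no_configuration[OF adj(1) reducible_triangle_other_needy, of "[w, b, y, x]"] adj deg
    by (auto simp: triangle_other_needy_def degree_def[symmetric] doubleton_eq_iff)
qed

lemma no_triangle_needy:
  assumes adj: "adj u v" "adj u w" "adj v w" "adj w y" "adj y x"
    and deg: "d u = 3" "d v = 3" "d w = 4" "d y = 4" "d x = 2"
  shows False
proof -
  have "distinct [u, v, w, y, x]"
    using deg adj_neq[OF adj(1)] adj_neq[OF adj(4)] by auto
  then show False
    using no_configuration[OF adj(1) reducible_triangle_needy, of "[w, y, x]"] adj deg
    by (auto simp: triangle_needy_def degree_def[symmetric] doubleton_eq_iff)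
qed

lemma no_triangle_hub_three:
  assumes adj: "adj u v" "adj u w" "adj v w" "adj w r" "adj r t"
    and deg: "d u = 3" "d v = 3" "d w = 4" "d r = 4" "d t = 3"
    and dist: "u \<noteq> t" "v \<noteq> t"
  shows False
proof -
  have "distinct [u, v, w, r, t]"
    using deg dist adj_neq[OF adj(1)] adj_neq[OF adj(4)] by auto
  then show False
    using no_configuration[OF adj(1) reducible_triangle_hub_three, of "[w, r, t]"] adj deg
    by (auto simp: triangle_hub_three_def degree_def[symmetric] doubleton_eq_iff)
qed

lemma no_triangle_hub_two_needy:
  assumes adj: "adj u v" "adj u w" "adj v w" "adj w r" "adj r y" "adj y x" "adj r y'" "adj y' x'"
    and deg: "d u = 3" "d v = 3" "d w = 4" "d r = 4" "d y = 4" "d x = 2" "d y' = 4" "d x' = 2"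
    and dist: "w \<noteq> y" "w \<noteq> y'" "y \<noteq> y'" "x \<noteq> x'"
  shows False
proof -
  have "distinct [u, v, w, r, y, x, y', x']"
    using deg dist adj_neq[OF adj(1)] adj_neq[OF adj(4)] adj_neq[OF adj(5)] adj_neq[OF adj(7)]
      by auto
  then show False
    using no_configuration[OF adj(1) reducible_triangle_hub_two_needy, of "[w, r, y, x, y', x']"]
      adj deg
    by (auto simp: triangle_hub_two_needy_def degree_def[symmetric] doubleton_eq_iff)
qed

lemma no_triangle_hub_partners:
  assumes adj: "adj u v" "adj u w" "adj v w" "adj w r" "adj r y" "adj r z" "adj y x" "adj z x"
    and deg: "d u = 3" "d v = 3" "d w = 4" "d r = 4" "d y = 4" "d z = 4" "d x = 2"
    and dist: "w \<noteq> y" "w \<noteq> z" "y \<noteq> z"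
  shows False
proof -
  have "distinct [u, v, w, r, y, z, x]"
    using deg dist adj_neq[OF adj(1)] adj_neq[OF adj(4)] adj_neq[OF adj(5)] adj_neq[OF adj(6)]
      by auto
  then show False
    using no_configuration[OF adj(1) reducible_triangle_hub_partners, of "[w, r, y, z, x]"] adj deg
    by (auto simp: triangle_hub_partners_def degree_def[symmetric] doubleton_eq_iff)
qed

lemma no_two_hubs:
  assumes adj: "adj u v" "adj u w" "adj v w" "adj w r" "adj r w'" "adj w' u'" "adj w' v'"
    "adj u' v'"
    and deg: "d u = 3" "d v = 3" "d w = 4" "d r = 4" "d w' = 4" "d u' = 3" "d v' = 3"
    and dist: "u \<noteq> u'" "u \<noteq> v'" "v \<noteq> u'" "v \<noteq> v'" "w \<noteq> w'"
  shows False
proof -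
  have "distinct [u, v, w, r, w', u', v']"
    using deg dist adj_neq[OF adj(1)] adj_neq[OF adj(4)] adj_neq[OF adj(5)] adj_neq[OF adj(8)]
      by auto
  then show False
    using no_configuration[OF adj(1) reducible_two_hubs, of "[w, r, w', u', v']"] adj deg
    by (auto simp: two_hubs_def degree_def[symmetric] doubleton_eq_iff)
qed

lemma no_four_clique:
  assumes adj: "adj u v" "adj u w" "adj v w" "adj u p" "adj v p" "adj w p"
    and deg: "d u = 3" "d v = 3" "d w = 4" "d p = 4"
  shows False
proof -
  have "distinct [u, v, w, p]"
    using deg adj_neq[OF adj(1)] adj_neq[OF adj(6)] by auto
  then show False
    using no_configuration[OF adj(1) reducible_four_clique, of "[w, p]"] adj deg
    by (auto simp: four_clique_def degree_def[symmetric] doubleton_eq_iff)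
qed

section \<open>Discharging\<close>

lemma nbrs_iff [simp]: "u \<in> nbrs v \<longleftrightarrow> adj v u"
  by (simp add: nbrs_def)

lemma nbr_of_2: "adj x y \<Longrightarrow> d x = 2 \<Longrightarrow> d y = 4"
  using degree_sum_edge[of x y] degree_le_4[of y] adj_verts[of x y] by simp

lemma nbr_of_3: "adj u v \<Longrightarrow> d u = 3 \<Longrightarrow> d v = 3 \<or> d v = 4"
  using degree_sum_edge[of u v] degree_le_4[of v] adj_verts[of u v] by auto

lemma two_elements: "2 \<le> card A \<Longrightarrow> \<exists>p \<in> A. \<exists>q \<in> A. p \<noteq> q"
proof -
  assume two: "2 \<le> card A"
  then have "finite A" by (metis card.infinite not_numeral_le_zero)
  then show ?thesis using two card_le_Suc0_iff_eq[of A] by auto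
qed

lemma nbrs_of_2:
  assumes "d x = 2" "adj x y" "adj x z" "y \<noteq> z" "adj x t"
  shows "t = y \<or> t = z"
proof -
  have "{y, z} = nbrs x" using assms by (intro card_subset_eq) (auto simp: card_nbrs)
  then show ?thesis using assms(5) by (metis insertE nbrs_iff singletonD)
qed

lemma nbrs_of_3:
  assumes "d u = 3" "adj u p" "adj u q" "adj u r" "p \<noteq> q" "p \<noteq> r" "q \<noteq> r" "adj u t"
  shows "t = p \<or> t = q \<or> t = r"
proof -
  have "{p, q, r} = nbrs u" using assms by (intro card_subset_eq) (auto simp: card_nbrs)
  then show ?thesis using assms(8) by (metis insertE nbrs_iff singletonD)
qed

definition needy :: "'a \<Rightarrow> bool" where "needy y \<longleftrightarrow> d y = 4 \<and> (\<exists>x. adj y x \<and> d x = 2)"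

definition hub :: "'a \<Rightarrow> bool" where
  "hub w \<longleftrightarrow> d w = 4 \<and> (\<exists>u v. adj w u \<and> adj w v \<and> adj u v \<and> d u = 3 \<and> d v = 3)"

definition near_needy :: "'a \<Rightarrow> bool" where "near_needy a \<longleftrightarrow> (\<exists>y. adj a y \<and> needy y)"

lemma needyE:
  assumes "needy y" obtains x where "adj x y" "adj y x" "d x = 2" "d y = 4"
  using assms adj_sym by (auto simp: needy_def)

lemma needy_nbr_4:
  assumes "needy y" "adj x y" "d x = 2" "adj y t" "t \<noteq> x"
  shows "d t = 4"
proof -
  have "d y = 4" using assms(1) by (simp add: needy_def)
  then show ?thesis
    using no_path_2_4_3[of x y t] no_path_2_4_2[of x y t] assms adj_neq[of x y] adj_neq[of y t]
      degree_cases[of t] adj_verts[of y t] by auto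
qed

lemma needy_no_3:
  assumes "needy y" "adj y t" shows "d t \<noteq> 3"
proof -
  obtain x where "adj x y" "d x = 2" using needyE[OF assms(1)] by metis
  then show ?thesis using needy_nbr_4[OF assms(1) _ _ assms(2), of x] by fastforce
qed

lemma needy_adjacent:
  assumes "needy y" "needy y'" "adj y y'" "adj x y" "d x = 2" "adj x' y'" "d x' = 2"
  shows "x' = x"
proof -
  have "d y = 4" "d y' = 4" "adj y' x'" using assms adj_symD by (auto simp: needy_def)
  then show ?thesis using no_path_2_4_4_2[of x y y' x'] assms(3-7) adj_neq[OF assms(3)] by auto
qed

text \<open>Two neighbours \<open>y\<close> and \<open>z\<close> of the same vertex of degree 2 allow no further needy neighbour of \<open>a\<close>. Hence
  three needy neighbours of \<open>a\<close> have three different neighbours of degree 2, which keeps the list of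
  configurations short.\<close>
lemma needy_partners:
  assumes "d a = 4" "adj a y" "adj a z" "adj a y'" "y \<noteq> z" "y' \<noteq> y" "y' \<noteq> z"
    and "adj x y" "adj x z" "d x = 2" "needy y'"
  shows False
proof -
  obtain x' where x': "adj x' y'" "d x' = 2" "d y' = 4" using needyE[OF assms(11)] by metis
  have "x' \<noteq> x" using nbrs_of_2[OF assms(10,8,9,5)] x'(1) assms by metis
  moreover have "d y = 4" "d z = 4" using nbr_of_2 assms by blast+
  moreover have "adj y' a" "adj y x" "y' \<noteq> a" "a \<noteq> y" "a \<noteq> z"
    using assms adj_symD adj_neq[of a y] adj_neq[of a y'] adj_neq[of a z] by auto
  ultimately show False
    using no_needy_shared_and_needy[of x' y' a y x z] assms x' by auto
qed

lemma distinct_twos: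
  assumes "d a = 4" "adj a y" "adj a y'" "adj a y''" "y \<noteq> y'" "y'' \<noteq> y" "y'' \<noteq> y'" "needy y''"
    and "adj x y" "adj x' y'" "d x = 2"
  shows "x \<noteq> x'"
  using needy_partners[of a y y' y'' x] assms by auto

definition threes :: "'a \<Rightarrow> 'a set" where "threes a = {u. adj a u \<and> d u = 3}"
definition needies :: "'a \<Rightarrow> 'a set" where "needies a = {y. adj a y \<and> needy y}"
definition hubs :: "'a \<Rightarrow> 'a set" where "hubs a = {w. adj a w \<and> hub w}"

text \<open>What a vertex \<open>a\<close> of degree 4 pays to a neighbour \<open>u\<close> of degree 3. If \<open>u\<close> has a neighbour of degree 3,
  then only two neighbours are left to pay the 3 that \<open>u\<close> needs. At most one of them is near a needy
  vertex (\<open>one_near_needy\<close>), and it pays 1 only, in order to keep the rest for that vertex.\<close>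
definition amount :: "'a \<Rightarrow> 'a \<Rightarrow> real" where
  "amount a u =
     (if \<forall>v. adj u v \<longrightarrow> d v \<noteq> 3 then 1
      else if near_needy a then 1
      else if \<exists>b. adj u b \<and> b \<noteq> a \<and> d b = 4 \<and> near_needy b then 2
      else 3 / 2)"

definition given :: "'a \<Rightarrow> real" where "given a = (\<Sum>u \<in> threes a. amount a u)"

text \<open>A hub has charge 2 and pays \<open>3 / 2\<close> to each of its two neighbours of degree 3, so it needs \<open>1 / 2\<close> from
  each of its two other neighbours. Needy neighbours divide the rest.\<close>
definition share :: "'a \<Rightarrow> real" where
  "share a = (2 - given a - card (hubs a) / 2) / card (needies a)"

lemma finite_nbr_sets [simp]: "finite (threes a)" "finite (needies a)" "finite (hubs a)"
  by (rule finite_subset[OF _ finite_nbrs[of a]]; auto simp: threes_def needies_def hubs_def)+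

lemma card_threes:
  assumes "d a = 4" shows "card (threes a) \<le> 2"
proof (rule ccontr)
  assume "\<not> ?thesis"
  then obtain T where "T \<subseteq> threes a" "card T = 3"
    by (metis not_less_eq_eq numeral_2_eq_2 numeral_3_eq_3 obtain_subset_with_card_n)
  then obtain u v w where "{u, v, w} \<subseteq> threes a" "u \<noteq> v" "u \<noteq> w" "v \<noteq> w" by (metis card_3_iff)
  then have "adj u a" "adj a v" "adj a w" "d u = 3" "d v = 3" "d w = 3" using adj_symD
    by (auto simp: threes_def)
  then show False using no_star_4_333[of u a v w] assms \<open>u \<noteq> v\<close> \<open>u \<noteq> w\<close> \<open>v \<noteq> w\<close> by auto
qed

lemma card_needies:
  assumes "d a = 4" shows "card (needies a) \<le> 3"
proof (rule ccontr)
  assume "\<not> ?thesis"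
  then have "4 \<le> card (needies a)" by simp
  then obtain T where T: "T \<subseteq> needies a" "card T = 4" by (metis obtain_subset_with_card_n)
  then obtain y1 y2 y3 y4 where ys: "distinct [y1, y2, y3, y4]" "T = {y1, y2, y3, y4}"
    by (auto simp: card_Suc_eq numeral_eq_Suc)
  have n: "needy y1" "needy y2" "needy y3" "needy y4" "adj a y1" "adj a y2" "adj a y3" "adj a y4"
    using ys(2) T(1) by (auto simp: needies_def)
  obtain x1 where x1: "adj x1 y1" "d x1 = 2" "d y1 = 4" using needyE[OF n(1)] by metis
  obtain x2 where x2: "adj x2 y2" "d x2 = 2" "d y2 = 4" using needyE[OF n(2)] by metis
  obtain x3 where x3: "adj x3 y3" "d x3 = 2" "d y3 = 4" using needyE[OF n(3)] by metis
  obtain x4 where x4: "adj x4 y4" "d x4 = 2" "d y4 = 4" using needyE[OF n(4)] by metis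
  have ne: "y1 \<noteq> y2" "y1 \<noteq> y3" "y1 \<noteq> y4" "y2 \<noteq> y3" "y2 \<noteq> y4" "y3 \<noteq> y4" using ys(1) by auto
  have nx: "x1 \<noteq> x2" "x1 \<noteq> x3" "x1 \<noteq> x4" "x2 \<noteq> x3" "x2 \<noteq> x4" "x3 \<noteq> x4"
    using distinct_twos[OF assms n(5,6,7) ne(1) _ _ n(3) x1(1) x2(1) x1(2)]
      distinct_twos[OF assms n(5,7,6) ne(2) _ _ n(2) x1(1) x3(1) x1(2)]
      distinct_twos[OF assms n(5,8,6) ne(3) _ _ n(2) x1(1) x4(1) x1(2)]
      distinct_twos[OF assms n(6,7,5) ne(4) _ _ n(1) x2(1) x3(1) x2(2)]
      distinct_twos[OF assms n(6,8,5) ne(5) _ _ n(1) x2(1) x4(1) x2(2)]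
      distinct_twos[OF assms n(7,8,5) ne(6) _ _ n(1) x3(1) x4(1) x3(2)] ne by auto
  have "adj y1 a" "adj y2 x2" "adj y3 x3" "adj y4 x4" using n(5) x2(1) x3(1) x4(1) adj_symD by auto
  moreover have "a \<noteq> y1" "a \<noteq> y2" "a \<noteq> y3" "a \<noteq> y4" using n(5-8) adj_neq by blast+
  ultimately show False
    using no_needy_four[of x1 y1 a y2 y3 y4 x4 x3 x2] n x1 x2 x3 x4 assms ne nx by auto
qed

lemma amount_near_needy: "near_needy a \<Longrightarrow> amount a u = 1"
  by (simp add: amount_def)

lemma needy_nbr_with_3:
  assumes "needy y" "adj y a" "w \<in> threes a"
  shows "d a = 4" "\<not> needy a"
proof -
  have w: "adj a w" "d w = 3" using assms(3) by (auto simp: threes_def)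
  obtain x where x: "adj x y" "d x = 2" using needyE[OF assms(1)] by metis
  have "a \<noteq> x" using nbr_of_2[of x w] w x(2) by auto
  then show "d a = 4" using needy_nbr_4[OF assms(1) x assms(2)] by simp
  show "\<not> needy a" using needy_no_3 w by blast
qed

text \<open>\<open>a\<close> pays less than 1 to \<open>y\<close>, since besides \<open>y\<close> it has a neighbour of degree 3 and another one that is needy
  or of degree 3. The remaining cases are whether the latter is of degree 3, needy on its own, or needy
  because of the same vertex \<open>x\<close>, and whether \<open>u\<close> is also adjacent to \<open>a\<close>.\<close>
lemma light_excludes_three:
  assumes y: "needy y" and a: "adj y a" "w \<in> threes a" "3 \<le> card (threes a) + card (needies a)"
    and b: "adj y b" "b \<noteq> a" "u \<in> threes b"
  shows False
proof -
  obtain x where x: "adj x y" "d x = 2" "d y = 4" using needyE[OF y] by metis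
  note da = needy_nbr_with_3[OF y a(1,2)] and db = needy_nbr_with_3[OF y b(1,3)]
  have bu: "adj b u" "adj u b" "d u = 3" using b(3) adj_symD by (auto simp: threes_def)
  show False
  proof (cases "2 \<le> card (threes a)")
    case True
    obtain v1 v2 where "v1 \<in> threes a" "v2 \<in> threes a" "v1 \<noteq> v2" using two_elements[OF True]
      by metis
    then have v: "adj a v1" "adj a v2" "d v1 = 3" "d v2 = 3" "v1 \<noteq> v2" by (auto simp: threes_def)
    show False
      using no_two_threes_vs_three[of x y a v1 v2 b u] no_two_threes_vs_shared_three[of x y a v1 v2
        b]
        no_two_threes_vs_shared_three[of x y a v2 v1 b] x a(1) b(1,2) bu v da db by auto
  next
    case False
    then have "2 \<le> card (needies a)" using a(3) by simp
    then obtain y' where y': "y' \<in> needies a" "y' \<noteq> y" using two_elements by metis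
    then have ay: "adj a y'" "needy y'" by (auto simp: needies_def)
    obtain x' where x': "adj x' y'" "adj y' x'" "d x' = 2" "d y' = 4" using needyE[OF ay(2)]
      by metis
    have w: "adj a w" "d w = 3" using a(2) by (auto simp: threes_def)
    have yb: "y' \<noteq> b" using ay(2) db(2) by auto
    show False
    proof (cases "x' = x")
      case True
      then show False
        using no_three_partner_vs_three[of x y a y' w b u] no_three_partner_vs_shared_three[of x y a
          y' w b]
          x x' ay w a(1) b(1,2) bu da db y'(2) yb by auto
    next
      case False
      then show False
        using no_three_needy_vs_three[of x y a w y' x' b u] no_three_needy_vs_shared_three[of x y a
          w y' x' b]
          x x' ay w a(1) b(1,2) bu da db y'(2) yb by auto
    qed
  qed
qed

lemma two_others:
  assumes "3 \<le> card A" "y \<in> A"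
  obtains p q where "p \<in> A" "q \<in> A" "p \<noteq> y" "q \<noteq> y" "p \<noteq> q"
proof -
  have "2 \<le> card (A - {y})" using assms by (simp add: card_Diff_singleton)
  then show thesis using two_elements[of "A - {y}"] that by blast
qed

lemma three_excludes_two_needy:
  assumes y: "needy y" and a: "adj y a" "w \<in> threes a" and b: "adj y b" "b \<noteq> a"
    "3 \<le> card (needies b)"
  shows False
proof -
  obtain x where x: "adj x y" "d x = 2" "d y = 4" using needyE[OF y] by metis
  note da = needy_nbr_with_3[OF y a]
  have w: "adj a w" "d w = 3" using a(2) by (auto simp: threes_def)
  have "card (needies b) \<le> d b" unfolding card_nbrs[symmetric]
    by (rule card_mono) (auto simp: needies_def)
  then have "b \<noteq> x" using b(3) x(2) by auto
  then have db: "d b = 4" using needy_nbr_4[OF y x(1,2) b(1)] by simp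
  have "y \<in> needies b" using y b(1) adj_symD by (auto simp: needies_def)
  then obtain y1 y2 where "y1 \<in> needies b" "y2 \<in> needies b" and ne: "y1 \<noteq> y" "y2 \<noteq> y" "y1 \<noteq> y2"
    using two_others[OF b(3)] by metis
  then have n: "adj b y1" "needy y1" "adj b y2" "needy y2" by (auto simp: needies_def)
  obtain x1 where x1: "adj x1 y1" "adj y1 x1" "d x1 = 2" "d y1 = 4" using needyE[OF n(2)] by metis
  obtain x2 where x2: "adj x2 y2" "adj y2 x2" "d x2 = 2" "d y2 = 4" using needyE[OF n(4)] by metis
  have by': "adj b y" using b(1) adj_symD by blast
  have "x \<noteq> x1" "x \<noteq> x2" "x1 \<noteq> x2"
    using distinct_twos[OF db by' n(1,3) _ _ _ n(4) x(1) x1(1) x(2)]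
      distinct_twos[OF db by' n(3,1) _ _ _ n(2) x(1) x2(1) x(2)]
      distinct_twos[OF db n(1,3) by' _ _ _ y x1(1) x2(1) x1(3)] ne by auto
  then show False
    using no_three_vs_two_needy[of x y b y1 x1 y2 x2 a w] x x1 x2 n ne w a(1) b(1,2) da db by auto
qed

text \<open>If \<open>y\<close> is adjacent to the other neighbour \<open>z\<close> of \<open>x\<close>, it collects from two vertices only, but both of
  them pay at least 1.\<close>
lemma needy_triangle:
  assumes yz: "needy y" "needy z" "adj y z" and x: "adj x y" "adj x z" "d x = 2" and b: "adj y b"
    "b \<noteq> x" "b \<noteq> z"
  shows "threes b = {}" "card (needies b) \<le> 2"
proof -
  have d4: "d y = 4" "d z = 4" "d b = 4" using yz needy_nbr_4[OF yz(1) x(1,3) b(1,2)]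
    by (auto simp: needy_def)
  have ne: "y \<noteq> z" using adj_neq[OF yz(3)] .
  have xn: "t = y \<or> t = z" if "adj x t" for t by (rule nbrs_of_2[OF x(3,1,2) ne that])
  show "threes b = {}"
    using no_needy_triangle_three[of x y z b] x yz(3) b d4 by (auto simp: threes_def)
  show "card (needies b) \<le> 2"
  proof (rule ccontr)
    assume "\<not> ?thesis"
    then have three: "3 \<le> card (needies b)" by simp
    have by': "adj b y" "y \<in> needies b" using yz(1) b(1) adj_symD by (auto simp: needies_def)
    obtain y1 y2 where "y1 \<in> needies b" "y2 \<in> needies b" and ne2: "y1 \<noteq> y" "y2 \<noteq> y" "y1 \<noteq> y2"
      using two_others[OF three by'(2)] by metis
    then have n: "adj b y1" "needy y1" "adj b y2" "needy y2" by (auto simp: needies_def)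
    have nz: "y1 \<noteq> z" "y2 \<noteq> z"
      using needy_partners[OF d4(3) by'(1) _ n(3) ne _ _ x n(4)] needy_partners[OF d4(3) by'(1) _
        n(1) ne _ _ x n(2)] n ne2 by auto
    obtain x1 where x1: "adj x1 y1" "adj y1 x1" "d x1 = 2" "d y1 = 4" using needyE[OF n(2)] by metis
    obtain x2 where x2: "adj x2 y2" "adj y2 x2" "d x2 = 2" "d y2 = 4" using needyE[OF n(4)] by metis
    have "x \<noteq> x1" "x \<noteq> x2" using xn[of y1] xn[of y2] x1(1) x2(1) ne2 nz by auto
    moreover have "x1 \<noteq> x2" using distinct_twos[OF d4(3) n(1,3) by'(1) _ _ _ yz(1) x1(1) x2(1)
      x1(3)] ne2 by auto
    ultimately show False
      using no_needy_triangle_two_needy[of x y z b y1 x1 y2 x2] x x1 x2 n ne2 nz yz(3) b d4 by auto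
  qed
qed

lemma three_unique: "d u = 3 \<Longrightarrow> adj u v \<Longrightarrow> adj u v' \<Longrightarrow> d v = 3 \<Longrightarrow> d v' = 3 \<Longrightarrow> v = v'"
  using no_path_3_3_3[of v u v'] adj_symD by blast

lemma hubE:
  assumes "hub w"
  obtains u v where "adj w u" "adj w v" "adj u w" "adj v w" "adj u v" "adj v u" "d u = 3" "d v = 3"
    "d w = 4"
  using assms adj_symD unfolding hub_def by blast

lemma hub_not_needy: "hub w \<Longrightarrow> \<not> needy w"
  using needy_no_3 by (metis hubE)

lemma hub_not_near_needy:
  assumes "hub w" shows "\<not> near_needy w"
proof
  assume "near_needy w"
  then obtain y where y: "adj w y" "needy y" by (auto simp: near_needy_def)
  obtain u v where h: "adj w u" "adj w v" "adj u w" "adj v w" "adj u v" "adj v u" "d u = 3"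
    "d v = 3" "d w = 4" using hubE[OF assms] .
  obtain x where "adj y x" "d x = 2" "d y = 4" using needyE[OF y(2)] by metis
  then show False using no_triangle_needy[of u v w y x] h y(1) by auto
qed

lemma triangle_not_near_needy:
  assumes h: "adj u v" "adj u w" "adj v w" "d u = 3" "d v = 3" "d w = 4" and b: "adj u b" "d b = 4"
    "b \<noteq> w"
  shows "\<not> near_needy b"
proof
  assume "near_needy b"
  then obtain y where y: "adj b y" "needy y" by (auto simp: near_needy_def)
  obtain x where "adj y x" "d x = 2" "d y = 4" using needyE[OF y(2)] by metis
  moreover have "y \<noteq> w" using needy_no_3[OF y(2)] h adj_symD by blast
  ultimately show False using no_triangle_other_needy[of u v w b y x] h b y(1) by auto
qed

lemma hub_three:
  assumes h: "adj u v" "adj u w" "adj v w" "d u = 3" "d v = 3" "d w = 4" and r: "adj w r" "d r = 4"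
    "adj r t" "d t = 3"
  shows "t = u \<or> t = v"
  using no_triangle_hub_three[of u v w r t] assms by auto

lemma hub_not_hub:
  assumes "hub w" "hub r" "adj w r" shows False
proof -
  obtain u v where h: "adj w u" "adj w v" "adj u w" "adj v w" "adj u v" "adj v u" "d u = 3"
    "d v = 3" "d w = 4" using hubE[OF assms(1)] .
  obtain u' v' where h': "adj r u'" "adj r v'" "adj u' r" "adj v' r" "adj u' v'" "adj v' u'"
    "d u' = 3" "d v' = 3" "d r = 4" using hubE[OF assms(2)] .
  have "u' = u \<or> u' = v" "v' = u \<or> v' = v"
    using hub_three[OF h(5,3,4,7,8,9) assms(3) h'(9) h'(1,7)] hub_three[OF h(5,3,4,7,8,9) assms(3)
      h'(9) h'(2,8)] by auto
  moreover have "u' \<noteq> v'" by (rule adj_neq[OF h'(5)])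
  ultimately have "adj u r" "adj v r" using h' by auto
  then show False using no_four_clique[of u v w r] h h'(9) assms(3) by auto
qed

lemma near_hub_one_needy:
  assumes "hub w" "adj w r" "d r = 4" shows "card (needies r) \<le> 1"
proof (rule ccontr)
  assume "\<not> ?thesis"
  then obtain y y' where "y \<in> needies r" "y' \<in> needies r" and ne: "y \<noteq> y'"
    using two_elements[of "needies r"] by auto
  then have n: "adj r y" "needy y" "adj r y'" "needy y'" by (auto simp: needies_def)
  obtain u v where h: "adj w u" "adj w v" "adj u w" "adj v w" "adj u v" "adj v u" "d u = 3"
    "d v = 3" "d w = 4" using hubE[OF assms(1)] .
  obtain x where x: "adj x y" "adj y x" "d x = 2" "d y = 4" using needyE[OF n(2)] by metis
  obtain x' where x': "adj x' y'" "adj y' x'" "d x' = 2" "d y' = 4" using needyE[OF n(4)] by metis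
  have nw: "y \<noteq> w" "y' \<noteq> w" using n hub_not_needy[OF assms(1)] by auto
  show False
    using no_triangle_hub_partners[of u v w r y y' x] no_triangle_hub_two_needy[of u v w r y x y'
      x'] h x x' n ne nw assms(2,3)
    by (cases "x' = x") auto
qed

text \<open>Two hubs next to \<open>r\<close> belong to the same pair of adjacent vertices of degree 3, and each of these two has
  only two neighbours of degree 4.\<close>
lemma card_hubs:
  assumes "d r = 4" shows "card (hubs r) \<le> 2"
proof (rule ccontr)
  assume "\<not> ?thesis"
  then have three: "3 \<le> card (hubs r)" by simp
  then obtain w where w: "w \<in> hubs r" by fastforce
  then have rw: "adj r w" "adj w r" "hub w" using adj_symD by (auto simp: hubs_def)
  obtain u v where h: "adj w u" "adj w v" "adj u w" "adj v w" "adj u v" "adj v u" "d u = 3"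
    "d v = 3" "d w = 4" using hubE[OF rw(3)] .
  have "adj u w'" if w': "w' \<in> hubs r" for w'
  proof (cases "w' = w")
    case False
    have rw': "adj r w'" "hub w'" using w' by (auto simp: hubs_def)
    obtain u' v' where h': "adj w' u'" "adj w' v'" "adj u' w'" "adj v' w'" "adj u' v'" "adj v' u'"
      "d u' = 3" "d v' = 3" "d w' = 4" using hubE[OF rw'(2)] .
    have "u = u' \<or> u = v' \<or> v = u' \<or> v = v'"
      using no_two_hubs[of u v w r w' u' v'] h h' rw rw' assms False by auto
    then show ?thesis
      using h' three_unique[OF h(8,6) _ h(7)] by auto
  qed (use h(3) in simp)
  then have "insert v (hubs r) \<subseteq> nbrs u" using h(5) by auto
  then have "card (insert v (hubs r)) \<le> 3" using card_mono[OF finite_nbrs] card_nbrs h(7) by metis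
  moreover have "v \<notin> hubs r" using h(8) by (auto simp: hubs_def hub_def)
  ultimately show False using three by simp
qed

text \<open>Since \<open>a\<close> is near a needy vertex, it pays just 1 to each neighbour of degree 3. If it has a hub
  neighbour, it has exactly one needy neighbour and none of degree 3.\<close>
lemma share_cases:
  assumes y: "needy y" "adj y a" and a: "d a = 4" "\<not> needy a"
  shows "card (threes a) + card (needies a) \<le> 2 \<Longrightarrow> 1 \<le> share a"
    and "0 \<le> share a" and "threes a = {} \<Longrightarrow> 2 / 3 \<le> share a"
proof -
  have yn: "y \<in> needies a" using y adj_symD by (auto simp: needies_def)
  then have near: "near_needy a" by (auto simp: near_needy_def needies_def)
  have given: "given a = card (threes a)" using amount_near_needy[OF near] by (simp add: given_def)
  have n1: "1 \<le> card (needies a)" using yn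
    by (metis One_nat_def Suc_leI card_gt_0_iff empty_iff finite_nbr_sets(2))
  have t2: "card (threes a) \<le> 2" and n3: "card (needies a) \<le> 3" using card_threes card_needies a
    by auto
  have "1 \<le> share a \<or> share a = (2 - real (card (threes a))) / card (needies a)"
  proof (cases "hubs a = {}")
    case True then show ?thesis by (simp add: share_def given)
  next
    case False
    then obtain w where w: "adj a w" "adj w a" "hub w" using adj_symD by (auto simp: hubs_def)
    obtain u v where h: "adj w u" "adj w v" "adj u w" "adj v w" "adj u v" "adj v u" "d u = 3"
      "d v = 3" "d w = 4" using hubE[OF w(3)] .
    have naw: "a \<noteq> w" using adj_neq[OF w(1)] .
    have "threes a = {}"
    proof (rule ccontr)
      assume "threes a \<noteq> {}"
      then obtain t where t: "adj a t" "d t = 3" by (auto simp: threes_def)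
      then have "t = u \<or> t = v" using hub_three[OF h(5,3,4,7,8,9) w(2) a(1)] by auto
      then have "\<not> near_needy a"
        using triangle_not_near_needy[OF h(5,3,4,7,8,9) _ a(1) naw] triangle_not_near_needy[OF
          h(6,4,3,8,7,9) _ a(1) naw] t(1) adj_symD by blast
      then show False using near by simp
    qed
    moreover have "card (needies a) = 1" using near_hub_one_needy[OF w(3,2) a(1)] n1 by simp
    ultimately show ?thesis using card_hubs[OF a(1)] by (simp add: share_def given)
  qed
  moreover have "card (threes a) + card (needies a) \<le> 2 \<Longrightarrow> 1
    \<le> (2 - real (card (threes a))) / card (needies a)"
    using n1 by (simp add: field_simps)
  moreover have "0 \<le> (2 - real (card (threes a))) / card (needies a)" using t2 by simp
  moreover have "threes a = {} \<Longrightarrow> 2 / 3 \<le> (2 - real (card (threes a))) / card (needies a)"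
    using n1 n3 by (simp add: field_simps)
  ultimately show "card (threes a) + card (needies a) \<le> 2 \<Longrightarrow> 1 \<le> share a" "0 \<le> share a"
    "threes a = {} \<Longrightarrow> 2 / 3 \<le> share a"
    by auto
qed

text \<open>Usually three neighbours pay. Each pays at least \<open>2 / 3\<close> unless one of them has a neighbour of degree 3
  and pays less than 1; in that case the other two pay at least 1 each.\<close>
lemma needy_receives:
  assumes y: "needy y"
  shows "2 \<le> (\<Sum>a | adj y a \<and> d a = 4 \<and> \<not> needy a. share a)"
proof -
  obtain x where x: "adj x y" "adj y x" "d x = 2" "d y = 4" using needyE[OF y] by metis
  have d4: "d a = 4" if "adj y a" "a \<noteq> x" for a using needy_nbr_4[OF y x(1,3)] that by simp
  let ?P = "{a. adj y a \<and> d a = 4 \<and> \<not> needy a}"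
  have fin: "finite ?P" by (rule finite_subset[OF _ finite_nbrs[of y]]) auto
  show ?thesis
  proof (cases "\<exists>z. adj y z \<and> needy z")
    case True
    then obtain z where z: "adj y z" "needy z" by blast
    obtain x' where "adj x' z" "d x' = 2" using needyE[OF z(2)] by metis
    then have xz: "adj x z" using needy_adjacent[OF y z(2,1) x(1,3)] by metis
    have zu: "z' = z" if z': "adj y z'" "needy z'" for z'
    proof -
      obtain x' where "adj x' z'" "d x' = 2" using needyE[OF z'(2)] by metis
      then have "adj x z'" using needy_adjacent[OF y z'(2,1) x(1,3)] by metis
      then show ?thesis using nbrs_of_2[OF x(3,1) xz adj_neq[OF z(1)]] adj_neq[OF z'(1)] by blast
    qed
    have "x \<noteq> z" using x(3) z(2) by (auto simp: needy_def)
    have "a \<in> ?P \<longleftrightarrow> a \<in> nbrs y - {x, z}" for a using d4[of a] zu[of a] z x(3) by auto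
    then have "?P = nbrs y - {x, z}" by blast
    then have card: "card ?P = 2" using card_nbrs[of y] x z \<open>x \<noteq> z\<close> by (simp add: card_Diff_subset)
    have "1 \<le> share a" if a: "a \<in> ?P" for a
    proof -
      have "a \<noteq> x" "a \<noteq> z" using a x(3) z(2) by auto
      then show ?thesis
        using needy_triangle[OF y z(2,1) x(1) xz x(3), of a] share_cases(1)[OF y] a by auto
    qed
    then have "of_nat (card ?P) * 1 \<le> sum share ?P" by (rule sum_bounded_below)
    then show ?thesis using card by simp
  next
    case False
    then have "?P = nbrs y - {x}" using d4 x(3) by auto
    then have card: "card ?P = 3" using card_nbrs[of y] x by simp
    show ?thesis
    proof (cases "\<exists>a \<in> ?P. threes a \<noteq> {} \<and> 3 \<le> card (threes a) + card (needies a)")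
      case True
      then obtain a w where a: "a \<in> ?P" "w \<in> threes a" "3 \<le> card (threes a) + card (needies a)"
        by blast
      have "1 \<le> share b" if b: "b \<in> ?P - {a}" for b
      proof -
        have "threes b = {}" using light_excludes_three[OF y _ a(2,3), of b] a(1) b by blast
        moreover have "card (needies b) \<le> 2"
          using three_excludes_two_needy[OF y _ a(2), of b] a(1) b by fastforce
        ultimately show ?thesis using share_cases(1)[OF y] b by auto
      qed
      then have "of_nat (card (?P - {a})) * 1 \<le> sum share (?P - {a})" by (rule sum_bounded_below)
      moreover have "sum share ?P = share a + sum share (?P - {a})"
        by (rule sum.remove[OF fin a(1)])
      moreover have "0 \<le> share a" using share_cases(2)[OF y] a(1) by auto
      ultimately show ?thesis using card a(1) by simp
    next
      case F: False
      have "2 / 3 \<le> share a" if a: "a \<in> ?P" for a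
      proof (cases "threes a = {}")
        case True then show ?thesis using share_cases(3)[OF y] a by auto
      next
        case False
        then have "card (threes a) + card (needies a) \<le> 2" using F a by fastforce
        then show ?thesis using share_cases(1)[OF y] a by fastforce
      qed
      then have "of_nat (card ?P) * (2 / 3) \<le> sum share ?P" by (rule sum_bounded_below)
      then show ?thesis using card by simp
    qed
  qed
qed

text \<open>The three configurations differ in whether the needy vertices next to \<open>p\<close> and \<open>q\<close> are equal, have a
  common neighbour of degree 2, or neither.\<close>
lemma one_near_needy:
  assumes u: "d u = 3" "adj u v" "d v = 3" and p: "adj u p" "d p = 4" "near_needy p" and q:
    "adj u q" "d q = 4" "near_needy q" and "p \<noteq> q"
  shows False
proof -
  obtain y where y: "adj y p" "adj p y" "needy y" using p(3) adj_symD by (auto simp: near_needy_def)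
  obtain y' where y': "adj y' q" "adj q y'" "needy y'" using q(3) adj_symD
    by (auto simp: near_needy_def)
  obtain x where x: "adj x y" "adj y x" "d x = 2" "d y = 4" using needyE[OF y(3)] by metis
  obtain x' where x': "adj x' y'" "adj y' x'" "d x' = 2" "d y' = 4" using needyE[OF y'(3)] by metis
  have pu: "adj p u" "adj q u" using p(1) q(1) adj_symD by auto
  have ne: "y \<noteq> q" "y' \<noteq> p" using needy_no_3[OF y(3)] needy_no_3[OF y'(3)] pu u(1) by auto
  show False
  proof (cases "y = y'")
    case True
    then show False using no_pair_same_needy[of x y p u q v] x y y' u p q pu \<open>p \<noteq> q\<close> ne by auto
  next
    case neq: False
    show False
    proof (cases "x' = x")
      case True
      then show False using no_pair_partner_needy[of x y p u q y' v] x x' y y' u p q pu \<open>p \<noteq> q\<close> ne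
        neq by auto
    next
      case False
      then show False using no_pair_between_needy[of x y p u v q y' x'] x x' y y' u p q pu \<open>p \<noteq> q\<close>
        ne neq by auto
    qed
  qed
qed

text \<open>A needy vertex pays to its neighbour of degree 2 only, and a hub only to its two neighbours of degree 3.\<close>
definition send :: "'a \<Rightarrow> 'a \<Rightarrow> real" where
  "send a b =
     (if \<not> adj a b \<or> d a \<noteq> 4 then 0
      else if needy a then (if d b = 2 then 4 else 0)
      else if d b = 3 then amount a b
      else if hub a then 0
      else if needy b then share a
      else if hub b then 1 / 2
      else 0)"

lemma charge_2:
  assumes "d x = 2"
  shows "(\<Sum>u \<in> nbrs x. send u x) = 8" "(\<Sum>u \<in> nbrs x. send x u) = 0"
proof -
  have "send u x = 4" if u: "u \<in> nbrs x" for u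
  proof -
    have "adj u x" "d u = 4" "needy u" using u nbr_of_2[of x u] assms adj_symD
      by (auto simp: needy_def)
    then show ?thesis using assms by (simp add: send_def)
  qed
  then show "(\<Sum>u \<in> nbrs x. send u x) = 8" using card_nbrs[of x] assms by simp
  show "(\<Sum>u \<in> nbrs x. send x u) = 0" using assms by (simp add: send_def)
qed

lemma charge_3:
  assumes u: "d u = 3"
  shows "(\<Sum>a \<in> nbrs u. send a u) = 3" "(\<Sum>a \<in> nbrs u. send u a) = 0"
proof -
  have send: "send a u = (if d a = 4 then amount a u else 0)" if a: "adj u a" for a
    using needy_no_3[of a u] a u adj_symD[of u a] by (auto simp: send_def)
  show "(\<Sum>a \<in> nbrs u. send a u) = 3"
  proof (cases "\<forall>v. adj u v \<longrightarrow> d v \<noteq> 3")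
    case True
    then have "send a u = 1" if "a \<in> nbrs u" for a using send[of a] nbr_of_3[of u a] that u
      by (auto simp: amount_def)
    then show ?thesis using card_nbrs[of u] u by simp
  next
    case False
    then obtain v where v: "adj u v" "d v = 3" by blast
    then have "card (nbrs u - {v}) = 2" using card_nbrs[of u] u by simp
    then obtain p q where pq: "nbrs u - {v} = {p, q}" "p \<noteq> q" by (auto simp: card_2_iff)
    have "p \<in> nbrs u - {v}" "q \<in> nbrs u - {v}" unfolding pq(1) by simp_all
    then have adj: "adj u p" "adj u q" and ne: "v \<noteq> p" "v \<noteq> q" by simp_all blast+
    have "v \<in> nbrs u" using v(1) by simp
    then have n: "nbrs u = {v, p, q}" "v \<noteq> p" "v \<noteq> q" using insert_Diff[of v "nbrs u"] pq(1) ne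
      by simp_all
    have d4: "d p = 4" "d q = 4"
      using nbr_of_3[OF adj(1) u] nbr_of_3[OF adj(2) u] three_unique[OF u v(1) adj(1) v(2)]
        three_unique[OF u v(1) adj(2) v(2)] n(2,3) by auto
    have other: "(\<exists>b. adj u b \<and> b \<noteq> p \<and> d b = 4 \<and> near_needy b) \<longleftrightarrow> near_needy q"
      "(\<exists>b. adj u b \<and> b \<noteq> q \<and> d b = 4 \<and> near_needy b) \<longleftrightarrow> near_needy p"
    proof -
      have "b = v \<or> b = p \<or> b = q" if "adj u b" for b using n(1) that nbrs_iff[of b u] by blast
      moreover have "d v \<noteq> 4" using v(2) by simp
      ultimately show "(\<exists>b. adj u b \<and> b \<noteq> p \<and> d b = 4 \<and> near_needy b) \<longleftrightarrow> near_needy q"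
        "(\<exists>b. adj u b \<and> b \<noteq> q \<and> d b = 4 \<and> near_needy b) \<longleftrightarrow> near_needy p"
        using adj d4 pq(2) by blast+
    qed
    have "amount p u + amount q u = 3"
      using one_near_needy[OF u v adj(1) d4(1) _ adj(2) d4(2) _ pq(2)] False other
        by (auto simp: amount_def)
    moreover have "send v u = 0" using send[OF v(1)] v(2) by simp
    ultimately show ?thesis using send[OF adj(1)] send[OF adj(2)] d4 n pq(2) by simp
  qed
  show "(\<Sum>a \<in> nbrs u. send u a) = 0" using u by (simp add: send_def)
qed

lemma charge_needy:
  assumes y: "needy y"
  shows "2 \<le> (\<Sum>a \<in> nbrs y. send a y)" "(\<Sum>a \<in> nbrs y. send y a) = 4"
proof -
  obtain x where x: "adj x y" "adj y x" "d x = 2" "d y = 4" using needyE[OF y] by metis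
  have "send y a = (if a = x then 4 else 0)" if "a \<in> nbrs y" for a
    using that needy_nbr_4[OF y x(1,3), of a] x y by (auto simp: send_def)
  then have "(\<Sum>a \<in> nbrs y. send y a) = (\<Sum>a \<in> nbrs y. if a = x then 4 else 0)"
    by (rule sum.cong[OF refl])
  then show "(\<Sum>a \<in> nbrs y. send y a) = 4" using x(2) by simp
  have "send a y = (if d a = 4 \<and> \<not> needy a then share a else 0)" if a: "a \<in> nbrs y" for a
  proof -
    have "adj a y" using a adj_symD by auto
    moreover have "\<not> hub a" using hub_not_near_needy[of a] \<open>adj a y\<close> y
      by (auto simp: near_needy_def)
    ultimately show ?thesis using y x(4) by (auto simp: send_def)
  qed
  then have "(\<Sum>a \<in> nbrs y. send a y) = (\<Sum>a \<in> nbrs y. if d a = 4 \<and> \<not> needy a then share a else 0)"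
    by (rule sum.cong[OF refl])
  also have "\<dots> = (\<Sum>a \<in> {a \<in> nbrs y. d a = 4 \<and> \<not> needy a}. share a)"
    by (rule sum.inter_filter[symmetric]) simp
  also have "{a \<in> nbrs y. d a = 4 \<and> \<not> needy a} = {a. adj y a \<and> d a = 4 \<and> \<not> needy a}" by auto
  finally show "2 \<le> (\<Sum>a \<in> nbrs y. send a y)" using needy_receives[OF y] by simp
qed

lemma amount_hub:
  assumes h: "adj u v" "adj u w" "adj v w" "d u = 3" "d v = 3" "d w = 4"
  shows "amount w u = 3 / 2"
proof -
  have "hub w" unfolding hub_def using h h(2,3)[THEN adj_symD] by blast
  then show ?thesis
    using triangle_not_near_needy[OF h] hub_not_near_needy[of w] h by (auto simp: amount_def)
qed

lemma charge_hub:
  assumes w: "hub w"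
  shows "(\<Sum>a \<in> nbrs w. send a w) = 1" "(\<Sum>a \<in> nbrs w. send w a) = 3"
proof -
  obtain u v where h: "adj w u" "adj w v" "adj u w" "adj v w" "adj u v" "adj v u" "d u = 3"
    "d v = 3" "d w = 4" using hubE[OF w] .
  have uv: "u \<noteq> v" by (rule adj_neq[OF h(5)])
  have "card (nbrs w - {u, v}) = 2" using card_nbrs[of w] h uv by (simp add: card_Diff_subset)
  then obtain r s where rs: "nbrs w - {u, v} = {r, s}" "r \<noteq> s" by (auto simp: card_2_iff)
  have rsn: "r \<in> nbrs w - {u, v}" "s \<in> nbrs w - {u, v}" unfolding rs(1) by simp_all
  then have r: "adj w r" "adj w s" "r \<notin> {u, v}" "s \<notin> {u, v}" by simp_all
  have "{u, v} \<subseteq> nbrs w" using h by simp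
  then have "nbrs w = {u, v} \<union> (nbrs w - {u, v})" by blast
  then have n: "nbrs w = {u, v, r, s}" unfolding rs(1)
    by (simp only: insert_is_Un[symmetric] Un_insert_left Un_empty_left)
  have r4: "d t = 4" "\<not> needy t" "\<not> hub t" if t: "adj w t" "t \<notin> {u, v}" for t
  proof -
    show "\<not> needy t" using hub_not_near_needy[OF w] t by (auto simp: near_needy_def)
    show "\<not> hub t" using hub_not_hub[OF w _ t(1)] by blast
    have "d t \<noteq> 3"
    proof
      assume "d t = 3"
      then have "{u, v, t} \<subseteq> threes w" using h t by (auto simp: threes_def)
      then have "card {u, v, t} \<le> 2"
        using card_mono[OF finite_nbr_sets(1)] card_threes[OF h(9)] le_trans by blast
      then show False using uv t(2) by auto
    qed
    moreover have "d t \<noteq> 2" using hub_not_needy[OF w] t(1) h(9) by (auto simp: needy_def)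
    ultimately show "d t = 4" using degree_cases[of t] adj_verts[OF t(1)] by auto
  qed
  have nn: "\<not> needy w" by (rule hub_not_needy[OF w])
  have "send r w = 1 / 2" "send s w = 1 / 2" "send u w = 0" "send v w = 0"
    using r4[OF r(1,3)] r4[OF r(2,4)] r(1,2)[THEN adj_symD] h w nn by (simp_all add: send_def)
  moreover have dist: "distinct [u, v, r, s]" using uv rs(2) r(3,4) by auto
  ultimately show "(\<Sum>a \<in> nbrs w. send a w) = 1" unfolding n by simp
  have "send w r = 0" "send w s = 0" "send w u = 3 / 2" "send w v = 3 / 2"
    using r4[OF r(1,3)] r4[OF r(2,4)] r(1,2) h w nn amount_hub[OF h(5,3,4,7,8,9)] amount_hub[OF
      h(6,4,3,8,7,9)] by (auto simp: send_def)
  then show "(\<Sum>a \<in> nbrs w. send w a) = 3" unfolding n using dist by simp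
qed

text \<open>A vertex \<open>a\<close> that is not a hub is not adjacent to both ends of a pair of adjacent vertices of degree 3. So
  if it pays more than 1 to some neighbour of degree 3, this is its only one. If it has a hub neighbour as
  well, the two belong to the same triangle, and \<open>a\<close> pays \<open>3 / 2\<close> and \<open>1 / 2\<close>.\<close>
lemma plain_budget:
  assumes a: "d a = 4" "\<not> hub a"
  shows "given a + card (hubs a) / 2 \<le> 2"
proof (cases "threes a = {}")
  case True
  then show ?thesis using card_hubs[OF a(1)] by (simp add: given_def)
next
  case False
  have single: "threes a = {t}" if t: "t \<in> threes a" "adj t v" "d v = 3" for t v
  proof -
    have t': "adj a t" "adj t a" "d t = 3" using t(1) adj_symD by (auto simp: threes_def)
    have "\<not> adj a v" using a t t' adj_symD unfolding hub_def by blast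
    have "s = t" if s: "s \<in> threes a" for s
      using no_path_3_3_4_3[of v t a s] s t t' a \<open>\<not> adj a v\<close> adj_symD by (auto simp: threes_def)
    then show ?thesis using t(1) by blast
  qed
  show ?thesis
  proof (cases "hubs a = {}")
    case True
    show ?thesis
    proof (cases "\<exists>t v. t \<in> threes a \<and> adj t v \<and> d v = 3")
      case True
      then obtain t where "threes a = {t}" using single by blast
      moreover have "amount a t \<le> 2" by (simp add: amount_def)
      ultimately show ?thesis using \<open>hubs a = {}\<close> by (simp add: given_def)
    next
      case False
      then have "given a = (\<Sum>t \<in> threes a. 1)" unfolding given_def
        by (intro sum.cong[OF refl]) (auto simp: amount_def)
      then show ?thesis using card_threes[OF a(1)] \<open>hubs a = {}\<close> by simp
    qed
  next
    case nh: False
    obtain t where t: "t \<in> threes a" using False by blast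
    then have t': "adj a t" "adj t a" "d t = 3" using adj_symD by (auto simp: threes_def)
    have hub_of: "\<exists>v. adj t v \<and> adj t w \<and> adj v w \<and> d v = 3 \<and> d w = 4" if w: "w \<in> hubs a" for w
    proof -
      have w': "adj a w" "adj w a" "hub w" using w adj_symD by (auto simp: hubs_def)
      obtain u v where h: "adj w u" "adj w v" "adj u w" "adj v w" "adj u v" "adj v u" "d u = 3"
        "d v = 3" "d w = 4" using hubE[OF w'(3)] .
      have "t = u \<or> t = v" by (rule hub_three[OF h(5,3,4,7,8,9) w'(2) a(1) t'(1,3)])
      then show ?thesis using h by blast
    qed
    obtain w where w: "w \<in> hubs a" using nh by blast
    then have aw: "adj a w" "hub w" by (auto simp: hubs_def)
    obtain v where v: "adj t v" "adj t w" "adj v w" "d v = 3" "d w = 4" using hub_of[OF w] by blast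
    have ne: "v \<noteq> w" "v \<noteq> a" "w \<noteq> a" using v a(1) adj_neq[OF aw(1)] by auto
    have nt: "b = v \<or> b = w \<or> b = a" if "adj t b" for b
      by (rule nbrs_of_3[OF t'(3) v(1,2) t'(2) ne that])
    have "w' = w" if w': "w' \<in> hubs a" for w'
    proof -
      have "adj t w'" "d w' = 4" "adj a w'" using hub_of[OF w'] w' by (auto simp: hubs_def)
      then show ?thesis using nt[of w'] v(4) adj_neq[of a w'] by auto
    qed
    then have hw: "hubs a = {w}" using w by blast
    have "\<not> near_needy b" if b: "adj t b" "b \<noteq> a" "d b = 4" for b
      using nt[OF b(1)] b hub_not_near_needy[OF aw(2)] v(4) by auto
    then have "amount a t \<le> 3 / 2" using v(1,4) by (auto simp: amount_def)
    then show ?thesis using single[OF t v(1,4)] hw by (simp add: given_def)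
  qed
qed

lemma charge_plain:
  assumes a: "d a = 4" "\<not> needy a" "\<not> hub a"
  shows "(\<Sum>b \<in> nbrs a. send b a) = 0" "(\<Sum>b \<in> nbrs a. send a b) \<le> 2"
proof -
  show "(\<Sum>b \<in> nbrs a. send b a) = 0" using a by (intro sum.neutral) (auto simp: send_def)
  have "send a b = (if d b = 3 then amount a b else 0) + (if needy b then share a else 0)
    + (if hub b then 1 / 2 else 0)"
    if b: "b \<in> nbrs a" for b
  proof -
    have "adj a b" using b by simp
    moreover have "needy b \<Longrightarrow> d b \<noteq> 3" "hub b \<Longrightarrow> d b \<noteq> 3" by (simp_all add: needy_def hub_def)
    ultimately show ?thesis
      using a hub_not_needy[of b]
        by (cases "d b = 3"; cases "needy b"; cases "hub b") (simp_all add: send_def)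
  qed
  then have "(\<Sum>b \<in> nbrs a. send a b) =
      (\<Sum>b \<in> nbrs a. (if d b = 3 then amount a b else 0) + (if needy b then share a else 0) + (if hub
        b then 1 / 2 else 0))"
    by (rule sum.cong[OF refl])
  also have "\<dots> = (\<Sum>b \<in> nbrs a. if d b = 3 then amount a b else 0)
    + (\<Sum>b \<in> nbrs a. if needy b then share a else 0) + (\<Sum>b \<in> nbrs a. if hub b then 1 / 2 else 0)"
    by (simp add: sum.distrib)
  also have "(\<Sum>b \<in> nbrs a. if d b = 3 then amount a b else 0) = given a"
    unfolding given_def by (subst sum.inter_filter[symmetric]) (simp_all add: threes_def)
  also have "(\<Sum>b \<in> nbrs a. if needy b then share a else 0) = card (needies a) * share a"
    by (subst sum.inter_filter[symmetric]) (simp_all add: needies_def)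
  also have "(\<Sum>b \<in> nbrs a. if hub b then 1 / 2 else 0) = card (hubs a) / (2::real)"
    by (subst sum.inter_filter[symmetric]) (simp_all add: hubs_def)
  finally have out: "(\<Sum>b \<in> nbrs a. send a b) = given a + card (needies a) * share a
    + card (hubs a) / 2" .
  show "(\<Sum>b \<in> nbrs a. send a b) \<le> 2"
  proof (cases "card (needies a) = 0")
    case True then show ?thesis using out plain_budget[OF a(1,3)] by simp
  next
    case False
    then have "card (needies a) * share a = 2 - given a - card (hubs a) / 2"
      by (simp add: share_def)
    then show ?thesis using out by simp
  qed
qed

lemma final_charge:
  assumes v: "v \<in> verts G"
  shows "0 \<le> 5 * real (d v) - 18 + (\<Sum>u \<in> nbrs v. send u v) - (\<Sum>u \<in> nbrs v. send v u)"
proof -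
  consider "d v = 2" | "d v = 3" | "needy v" "d v = 4" | "hub v" "d v = 4" | "d v = 4" "\<not> needy v"
    "\<not> hub v"
    using degree_cases[OF v] by blast
  then show ?thesis
    by cases (use charge_2[of v] charge_3[of v] charge_needy[of v] charge_hub[of v] charge_plain[of
      v] in auto)
qed

lemma handshake: "(\<Sum>v \<in> verts G. d v) = 2 * card (edges G)"
proof -
  have "(\<Sum>v \<in> verts G. d v) = (\<Sum>v \<in> verts G. \<Sum>e \<in> edges G. if v \<in> e then 1 else 0)"
    unfolding degree_def using finite_edges
      by (intro sum.cong[OF refl]) (simp add: sum.If_cases Int_def)
  also have "\<dots> = (\<Sum>e \<in> edges G. \<Sum>v \<in> verts G. if v \<in> e then 1 else 0)" by (rule sum.swap)
  also have "\<dots> = (\<Sum>e \<in> edges G. 2)"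
  proof (rule sum.cong[OF refl])
    fix e assume e: "e \<in> edges G"
    have "verts G \<inter> {v. v \<in> e} = e" using edge_verts[OF e] by auto
    then show "(\<Sum>v \<in> verts G. if v \<in> e then 1 else 0) = (2::nat)" using edge_card[OF e] finite_verts
      by (simp add: sum.If_cases)
  qed
  finally show ?thesis by simp
qed

theorem average_degree_ge: "3.6 \<le> average_degree G"
proof -
  have loc: "(\<Sum>u \<in> verts G. send u v) = (\<Sum>u \<in> nbrs v. send u v)"
    "(\<Sum>u \<in> verts G. send v u) = (\<Sum>u \<in> nbrs v. send v u)" for v
    by (rule sum.mono_neutral_right[OF finite_verts]; use adj_verts adj_symD in
      \<open>auto simp: send_def\<close>)+
  have "0 \<le> (\<Sum>v \<in> verts G. 5 * real (d v) - 18
    + (\<Sum>u \<in> verts G. send u v) - (\<Sum>u \<in> verts G. send v u))"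
    unfolding loc by (rule sum_nonneg) (rule final_charge)
  also have "\<dots> = 5 * real (\<Sum>v \<in> verts G. d v) - 18 * card (verts G)
    + (\<Sum>v \<in> verts G. \<Sum>u \<in> verts G. send u v) - (\<Sum>v \<in> verts G. \<Sum>u \<in> verts G. send v u)"
    by (simp add: sum.distrib sum_subtractf sum_distrib_left)
  also have "(\<Sum>v \<in> verts G. \<Sum>u \<in> verts G. send u v) = (\<Sum>v \<in> verts G. \<Sum>u \<in> verts G. send v u)"
    by (rule sum.swap)
  finally have "18 * real (card (verts G)) \<le> 10 * card (edges G)" by (simp add: handshake)
  moreover have "0 < card (verts G)"
    using critical finite_verts by (auto simp: edge_critical_def connected_graph_def card_gt_0_iff)
  ultimately show ?thesis by (simp add: average_degree_def field_simps)
qed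

end

section \<open>Sharpness\<close>

lemma complete_minus_edge_vertices:
  assumes "e \<subseteq> {..<5::nat}" "card e = 2" "f \<subseteq> {..<5}" "card f = 2" "e \<noteq> f"
  obtains (touch) a b c p q where "distinct [a, b, c, p, q]" "set [a, b, c, p, q] = {..<5}"
    "e = {a, b}" "f = {a, c}"
  | (apart) a b c p q where "distinct [a, b, c, p, q]" "set [a, b, c, p, q] = {..<5}" "e = {a, b}"
    "f = {c, p}"
proof -
  obtain a b where e: "e = {a, b}" "a \<noteq> b" using assms(2) by (auto simp: card_2_iff)
  obtain c p where f: "f = {c, p}" "c \<noteq> p" using assms(4) by (auto simp: card_2_iff)
  have rest: "\<exists>xs. distinct (ys @ xs) \<and> set (ys @ xs) = {..<5} \<and> length xs = 5 - length ys"
    if ys: "distinct ys" "set ys \<subseteq> {..<5}" for ys :: "nat list"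
  proof -
    obtain xs where xs: "set xs = {..<5} - set ys" "distinct xs"
      using finite_distinct_list[of "{..<5} - set ys"] by auto
    then have "distinct (ys @ xs)" "set (ys @ xs) = {..<5}" using ys by auto
    moreover from this have "length (ys @ xs) = 5" using distinct_card[of "ys @ xs"] by simp
    ultimately show ?thesis by (intro exI[of _ xs]) auto
  qed
  have touching: thesis if "e = {a', b'}" "f = {a', c'}" "distinct [a', b', c']" for a' b' c'
  proof -
    have "set [a', b', c'] \<subseteq> {..<5}" using that assms by auto
    from rest[OF that(3) this] obtain xs
      where xs: "distinct ([a', b', c'] @ xs)" "set ([a', b', c'] @ xs) = {..<5}"
        "length xs = 5 - length [a', b', c']"
      by blast
    then obtain p' q' where "xs = [p', q']" by (auto simp: length_Suc_conv numeral_2_eq_2)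
    then show thesis using touch[of a' b' c' p' q'] xs that by auto
  qed
  show thesis
  proof (cases "{a, b} \<inter> {c, p} = {}")
    case True
    have "distinct [a, b, c, p]" "set [a, b, c, p] \<subseteq> {..<5}" using True e f assms by auto
    from rest[OF this] obtain xs
      where xs: "distinct ([a, b, c, p] @ xs)" "set ([a, b, c, p] @ xs) = {..<5}"
        "length xs = 5 - length [a, b, c, p]"
      by blast
    then obtain q where "xs = [q]" by (auto simp: length_Suc_conv)
    then show thesis using apart[of a b c p q] xs e f by auto
  next
    case False
    then consider "a = c" | "a = p" | "b = c" | "b = p" by auto
    then show thesis
      using touching[of a b p] touching[of a b c] touching[of b a p] touching[of b a c] e f assms(5)
      by cases (auto simp: insert_commute)
  qed
qed

lemma complete_5_edges:
  assumes "distinct [a, b, c, p, q]" "set [a, b, c, p, q] = {..<5::nat}"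
  shows "edges (complete_graph 5) = {{a,b},{a,c},{a,p},{a,q},{b,c},{b,p},{b,q},{c,p},{c,q},{p,q}}"
proof (intro set_eqI iffI)
  fix e assume "e \<in> edges (complete_graph 5)"
  then obtain u v where "e = {u, v}" "u \<noteq> v" "u \<in> {..<5}" "v \<in> {..<5}"
    by (auto simp: complete_graph_def card_2_iff)
  then show "e \<in> {{a,b},{a,c},{a,p},{a,q},{b,c},{b,p},{b,q},{c,p},{c,q},{p,q}}"
    unfolding assms(2)[symmetric] by (auto simp: doubleton_eq_iff)
next
  fix e assume "e \<in> {{a,b},{a,c},{a,p},{a,q},{b,c},{b,p},{b,q},{c,p},{c,q},{p,q}}"
  then obtain u v where "e = {u, v}" "u \<noteq> v" "u \<in> set [a, b, c, p, q]" "v \<in> set [a, b, c, p, q]"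
    using assms(1) by fastforce
  then show "e \<in> edges (complete_graph 5)" unfolding assms(2) by (simp add: complete_graph_def)
qed

lemma degree_complete_5:
  assumes "x < 5" shows "degree (complete_graph 5) x = 4"
proof -
  have "{f \<in> edges (complete_graph 5). x \<in> f} = (\<lambda>y. {x, y}) ` ({..<5} - {x})" (is "?L = ?R")
  proof (intro set_eqI iffI)
    fix f assume "f \<in> ?L"
    then have f: "f \<subseteq> {..<5}" "card f = 2" "x \<in> f" by (auto simp: complete_graph_def)
    then obtain y where "f = {x, y}" "y \<noteq> x" by (auto simp: card_2_iff)
    then show "f \<in> ?R" using f(1) by auto
  next
    fix f assume "f \<in> ?R"
    then show "f \<in> ?L" using assms by (auto simp: complete_graph_def)
  qed
  moreover have "inj_on (\<lambda>y. {x, y}) ({..<5} - {x})"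
    by (auto intro!: inj_onI simp: doubleton_eq_iff)
  ultimately show ?thesis using assms by (simp add: degree_def card_image)
qed

lemma colouring_of_matchings:
  assumes cover: "E \<subseteq> \<Union> (set Ms)" and match:
    "\<And>M e f. M \<in> set Ms \<Longrightarrow> e \<in> M \<Longrightarrow> f \<in> M \<Longrightarrow> e \<noteq> f \<Longrightarrow> e \<inter> f = {}"
  shows "\<exists>\<phi>. colouring (length Ms) E \<phi>"
proof -
  have "\<forall>e \<in> E. \<exists>i < length Ms. e \<in> Ms ! i" using cover by (metis UnionE in_set_conv_nth subsetD)
  then obtain \<phi> where "\<forall>e \<in> E. \<phi> e < length Ms \<and> e \<in> Ms ! \<phi> e" by metis
  then have "colouring (length Ms) E \<phi>" unfolding colouring_def using match
    by (metis image_subsetI lessThan_iff nth_mem)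
  then show ?thesis by blast
qed

lemma complete_5_minus_two_colourable:
  assumes "e \<in> edges (complete_graph 5)" "f \<in> edges (complete_graph 5)" "e \<noteq> f"
  shows "\<exists>\<phi>. colouring 4 (edges (complete_graph 5) - {e} - {f}) \<phi>"
proof -
  have ef: "e \<subseteq> {..<5}" "card e = 2" "f \<subseteq> {..<5}" "card f = 2" using assms
    by (auto simp: complete_graph_def)
  from ef assms(3) show ?thesis
  proof (cases rule: complete_minus_edge_vertices)
    case (touch a b c p q)
    let ?Ms = "[{{a,p},{c,q}}, {{a,q},{b,p}}, {{b,c},{p,q}}, {{b,q},{c,p}}]"
    have "\<exists>\<phi>. colouring (length ?Ms) (edges (complete_graph 5) - {e} - {f}) \<phi>"
    proof (rule colouring_of_matchings)
      show "edges (complete_graph 5) - {e} - {f} \<subseteq> \<Union> (set ?Ms)"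
        unfolding complete_5_edges[OF touch(1,2)] touch(3,4) by auto
    qed (use touch(1) in auto)
    then show ?thesis by (simp add: numeral_eq_Suc)
  next
    case (apart a b c p q)
    let ?Ms = "[{{a,c},{b,q}}, {{a,p},{c,q}}, {{a,q},{b,p}}, {{b,c},{p,q}}]"
    have "\<exists>\<phi>. colouring (length ?Ms) (edges (complete_graph 5) - {e} - {f}) \<phi>"
    proof (rule colouring_of_matchings)
      show "edges (complete_graph 5) - {e} - {f} \<subseteq> \<Union> (set ?Ms)"
        unfolding complete_5_edges[OF apart(1,2)] apart(3,4) by auto
    qed (use apart(1) in auto)
    then show ?thesis by (simp add: numeral_eq_Suc)
  qed
qed

lemma edges_le_matchings:
  assumes col: "colouring k E \<phi>" and V: "finite V" "\<And>e. e \<in> E \<Longrightarrow> e \<subseteq> V \<and> card e = 2"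
  shows "card E \<le> k * (card V div 2)"
proof -
  have finE: "finite E" using V by (meson Pow_iff finite_Pow_iff finite_subset subsetI)
  have bound: "card {e \<in> E. \<phi> e = i} \<le> card V div 2" for i
  proof -
    let ?M = "{e \<in> E. \<phi> e = i}"
    have disj: "pairwise disjnt ?M" using col unfolding colouring_def pairwise_def disjnt_def
      by blast
    have fin: "finite e" if "e \<in> ?M" for e using that V finite_subset by blast
    have "card (\<Union> ?M) = sum card ?M" using disj fin by (rule card_Union_disjoint)
    also have "\<dots> = (\<Sum>e \<in> ?M. 2)" using V(2) by (intro sum.cong[OF refl]) simp
    finally have "card (\<Union> ?M) = 2 * card ?M" by simp
    moreover have "card (\<Union> ?M) \<le> card V" using V by (intro card_mono) auto
    ultimately show ?thesis by simp
  qed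
  have "card E = (\<Sum>i<k. card {e \<in> E. \<phi> e = i})"
    using sum.group[OF finE finite_lessThan, of \<phi> k "\<lambda>_. 1::nat"] col by (simp add: colouring_def)
  also have "\<dots> \<le> (\<Sum>i<k. card V div 2)" using bound by (rule sum_mono)
  finally show ?thesis by simp
qed

lemma complete_5_minus_edge:
  assumes e: "e \<in> edges (complete_graph 5)"
  shows "edge_critical (delete_edge e (complete_graph 5))"
    and "max_degree (delete_edge e (complete_graph 5)) = 4"
    and "average_degree (delete_edge e (complete_graph 5)) = 3.6"
proof -
  let ?H = "delete_edge e (complete_graph 5)"
  obtain a b where ab: "e = {a, b}" "a \<noteq> b" "a < 5" "b < 5" using e
    by (auto simp: complete_graph_def card_2_iff)
  have "\<exists>f. f \<subseteq> {..<5::nat} \<and> card f = 2 \<and> f \<noteq> e"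
    by (rule exI[of _ "if e = {0,1} then {0,2} else {0,1}"]) (auto simp: doubleton_eq_iff)
  then obtain f where "f \<subseteq> {..<5::nat}" "card f = 2" "e \<noteq> f" by blast
  then obtain c p q where v: "distinct [a, b, c, p, q]" "set [a, b, c, p, q] = {..<5}"
  proof -
    obtain xs where xs: "set xs = {..<5} - {a, b}" "distinct xs"
      using finite_distinct_list[of "{..<5} - {a, b}"] by auto
    have "length xs = 3" using distinct_card[OF xs(2)] xs(1) ab by (simp add: card_Diff_subset)
    then obtain c p q where "xs = [c, p, q]" by (auto simp: length_Suc_conv numeral_3_eq_3)
    then show thesis using that[of c p q] xs ab by auto
  qed
  have V: "verts ?H = {a, b, c, p, q}" "verts ?H = {..<5}" using v(2)
    by (simp_all add: delete_edge_def complete_graph_def)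
  have E: "edges ?H = {{a,c},{a,p},{a,q},{b,c},{b,p},{b,q},{c,p},{c,q},{p,q}}"
    unfolding delete_edge_def ugraph.simps complete_5_edges[OF v] ab(1) using v(1)
      by (auto simp: doubleton_eq_iff)
  have cardE: "card (edges ?H) = 9" unfolding E using v(1) by (simp add: doubleton_eq_iff)
  have simple: "finite_simple_graph ?H"
    by (auto simp: finite_simple_graph_def delete_edge_def complete_graph_def)
  have dle: "degree ?H x \<le> 4" if "x \<in> verts ?H" for x
  proof -
    have "{f \<in> edges ?H. x \<in> f} \<subseteq> {f \<in> edges (complete_graph 5). x \<in> f}"
      by (auto simp: delete_edge_def)
    then have "degree ?H x \<le> degree (complete_graph 5) x" unfolding degree_def
      by (rule card_mono[rotated]) (simp add: complete_graph_def)
    then show ?thesis using degree_complete_5[of x] that V(2) by simp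
  qed
  have dc: "degree ?H c = 4"
  proof -
    have "{f \<in> edges ?H. c \<in> f} = {f \<in> edges (complete_graph 5). c \<in> f}" using ab(1) v(1)
      by (auto simp: delete_edge_def)
    moreover have "c < 5" using V by auto
    ultimately show ?thesis using degree_complete_5[of c] by (simp add: degree_def)
  qed
  show max: "max_degree ?H = 4" unfolding max_degree_def
  proof (rule Max_eqI)
    have "c \<in> verts ?H" by (simp add: V(1))
    then show "4 \<in> degree ?H ` verts ?H" using dc by force
  qed (use dle V in auto)
  show "average_degree ?H = 3.6" using V(2) by (simp add: average_degree_def cardE)
  have conn: "connected_graph ?H"
  proof -
    let ?R = "{(x, y). {x, y} \<in> edges ?H}"
    have "(x, c) \<in> ?R\<^sup>* \<and> (c, x) \<in> ?R\<^sup>*" if "x \<in> verts ?H" for x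
    proof (cases "x = c")
      case False
      then have "{x, c} \<in> edges ?H" using that unfolding V(1) E by (auto simp: doubleton_eq_iff)
      moreover have "{x, c} = {c, x}" by blast
      ultimately have "(x, c) \<in> ?R" "(c, x) \<in> ?R" by simp_all
      then show ?thesis by (intro conjI r_into_rtrancl)
    qed auto
    then have "(x, y) \<in> ?R\<^sup>*" if "x \<in> verts ?H" "y \<in> verts ?H" for x y
      using that rtrancl_trans[of x c ?R y] by blast
    moreover have "verts ?H \<noteq> {}" unfolding V(1) by simp
    ultimately show ?thesis unfolding connected_graph_def by blast
  qed
  have chi: "chromatic_index ?H > 4"
  proof (rule ccontr)
    assume "\<not> ?thesis"
    moreover obtain \<phi> where "colouring (chromatic_index ?H) (edges ?H) \<phi>"
      using chromatic_index_attained[OF simple]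
        by (auto simp: proper_edge_coloring_def colouring_def)
    then have "card (edges ?H) \<le> chromatic_index ?H * (card {..<5::nat} div 2)"
      using simple V(2) by (intro edges_le_matchings) (auto simp: finite_simple_graph_def)
    ultimately show False by (simp add: cardE)
  qed
  have crit: "chromatic_index (delete_edge f ?H) \<le> 4" if f: "f \<in> edges ?H" for f
  proof -
    have "f \<in> edges (complete_graph 5)" "e \<noteq> f" using f by (auto simp: delete_edge_def)
    then obtain \<phi> where "colouring 4 (edges (complete_graph 5) - {e} - {f}) \<phi>"
      using complete_5_minus_two_colourable[OF e] by blast
    then have "proper_edge_coloring (delete_edge f ?H) 4 \<phi>"
      by (simp add: proper_edge_coloring_def colouring_def delete_edge_def)
    then show ?thesis unfolding chromatic_index_def by (intro Least_le) blast
  qed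
  show "edge_critical ?H" unfolding edge_critical_def max using simple conn chi crit by blast
qed

section \<open>The bound and its sharpness\<close>

theorem theorem6p1:
  fixes G :: "'a ugraph"
  shows "(edge_critical G \<and> max_degree G = 4 \<longrightarrow> average_degree G \<ge> 3.6) \<and>
         (\<forall>e \<in> edges (complete_graph 5).
            edge_critical (delete_edge e (complete_graph 5)) \<and>
            max_degree (delete_edge e (complete_graph 5)) = 4 \<and>
            average_degree (delete_edge e (complete_graph 5)) = 3.6)"
proof (intro conjI impI ballI)
  assume "edge_critical G \<and> max_degree G = 4"
  then interpret critical_graph G by unfold_locales auto
  show "average_degree G \<ge> 3.6" by (rule average_degree_ge)
qed (fact complete_5_minus_edge)+

end
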